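(* Let $\alpha$ be a real number and let $K^\alpha(z,w)=K_w^\alpha(z)$ be the reproducing kernel of the Hilbert space $(F_\alpha^2,\langle\ ,\ \rangle_\alpha)$. Then $$K^\alpha(z,w)=\mathcal I^{-\alpha/2}K_w(z)+E^\alpha(z,w),\qquad z,w\in\mathbb{C}^n,$$ where $K_w(z)=e^{z\cdot\overline w}$, the operator $\mathcal I^{-\alpha/2}$ acts in the variable $z$, and the error term $E^\alpha(z,w)$ is the polynomial in $z\cdot\overline w$ given by $$E^\alpha(z,w)=\begin{cases}0 & \text{if }\alpha\le0,\\ \displaystyle\sum_{k\le\alpha/2}\frac{\Gamma(n+k)}{\Gamma(n+k-\alpha/2)}\frac{(z\cdot\overline w)^k}{k!} & \text{if }0<\alpha<2n,\\ (K_w)_{\alpha/2}^-(z)=\displaystyle\sum_{k\le\alpha/2}\frac{(z\cdot\overline w)^k}{k!} & \text{if }\alpha\ge2n.\end{cases}$$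
   Context: Fix an integer $n\ge1$. $dV$ is Lebesgue volume measure on $\mathbb{C}^n$ normalized so that $\int_{\mathbb{C}^n}e^{-|z|^2}dV(z)=1$; $z\cdot\overline w=\sum_{j=1}^n z_j\overline{w_j}$; $H(\mathbb{C}^n)$ is the space of entire functions. For $\alpha$ real, $F_\alpha^2$ is the space of $f\in H(\mathbb{C}^n)$ with $\int_{\mathbb{C}^n}|f(z)|^2e^{-|z|^2}(1+|z|)^{-\alpha}dV(z)<\infty$. Let $f\in H(\mathbb{C}^n)$ have homogeneous expansion $f=\sum_{k\ge0}f_k$ ($f_k$ a homogeneous polynomial of degree $k$). For $s$ real put $f_s^-=\sum_{k\le|s|}f_k$, $f_s^+=\sum_{k>|s|}f_k$, and $\mathcal I^sf=\sum_k\frac{\Gamma(n+k)}{\Gamma(n+s+k)}f_k$, the sum being over all $k\ge0$ if $s\ge0$ and over $k>|s|$ only if $s<0$. Put $(\psi,\varphi)_\alpha=\int_{\mathbb{C}^n}\psi(z)\overline{\varphi(z)}e^{-|z|^2}|z|^{-\alpha}dV(z)$ whenever well defined. The space $F_\alpha^2$ is a Hilbert space (with norm equivalent to the natural one) under the inner product $\langle f,g\rangle_\alpha=(f,g)_\alpha$ if $\alpha<2n$, and $\langle f,g\rangle_\alpha=(f_{\alpha/2}^-,g_{\alpha/2}^-)_0+(f_{\alpha/2}^+,g_{\alpha/2}^+)_\alpha$ if $\alpha\ge2n$. Point evaluations are bounded on $F_\alpha^2$, and $K_w^\alpha\in F_\alpha^2$ is the unique element with $f(w)=\langle f,K_w^\alpha\rangle_\alpha$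 for all $f\in F_\alpha^2$. *)

theory Defs
  imports "HOL-Analysis.Analysis"
begin

text \<open>
  The space of \<open>n\<close> complex variables is \<^typ>\<open>complex ^ 'n\<close>, with \<open>n = CARD('n) \<ge> 1\<close>; its
  \<^const>\<open>norm\<close> is the Euclidean norm, and \<^const>\<open>lborel\<close> on it is Lebesgue measure in
  \<open>2 n\<close> real dimensions.
\<close>

definition dV :: "(complex ^ 'n) measure" where
  "dV = scale_measure (1 / (\<integral>\<^sup>+ z. ennreal (exp (- (norm (z :: complex ^ 'n))\<^sup>2)) \<partial>lborel)) lborel"

definition herm :: "complex ^ 'n \<Rightarrow> complex ^ 'n \<Rightarrow> complex" where
  "herm z w = (\<Sum>j\<in>UNIV. z $ j * cnj (w $ j))"

text \<open>
  Holomorphy in several variables: real Frechet differentiability with a complex-linear derivative.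
\<close>

definition entire_fun :: "(complex ^ 'n \<Rightarrow> complex) \<Rightarrow> bool" where
  "entire_fun f \<longleftrightarrow>
     (\<forall>z. \<exists>D. (f has_derivative D) (at z) \<and> (\<forall>c v. D (c *s v) = c * D v))"

definition fock_space :: "real \<Rightarrow> (complex ^ 'n \<Rightarrow> complex) set" where
  "fock_space \<alpha> = {f. entire_fun f \<and>
     integrable dV (\<lambda>z. (cmod (f z))\<^sup>2 * exp (- (norm z)\<^sup>2) * (1 + norm z) powr (- \<alpha>))}"

definition homogeneous_poly :: "nat \<Rightarrow> (complex ^ 'n \<Rightarrow> complex) \<Rightarrow> bool" where
  "homogeneous_poly k p \<longleftrightarrow>
     (\<exists>c :: ('n \<Rightarrow> nat) \<Rightarrow> complex.
        \<forall>z. p z = (\<Sum>m | (\<Sum>j\<in>UNIV. m j) = k. c m * (\<Prod>j\<in>UNIV. (z $ j) ^ m j)))"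

definition homogeneous_expansion ::
    "(complex ^ 'n \<Rightarrow> complex) \<Rightarrow> (nat \<Rightarrow> complex ^ 'n \<Rightarrow> complex) \<Rightarrow> bool" where
  "homogeneous_expansion f p \<longleftrightarrow>
     (\<forall>k. homogeneous_poly k (p k)) \<and> (\<forall>z. (\<lambda>k. p k z) sums f z)"

text \<open>
  The expansion is unique because \<open>t \<mapsto> f (t z)\<close> is a power series in \<open>t\<close> with coefficients
  \<open>p k z\<close>; it exists for every entire \<open>f\<close>.
\<close>

definition hcomp :: "(complex ^ 'n \<Rightarrow> complex) \<Rightarrow> nat \<Rightarrow> complex ^ 'n \<Rightarrow> complex" where
  "hcomp f = (THE p. homogeneous_expansion f p)"

definition low_part :: "real \<Rightarrow> (complex ^ 'n \<Rightarrow> complex) \<Rightarrow> complex ^ 'n \<Rightarrow> complex" where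
  "low_part s f z = (\<Sum>k | real k \<le> \<bar>s\<bar>. hcomp f k z)"

definition high_part :: "real \<Rightarrow> (complex ^ 'n \<Rightarrow> complex) \<Rightarrow> complex ^ 'n \<Rightarrow> complex" where
  "high_part s f z = (\<Sum>k. if real k > \<bar>s\<bar> then hcomp f k z else 0)"

definition frac_op :: "real \<Rightarrow> (complex ^ 'n \<Rightarrow> complex) \<Rightarrow> complex ^ 'n \<Rightarrow> complex" where
  "frac_op s f z =
     (\<Sum>k. if s \<ge> 0 \<or> real k > \<bar>s\<bar>
          then complex_of_real (Gamma (real CARD('n) + real k) / Gamma (real CARD('n) + s + real k))
               * hcomp f k z
          else 0)"

text \<open>
  Since \<open>0 powr a = 0\<close> for every \<open>a\<close>, the weight \<open>norm z powr (- \<alpha>)\<close> vanishes at the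
  origin (also for \<open>\<alpha> = 0\<close>), which is a null set.
\<close>

definition pairing ::
    "real \<Rightarrow> (complex ^ 'n \<Rightarrow> complex) \<Rightarrow> (complex ^ 'n \<Rightarrow> complex) \<Rightarrow> complex" where
  "pairing \<alpha> \<psi> \<phi> =
     (\<integral>z. \<psi> z * cnj (\<phi> z) * complex_of_real (exp (- (norm z)\<^sup>2) * norm z powr (- \<alpha>)) \<partial>dV)"

definition fock_inner ::
    "real \<Rightarrow> (complex ^ 'n \<Rightarrow> complex) \<Rightarrow> (complex ^ 'n \<Rightarrow> complex) \<Rightarrow> complex" where
  "fock_inner \<alpha> f g =
     (if \<alpha> < 2 * real CARD('n) then pairing \<alpha> f g
      else pairing 0 (low_part (\<alpha> / 2) f) (low_part (\<alpha> / 2) g)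
         + pairing \<alpha> (high_part (\<alpha> / 2) f) (high_part (\<alpha> / 2) g))"

text \<open>\<open>fock_kernel \<alpha> w\<close> is the function \<open>z \<mapsto> K\<^sup>\<alpha>(z, w)\<close>.\<close>

definition fock_kernel :: "real \<Rightarrow> complex ^ 'n \<Rightarrow> complex ^ 'n \<Rightarrow> complex" where
  "fock_kernel \<alpha> w =
     (THE K. K \<in> fock_space \<alpha> \<and> (\<forall>f\<in>fock_space \<alpha>. f w = fock_inner \<alpha> f K))"

definition exp_kernel :: "complex ^ 'n \<Rightarrow> complex ^ 'n \<Rightarrow> complex" where
  "exp_kernel w z = exp (herm z w)"

definition error_term :: "real \<Rightarrow> complex ^ 'n \<Rightarrow> complex ^ 'n \<Rightarrow> complex" where
  "error_term \<alpha> z w =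
     (if \<alpha> \<le> 0 then 0
      else if \<alpha> < 2 * real CARD('n) then
        (\<Sum>k | real k \<le> \<alpha> / 2.
           complex_of_real (Gamma (real CARD('n) + real k) / Gamma (real CARD('n) + real k - \<alpha> / 2))
           * (herm z w ^ k / fact k))
      else low_part (\<alpha> / 2) (exp_kernel w) z)"

end

theory Submission
  imports Defs "HOL-Complex_Analysis.Cauchy_Integral_Formula" "HOL-Real_Asymp.Real_Asymp"
begin

text \<open>
  For a homogeneous polynomial \<open>p\<close> of degree \<open>k\<close>, Gaussian mean values give
  \<open>(p, (z, w)\<^sup>k / k!)\<^sub>0 = p(w)\<close>. The measure \<open>h dV\<close>, with \<open>h\<close> homogeneous of degree \<open>2k\<close>, is pushed
  forward by \<open>|z|\<^sup>2\<close> to a multiple of \<open>t\<close> to the power \<open>n + k - 1\<close> on the half-line, so passing to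
  the weight with parameter \<open>\<alpha>\<close> multiplies this pairing by the quotient of
  \<open>\<Gamma>(n + k - \<alpha>/2)\<close> and \<open>\<Gamma>(n + k)\<close>; hence the coefficients of the kernel.
  Homogeneous components of different degrees are orthogonal by rotation invariance. Expansions are
  integrated termwise on annuli \<open>1/N \<le> |z|\<^sup>2 \<le> N\<close>, and \<open>N\<close> tends to infinity by dominated convergence
  on the side of the integral and by Tannery's theorem on the side of the series.
  Any reproducing kernel \<open>K\<close> coincides with the explicit one, since evaluating \<open>K\<close> and evaluating
  the explicit kernel both compute, up to conjugation, the same inner product.
\<close>

section \<open>Isometries and radial integration for Lebesgue measure\<close>

text \<open>The factor relating a homogeneous density to a power of \<open>t\<close> is never
  computed. It depends on the density but not on the radial weight, so the Gaussian weight, for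
  which the pairing is known to be \<open>p w\<close>, determines it. Neither surface measure on the
  sphere nor norms of monomials enter. The obstacle is that the expansion of a member of the Fock
  space converges only locally uniformly, and no bound for its components against a weight on the
  whole space is at hand. This forces the cutoffs. Under a cutoff the term of degree k is
  \<open>p k w\<close> times the fraction of the full moment that the cutoff retains. That fraction
  lies between 0 and 1 and tends to 1, so the absolutely convergent series of the
  \<open>p k w\<close> is the majorant for Tannery's theorem. On the other side it suffices that the
  uncut product is integrable. If \<alpha> < 2n, the weight is locally integrable; if \<alpha> \<ge>
  2n, the high parts vanish at the origin to an order above \<alpha>/2, and this outweighs the
  singularity.\<close>

lemma nn_integral_lborel_shift:
  fixes g :: "'a::euclidean_space \<Rightarrow> ennreal"
  assumes [measurable]: "g \<in> borel_measurable borel"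
  shows "(\<integral>\<^sup>+x. g (c + x) \<partial>lborel) = (\<integral>\<^sup>+x. g x \<partial>lborel)"
proof -
  have "(\<integral>\<^sup>+x. g x \<partial>lborel) = (\<integral>\<^sup>+x. g x \<partial>distr lborel borel ((+) c))"
    by (simp add: lborel_distr_plus)
  also have "\<dots> = (\<integral>\<^sup>+x. g (c + x) \<partial>lborel)"
    by (subst nn_integral_distr) auto
  finally show ?thesis by simp
qed

text \<open>
  Both sides are translation invariant, so Fubini applied to
  \<open>1\<^sub>A(T x) 1\<^sub>B(y - T x)\<close> shows that they are proportional; the unit ball \<open>B\<close>, which \<open>T\<close>
  preserves, shows that the factor is 1.
\<close>

lemma lborel_distr_isometry:
  fixes T :: "'a::euclidean_space \<Rightarrow> 'a"
  assumes lin: "linear T" and iso: "\<And>x. norm (T x) = norm x"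
  shows "distr lborel borel T = lborel"
proof (rule measure_eqI)
  have cont: "continuous_on UNIV T"
    using lin linear_continuous_on linear_conv_bounded_linear by blast
  then have [measurable]: "T \<in> borel_measurable borel"
    by (rule borel_measurable_continuous_onI)
  have "inj T"
    using linear_injective_0[OF lin] by (metis iso norm_eq_zero)
  then have surj: "surj T"
    using lin linear_injective_imp_surjective by blast
  fix A :: "'a set" assume "A \<in> sets (distr lborel borel T)"
  then have [measurable]: "A \<in> sets borel" by simp
  define B where "B = ball (0::'a) 1"
  have [measurable]: "B \<in> sets borel" by (simp add: B_def)
  define a b :: "'a \<Rightarrow> ennreal" where "a = indicator A" and "b = indicator B"
  have [measurable]: "a \<in> borel_measurable borel" "b \<in> borel_measurable borel"
    by (auto simp: a_def b_def)
  have b_cong: "b x = b y" if "norm x = norm y" for x y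
    using that by (simp add: b_def B_def indicator_def)
  have shift_b: "(\<integral>\<^sup>+y. b (y - c) \<partial>lborel) = emeasure lborel B" for c
  proof -
    have "(\<integral>\<^sup>+y. b (y - c) \<partial>lborel) = (\<integral>\<^sup>+y. b y \<partial>lborel)"
      using nn_integral_lborel_shift[of b "- c"] by simp
    then show ?thesis by (simp add: b_def)
  qed
  have shift_a: "(\<integral>\<^sup>+y. a (c + y) \<partial>lborel) = emeasure lborel A" for c
    using nn_integral_lborel_shift[of a c] by (simp add: a_def)
  have "emeasure (distr lborel borel T) A * emeasure lborel B
      = (\<integral>\<^sup>+x. a (T x) \<partial>lborel) * emeasure lborel B"
  proof -
    have "emeasure (distr lborel borel T) A = (\<integral>\<^sup>+x. a x \<partial>distr lborel borel T)"
      by (simp add: a_def)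
    then show ?thesis by (simp add: nn_integral_distr)
  qed
  also have "\<dots> = (\<integral>\<^sup>+x. a (T x) * (\<integral>\<^sup>+y. b (y - T x) \<partial>lborel) \<partial>lborel)"
    by (simp add: shift_b nn_integral_multc)
  also have "\<dots> = (\<integral>\<^sup>+x. (\<integral>\<^sup>+y. a (T x) * b (y - T x) \<partial>lborel) \<partial>lborel)"
    by (simp add: nn_integral_cmult)
  also have "\<dots> = (\<integral>\<^sup>+y. (\<integral>\<^sup>+x. a (T x) * b (y - T x) \<partial>lborel) \<partial>lborel)"
    by (rule lborel_pair.Fubini') measurable
  also have "\<dots> = (\<integral>\<^sup>+y. (\<integral>\<^sup>+x. a (T x + y) * b x \<partial>lborel) \<partial>lborel)"
  proof (rule nn_integral_cong)
    fix y :: 'a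
    obtain y' where y': "T y' = y" using surj by (metis surjD)
    \<comment> \<open>Translating x by a preimage \<open>y'\<close> of y turns the argument of
      \<open>b\<close> into \<open>- T x\<close>, which has the norm of x.\<close>
    have "(\<integral>\<^sup>+x. a (T x) * b (y - T x) \<partial>lborel) = (\<integral>\<^sup>+x. a (T (y' + x)) * b (y - T (y' + x)) \<partial>lborel)"
      by (subst nn_integral_lborel_shift[of "\<lambda>x. a (T x) * b (y - T x)" y']) auto
    also have "\<dots> = (\<integral>\<^sup>+x. a (T x + y) * b x \<partial>lborel)"
    proof (rule nn_integral_cong)
      fix x
      have "b (y - T (y' + x)) = b x"
        by (rule b_cong) (simp add: linear_add[OF lin] y' iso)
      then show "a (T (y' + x)) * b (y - T (y' + x)) = a (T x + y) * b x"
        by (simp add: linear_add[OF lin] y' add.commute)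
    qed
    finally show "(\<integral>\<^sup>+x. a (T x) * b (y - T x) \<partial>lborel) = (\<integral>\<^sup>+x. a (T x + y) * b x \<partial>lborel)" .
  qed
  also have "\<dots> = (\<integral>\<^sup>+x. (\<integral>\<^sup>+y. a (T x + y) * b x \<partial>lborel) \<partial>lborel)"
    by (rule lborel_pair.Fubini') measurable
  also have "\<dots> = (\<integral>\<^sup>+x. emeasure lborel A * b x \<partial>lborel)"
    by (simp add: nn_integral_multc shift_a)
  also have "\<dots> = emeasure lborel A * emeasure lborel B"
    by (simp add: nn_integral_cmult b_def)
  finally have "emeasure (distr lborel borel T) A * emeasure lborel B
      = emeasure lborel A * emeasure lborel B" .
  moreover have "emeasure lborel B \<noteq> \<infinity>" "emeasure lborel B \<noteq> 0"
    using emeasure_lborel_ball_finite[of "0::'a" 1]  content_ball_pos[of 1 "0::'a"]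
    by (auto simp: B_def measure_def)
  ultimately show "emeasure (distr lborel borel T) A = emeasure lborel A"
    by (metis ennreal_mult_divide_eq infinity_ennreal_def)
qed simp

section \<open>Integrals of homogeneous functions against radial weights\<close>

lemma nn_integral_lborel_scale:
  fixes g :: "'a::euclidean_space \<Rightarrow> ennreal"
  assumes [measurable]: "g \<in> borel_measurable borel" and c: "0 < c"
  shows "(\<integral>\<^sup>+x. g x \<partial>lborel) = ennreal (c ^ DIM('a)) * (\<integral>\<^sup>+x. g (c *\<^sub>R x) \<partial>lborel)"
proof -
  have "(\<integral>\<^sup>+x. g x \<partial>lborel)
      = (\<integral>\<^sup>+x. g x \<partial>density (distr lborel borel (\<lambda>x. 0 + c *\<^sub>R x)) (\<lambda>_. ennreal (\<bar>c\<bar> ^ DIM('a))))"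
    using c by (subst lborel_affine[of c 0]) auto
  also have "\<dots> = ennreal (c ^ DIM('a)) * (\<integral>\<^sup>+x. g (c *\<^sub>R x) \<partial>lborel)"
    using c by (subst nn_integral_density) (auto simp: nn_integral_distr nn_integral_cmult)
  finally show ?thesis .
qed

lemma nn_integral_has_integral_on:
  fixes f :: "real \<Rightarrow> real"
  assumes [measurable]: "f \<in> borel_measurable borel" "S \<in> sets borel"
    and "\<And>x. x \<in> S \<Longrightarrow> 0 \<le> f x" "(f has_integral I) S"
  shows "(\<integral>\<^sup>+x. ennreal (f x) * indicator S x \<partial>lborel) = ennreal I"
proof -
  have "((\<lambda>x. if x \<in> S then f x else 0) has_integral I) UNIV"
    using assms(4) by (simp add: has_integral_restrict_UNIV)
  then have "integral\<^sup>N lborel (\<lambda>x. ennreal (if x \<in> S then f x else 0)) = ennreal I"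
    using assms by (intro nn_integral_has_integral_lborel) auto
  moreover have "(\<lambda>x. ennreal (if x \<in> S then f x else 0)) = (\<lambda>x. ennreal (f x) * indicator S x)"
    by (auto simp: indicator_def)
  ultimately show ?thesis by simp
qed

text \<open>Scaling by \<open>sqrt s\<close> shows that the set where the squared norm is at most s
  has mass proportional to \<open>s powr a\<close> under the density \<open>h\<close>. The
  half-lines \<open>{..s}\<close> generate the Borel sets, so this determines the image measure. The
  exponent is half of dimension plus degree because the radial variable is the squared norm;
  \<open>bound\<close> makes the masses finite.\<close>

lemma nn_integral_radial:
  fixes h :: "'a::euclidean_space \<Rightarrow> real" and d :: nat
  defines "a \<equiv> (real DIM('a) + real d) / 2"
  assumes [measurable]: "h \<in> borel_measurable borel" and nonneg: "\<And>x. 0 \<le> h x"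
    and hom: "\<And>t x. 0 < t \<Longrightarrow> h (t *\<^sub>R x) = t ^ d * h x"
    and bound: "\<And>x. norm x \<le> 1 \<Longrightarrow> h x \<le> M"
  obtains C where "0 \<le> C" "\<And>\<phi>. \<phi> \<in> borel_measurable borel \<Longrightarrow>
    (\<integral>\<^sup>+x. ennreal (h x) * \<phi> ((norm x)\<^sup>2) \<partial>lborel)
      = ennreal C * (\<integral>\<^sup>+t. ennreal (t powr (a - 1)) * indicator {0<..} t * \<phi> t \<partial>lborel)"
proof -
  have a: "0 < a" by (simp add: a_def add_pos_nonneg)
  define I where "I = (\<integral>\<^sup>+x. ennreal (h x) * indicator {..1} ((norm x)\<^sup>2) \<partial>lborel)"
  have "I \<le> (\<integral>\<^sup>+x. ennreal M * indicator (cball 0 1) x \<partial>(lborel::'a measure))"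
    unfolding I_def
  proof (rule nn_integral_mono)
    fix x :: 'a
    show "ennreal (h x) * indicator {..1} ((norm x)\<^sup>2) \<le> ennreal M * indicator (cball 0 1) x"
      using bound[of x] by (auto simp: indicator_def power_le_one_iff abs_le_square_iff[of _ 1, simplified] intro: ennreal_leI)
  qed
  also have "\<dots> = ennreal M * emeasure lborel (cball (0::'a) 1)"
    by (subst nn_integral_cmult) (auto intro!: borel_measurable_indicator)
  also have "\<dots> < \<infinity>"
    using emeasure_lborel_cball_finite[of "0::'a" 1] by (simp add: ennreal_mult_less_top)
  finally obtain r where r: "0 \<le> r" "I = ennreal r"
    by (metis ennreal_cases infinity_ennreal_def less_irrefl)
  \<comment> \<open>The factor \<open>a\<close> cancels the denominator in the integral
    \<open>s powr a / a\<close> of \<open>t powr (a - 1)\<close> over [0, s].\<close>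
  define C where "C = r * a"
  have C: "0 \<le> C" using r a by (simp add: C_def)
  define M1 where "M1 = distr (density lborel (\<lambda>x. ennreal (h x))) borel (\<lambda>x. (norm x)\<^sup>2)"
  define M2 where "M2 = density lborel (\<lambda>t. ennreal C * (ennreal (t powr (a - 1)) * indicator {0<..} t))"
  have M1: "emeasure M1 {..s} = (\<integral>\<^sup>+x. ennreal (h x) * indicator {..s} ((norm x)\<^sup>2) \<partial>lborel)" for s
  proof -
    have "emeasure M1 {..s} = (\<integral>\<^sup>+t. indicator {..s} t \<partial>M1)"
      by (simp add: M1_def)
    also have "\<dots> = (\<integral>\<^sup>+x. ennreal (h x) * indicator {..s} ((norm x)\<^sup>2) \<partial>lborel)"
      unfolding M1_def by (subst nn_integral_distr, simp, simp, subst nn_integral_density) auto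
    finally show ?thesis .
  qed
  have M2: "emeasure M2 {..s} = ennreal C * (\<integral>\<^sup>+t. ennreal (t powr (a - 1)) * indicator {0<..} t * indicator {..s} t \<partial>lborel)" for s
    unfolding M2_def
    by (subst emeasure_density, simp, simp, subst nn_integral_cmult[symmetric]) (auto simp: mult_ac)
  have eq: "emeasure M1 {..s} = emeasure M2 {..s}" for s
  proof (cases "0 < s")
    case True
    have *: "s powr a = sqrt s ^ DIM('a) * sqrt s ^ d"
      using True by (simp add: a_def powr_half_sqrt[symmetric] powr_power add_divide_distrib powr_add powr_powr flip: powr_realpow)
    have "emeasure M1 {..s} = ennreal (sqrt s ^ DIM('a)) *
        (\<integral>\<^sup>+x. ennreal (h (sqrt s *\<^sub>R x)) * indicator {..s} ((norm (sqrt s *\<^sub>R x))\<^sup>2) \<partial>lborel)"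
      unfolding M1 using True by (subst nn_integral_lborel_scale[of _ "sqrt s"]) auto
    also have "(\<integral>\<^sup>+x. ennreal (h (sqrt s *\<^sub>R x)) * indicator {..s} ((norm (sqrt s *\<^sub>R x))\<^sup>2) \<partial>lborel)
        = (\<integral>\<^sup>+x. ennreal (sqrt s ^ d) * (ennreal (h x) * indicator {..1} ((norm x)\<^sup>2)) \<partial>lborel)"
      using True nonneg
      by (intro nn_integral_cong) (auto simp: hom ennreal_mult' indicator_def power_mult_distrib mult_ac)
    also have "\<dots> = ennreal (sqrt s ^ d) * ennreal r"
      by (simp add: nn_integral_cmult I_def[symmetric] r)
    also have "ennreal (sqrt s ^ DIM('a)) * \<dots> = ennreal (s powr a * r)"
      using True r by (simp add: * ennreal_mult' mult.assoc)
    finally have 1: "emeasure M1 {..s} = ennreal (s powr a * r)" .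
    have "(\<integral>\<^sup>+t. ennreal (t powr (a - 1)) * indicator {0<..} t * indicator {..s} t \<partial>lborel)
        = (\<integral>\<^sup>+t. ennreal (t powr (a - 1)) * indicator {0..s} t \<partial>lborel)"
      by (intro nn_integral_cong) (auto simp: indicator_def)
    also have "\<dots> = ennreal (s powr a / a)"
      using has_integral_powr_from_0[of "a - 1" s] a True
      by (intro nn_integral_has_integral_on) auto
    finally show ?thesis
      unfolding 1 M2 using a C r by (simp add: C_def ennreal_mult'[symmetric] mult_ac)
  next
    case False
    have "emeasure M2 {..s} = ennreal C * (\<integral>\<^sup>+t. 0 \<partial>(lborel::real measure))"
      unfolding M2 using False by (intro arg_cong2[where f="(*)"] refl nn_integral_cong) (auto simp: indicator_def)
    moreover have "emeasure M1 {..s} = (\<integral>\<^sup>+t. 0 \<partial>(lborel::'a measure))"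
      unfolding M1
    proof (rule nn_integral_cong_AE)
      \<comment> \<open>For s = 0 the sublevel set still contains the origin, hence an equality
        almost everywhere.\<close>
      have "AE x in lborel. x \<noteq> (0::'a)"
        by (rule AE_I[of _ _ "{0}"]) auto
      then show "AE x in lborel. ennreal (h x) * indicator {..s} ((norm x)\<^sup>2) = 0"
      proof eventually_elim
        case (elim x)
        then have "0 < (norm x)\<^sup>2" by simp
        then have "\<not> (norm x)\<^sup>2 \<le> s" using False by linarith
        then show ?case by (simp add: indicator_def)
      qed
    qed
    ultimately show ?thesis by simp
  qed
  have "M1 = M2"
  proof (rule measure_eqI_generator_eq[where E="range atMost" and \<Omega>=UNIV and A="\<lambda>n. {..real n}"])
    show "Int_stable (range (atMost :: real \<Rightarrow> _))"
      by (auto simp: Int_stable_def)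
    have "sets (borel :: real measure) = sigma_sets UNIV (range atMost)"
      by (subst borel_eq_atMost) simp
    then show "sets M1 = sigma_sets UNIV (range atMost)" "sets M2 = sigma_sets UNIV (range atMost)"
      by (simp_all add: M1_def M2_def)
    show "(\<Union>n. {..real n}) = UNIV"
      using real_arch_simple by auto
    show "emeasure M1 {..real n} \<noteq> \<infinity>" for n
    proof (cases "0 < real n")
      case True
      have "(\<integral>\<^sup>+t. ennreal (t powr (a - 1)) * indicator {0<..} t * indicator {..real n} t \<partial>lborel)
          = (\<integral>\<^sup>+t. ennreal (t powr (a - 1)) * indicator {0..real n} t \<partial>lborel)"
        by (intro nn_integral_cong) (auto simp: indicator_def)
      also have "\<dots> = ennreal (real n powr a / a)"
        using has_integral_powr_from_0[of "a - 1" "real n"] a True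
        by (intro nn_integral_has_integral_on) auto
      finally show ?thesis by (simp add: eq M2 ennreal_mult_eq_top_iff)
    next
      case False
      then have n: "real n = 0" by simp
      have "emeasure M2 {..real n} = ennreal C * (\<integral>\<^sup>+t. 0 \<partial>(lborel::real measure))"
        unfolding M2 n by (intro arg_cong2[where f="(*)"] refl nn_integral_cong) (auto simp: indicator_def)
      then show ?thesis by (simp add: eq)
    qed
  qed (use eq in auto)
  have "(\<integral>\<^sup>+x. ennreal (h x) * \<phi> ((norm x)\<^sup>2) \<partial>lborel)
      = ennreal C * (\<integral>\<^sup>+t. ennreal (t powr (a - 1)) * indicator {0<..} t * \<phi> t \<partial>lborel)"
    if [measurable]: "\<phi> \<in> borel_measurable borel" for \<phi>
  proof -
    have "(\<integral>\<^sup>+x. ennreal (h x) * \<phi> ((norm x)\<^sup>2) \<partial>lborel) = (\<integral>\<^sup>+t. \<phi> t \<partial>M1)"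
      unfolding M1_def by (subst nn_integral_distr) (auto simp: nn_integral_density)
    also have "\<dots> = (\<integral>\<^sup>+t. \<phi> t \<partial>M2)" by (simp add: \<open>M1 = M2\<close>)
    also have "\<dots> = ennreal C * (\<integral>\<^sup>+t. ennreal (t powr (a - 1)) * indicator {0<..} t * \<phi> t \<partial>lborel)"
      unfolding M2_def by (subst nn_integral_density) (auto simp: nn_integral_cmult mult.assoc)
    finally show ?thesis .
  qed
  with C show ?thesis by (rule that)
qed

text \<open>The constant is chosen before \<open>\<phi>\<close>. This order of quantifiers is what
  later allows one weight to determine the constant for all others. The bound on the unit ball comes
  from compactness.\<close>

lemma has_integral_radial_nonneg:
  fixes h :: "'a::euclidean_space \<Rightarrow> real" and d :: nat
  defines "a \<equiv> (real DIM('a) + real d) / 2"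
  assumes cont: "continuous_on UNIV h" and nonneg: "\<And>x. 0 \<le> h x"
    and hom: "\<And>t x. 0 < t \<Longrightarrow> h (t *\<^sub>R x) = t ^ d * h x"
  shows "\<exists>C. \<forall>\<phi>. \<phi> \<in> borel_measurable borel \<longrightarrow> (\<forall>t. 0 \<le> \<phi> t) \<longrightarrow>
    integrable lborel (\<lambda>t. t powr (a - 1) * indicator {0<..} t * \<phi> t) \<longrightarrow>
    has_bochner_integral lborel (\<lambda>x. h x * \<phi> ((norm x)\<^sup>2))
      (C * (\<integral>t. t powr (a - 1) * indicator {0<..} t * \<phi> t \<partial>lborel))"
proof -
  have [measurable]: "h \<in> borel_measurable borel"
    using cont by (rule borel_measurable_continuous_onI)
  have "compact (h ` cball 0 1)"
    using cont by (intro compact_continuous_image) (auto intro: continuous_on_subset)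
  then obtain M where "\<And>y. y \<in> h ` cball 0 1 \<Longrightarrow> norm y \<le> M"
    using compact_imp_bounded bounded_iff by metis
  then have "h x \<le> M" if "norm x \<le> 1" for x
    using that by fastforce
  then obtain C where C: "0 \<le> C" and
    eq: "\<And>\<phi>. \<phi> \<in> borel_measurable borel \<Longrightarrow>
    (\<integral>\<^sup>+x. ennreal (h x) * \<phi> ((norm x)\<^sup>2) \<partial>lborel)
      = ennreal C * (\<integral>\<^sup>+t. ennreal (t powr (a - 1)) * indicator {0<..} t * \<phi> t \<partial>lborel)"
    using nn_integral_radial[of h d M] nonneg hom unfolding a_def by auto
  show ?thesis
  proof (intro exI allI impI)
    fix \<phi> :: "real \<Rightarrow> real"
    assume [measurable]: "\<phi> \<in> borel_measurable borel" and "\<forall>t. 0 \<le> \<phi> t"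
      and int: "integrable lborel (\<lambda>t. t powr (a - 1) * indicator {0<..} t * \<phi> t)"
    then have pos: "0 \<le> \<phi> t" for t by simp
    let ?J = "\<integral>t. t powr (a - 1) * indicator {0<..} t * \<phi> t \<partial>lborel"
    have J: "0 \<le> ?J" using pos by (intro integral_nonneg_AE) auto
    have "(\<integral>\<^sup>+x. ennreal (h x * \<phi> ((norm x)\<^sup>2)) \<partial>lborel)
      = ennreal C * (\<integral>\<^sup>+t. ennreal (t powr (a - 1)) * indicator {0<..} t * ennreal (\<phi> t) \<partial>lborel)"
      using eq[of "\<lambda>t. ennreal (\<phi> t)"] nonneg by (simp add: ennreal_mult')
    also have "(\<integral>\<^sup>+t. ennreal (t powr (a - 1)) * indicator {0<..} t * ennreal (\<phi> t) \<partial>lborel)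
      = (\<integral>\<^sup>+t. ennreal (t powr (a - 1) * indicator {0<..} t * \<phi> t) \<partial>lborel)"
      using pos by (intro nn_integral_cong) (auto simp: indicator_def ennreal_mult')
    also have "\<dots> = ennreal ?J"
      using int pos by (intro nn_integral_eq_integral) auto
    finally have "(\<integral>\<^sup>+x. ennreal (h x * \<phi> ((norm x)\<^sup>2)) \<partial>lborel) = ennreal (C * ?J)"
      using C J by (simp add: ennreal_mult')
    then show "has_bochner_integral lborel (\<lambda>x. h x * \<phi> ((norm x)\<^sup>2)) (C * ?J)"
      using C J nonneg pos by (intro has_bochner_integral_nn_integral) auto
  qed
qed

text \<open>The positive and negative parts of the real and imaginary parts of \<open>H\<close> are
  continuous, nonnegative and homogeneous of the same degree, since \<open>max 0\<close> commutes
  with positive scaling. Four nonnegative cases combine to the complex one.\<close>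

lemma has_integral_radial:
  fixes H :: "'a::euclidean_space \<Rightarrow> complex" and d :: nat
  defines "a \<equiv> (real DIM('a) + real d) / 2"
  assumes cont: "continuous_on UNIV H"
    and hom: "\<And>t x. 0 < t \<Longrightarrow> H (t *\<^sub>R x) = of_real (t ^ d) * H x"
  shows "\<exists>D. \<forall>\<phi>. \<phi> \<in> borel_measurable borel \<longrightarrow> (\<forall>t. 0 \<le> \<phi> t) \<longrightarrow>
    integrable lborel (\<lambda>t. t powr (a - 1) * indicator {0<..} t * \<phi> t) \<longrightarrow>
    has_bochner_integral lborel (\<lambda>x. H x * of_real (\<phi> ((norm x)\<^sup>2)))
      (D * of_real (\<integral>t. t powr (a - 1) * indicator {0<..} t * \<phi> t \<partial>lborel))"
proof -
  have ex: "\<exists>C. \<forall>\<phi>. \<phi> \<in> borel_measurable borel \<longrightarrow> (\<forall>t. 0 \<le> \<phi> t) \<longrightarrow>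
    integrable lborel (\<lambda>t. t powr (a - 1) * indicator {0<..} t * \<phi> t) \<longrightarrow>
    has_bochner_integral lborel (\<lambda>x. max 0 (u (H x)) * \<phi> ((norm x)\<^sup>2))
      (C * (\<integral>t. t powr (a - 1) * indicator {0<..} t * \<phi> t \<partial>lborel))"
    if u: "continuous_on UNIV u" "\<And>t z. u (of_real t * z) = t * u z" for u :: "complex \<Rightarrow> real"
    unfolding a_def
  proof (rule has_integral_radial_nonneg)
    have "continuous_on UNIV (\<lambda>x. u (H x))"
      using continuous_on_compose2[OF u(1) cont] by auto
    then show "continuous_on UNIV (\<lambda>x. max 0 (u (H x)))"
      by (intro continuous_intros)
    show "max 0 (u (H (t *\<^sub>R x))) = t ^ d * max 0 (u (H x))" if "0 < t" for t x
      using that by (simp add: hom u(2) max_mult_distrib_left del: of_real_power)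
  qed auto
  have cnt: "continuous_on UNIV Re" "continuous_on UNIV (\<lambda>z. - Re z)"
      "continuous_on UNIV Im" "continuous_on UNIV (\<lambda>z. - Im z)"
    by (auto intro!: continuous_intros)
  obtain C1 where 1: "\<forall>\<phi>. \<phi> \<in> borel_measurable borel \<longrightarrow> (\<forall>t. 0 \<le> \<phi> t) \<longrightarrow>
    integrable lborel (\<lambda>t. t powr (a - 1) * indicator {0<..} t * \<phi> t) \<longrightarrow>
    has_bochner_integral lborel (\<lambda>x. max 0 (Re (H x)) * \<phi> ((norm x)\<^sup>2))
      (C1 * (\<integral>t. t powr (a - 1) * indicator {0<..} t * \<phi> t \<partial>lborel))"
    using ex[of Re, OF cnt(1)] by auto
  obtain C2 where 2: "\<forall>\<phi>. \<phi> \<in> borel_measurable borel \<longrightarrow> (\<forall>t. 0 \<le> \<phi> t) \<longrightarrow>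
    integrable lborel (\<lambda>t. t powr (a - 1) * indicator {0<..} t * \<phi> t) \<longrightarrow>
    has_bochner_integral lborel (\<lambda>x. max 0 (- Re (H x)) * \<phi> ((norm x)\<^sup>2))
      (C2 * (\<integral>t. t powr (a - 1) * indicator {0<..} t * \<phi> t \<partial>lborel))"
    using ex[of "\<lambda>z. - Re z", OF cnt(2)] by auto
  obtain C3 where 3: "\<forall>\<phi>. \<phi> \<in> borel_measurable borel \<longrightarrow> (\<forall>t. 0 \<le> \<phi> t) \<longrightarrow>
    integrable lborel (\<lambda>t. t powr (a - 1) * indicator {0<..} t * \<phi> t) \<longrightarrow>
    has_bochner_integral lborel (\<lambda>x. max 0 (Im (H x)) * \<phi> ((norm x)\<^sup>2))
      (C3 * (\<integral>t. t powr (a - 1) * indicator {0<..} t * \<phi> t \<partial>lborel))"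
    using ex[of Im, OF cnt(3)] by auto
  obtain C4 where 4: "\<forall>\<phi>. \<phi> \<in> borel_measurable borel \<longrightarrow> (\<forall>t. 0 \<le> \<phi> t) \<longrightarrow>
    integrable lborel (\<lambda>t. t powr (a - 1) * indicator {0<..} t * \<phi> t) \<longrightarrow>
    has_bochner_integral lborel (\<lambda>x. max 0 (- Im (H x)) * \<phi> ((norm x)\<^sup>2))
      (C4 * (\<integral>t. t powr (a - 1) * indicator {0<..} t * \<phi> t \<partial>lborel))"
    using ex[of "\<lambda>z. - Im z", OF cnt(4)] by auto
  show ?thesis
  proof (intro exI allI impI)
    fix \<phi> :: "real \<Rightarrow> real"
    assume \<phi>: "\<phi> \<in> borel_measurable borel" "\<forall>t. 0 \<le> \<phi> t"
      "integrable lborel (\<lambda>t. t powr (a - 1) * indicator {0<..} t * \<phi> t)"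
    let ?J = "\<integral>t. t powr (a - 1) * indicator {0<..} t * \<phi> t \<partial>lborel"
    have "has_bochner_integral lborel
      (\<lambda>x. of_real (max 0 (Re (H x)) * \<phi> ((norm x)\<^sup>2)) - of_real (max 0 (- Re (H x)) * \<phi> ((norm x)\<^sup>2))
        + \<i> * (of_real (max 0 (Im (H x)) * \<phi> ((norm x)\<^sup>2)) - of_real (max 0 (- Im (H x)) * \<phi> ((norm x)\<^sup>2))))
      (of_real (C1 * ?J) - of_real (C2 * ?J) + \<i> * (of_real (C3 * ?J) - of_real (C4 * ?J)))"
      using 1 2 3 4 \<phi>
      by (intro has_bochner_integral_add has_bochner_integral_diff has_bochner_integral_mult_right
          has_bochner_integral_of_real) blast+
    moreover have "of_real (max 0 (Re (H x)) * \<phi> ((norm x)\<^sup>2)) - of_real (max 0 (- Re (H x)) * \<phi> ((norm x)\<^sup>2))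
        + \<i> * (of_real (max 0 (Im (H x)) * \<phi> ((norm x)\<^sup>2)) - of_real (max 0 (- Im (H x)) * \<phi> ((norm x)\<^sup>2)))
        = H x * of_real (\<phi> ((norm x)\<^sup>2))" for x
      by (auto simp: complex_eq_iff max_def)
    ultimately show "has_bochner_integral lborel (\<lambda>x. H x * of_real (\<phi> ((norm x)\<^sup>2)))
        ((C1 - C2 + \<i> * (C3 - C4)) * of_real ?J)"
      by (simp add: algebra_simps)
  qed
qed

section \<open>Gaussian integrals and the normalization of the measure\<close>

lemma integral_powr_exp:
  assumes "0 < (b::real)"
  shows "has_bochner_integral lborel (\<lambda>t. t powr (b - 1) * indicator {0<..} t * exp (- t)) (Gamma b)"
proof (rule has_bochner_integral_nn_integral)
  have "(\<integral>\<^sup>+t. ennreal (t powr (b - 1) * indicator {0<..} t * exp (- t)) \<partial>lborel)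
    = (\<integral>\<^sup>+t. ennreal (t powr (b - 1) / exp t) * indicator {0..} t \<partial>lborel)"
    by (intro nn_integral_cong) (auto simp: indicator_def exp_minus field_simps)
  also have "\<dots> = ennreal (Gamma b)"
    using Gamma_integral_real[OF assms] by (intro nn_integral_has_integral_on) auto
  finally show "(\<integral>\<^sup>+t. ennreal (t powr (b - 1) * indicator {0<..} t * exp (- t)) \<partial>lborel) = ennreal (Gamma b)" .
qed (use assms in \<open>auto intro: Gamma_real_nonneg\<close>)

lemma integral_exp_norm_finite:
  "integrable lborel (\<lambda>z::'a::euclidean_space. exp (- (norm z)\<^sup>2))"
proof -
  obtain C where "\<forall>\<phi>. \<phi> \<in> borel_measurable borel \<longrightarrow> (\<forall>t. 0 \<le> \<phi> t) \<longrightarrow>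
    integrable lborel (\<lambda>t. t powr ((real DIM('a) + real 0) / 2 - 1) * indicator {0<..} t * \<phi> t) \<longrightarrow>
    has_bochner_integral lborel (\<lambda>x::'a. 1 * \<phi> ((norm x)\<^sup>2))
      (C * (\<integral>t. t powr ((real DIM('a) + real 0) / 2 - 1) * indicator {0<..} t * \<phi> t \<partial>lborel))"
    using has_integral_radial_nonneg[of "\<lambda>x::'a. 1" 0] by auto
  from this[rule_format, of "\<lambda>t. exp (- t)"] show ?thesis
    using integral_powr_exp[of "(real DIM('a) + real 0) / 2"]
    by (auto simp: has_bochner_integral_iff)
qed

text \<open>The definition divides in \<open>ennreal\<close>. Only because the Gaussian integral is
  neither zero nor infinite is the factor a positive real, with total Gaussian mass 1.\<close>

lemma dV_eq_density:
  obtains c where "0 < c" "(dV :: (complex ^ 'n) measure) = density lborel (\<lambda>_. ennreal c)"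
    "(\<integral>z. exp (- (norm z)\<^sup>2) \<partial>(dV :: (complex ^ 'n) measure)) = 1"
proof -
  let ?g = "\<lambda>z :: complex ^ 'n. exp (- (norm z)\<^sup>2)"
  let ?I = "\<integral>z. ?g z \<partial>lborel"
  have "?I \<noteq> 0"
  proof
    assume "?I = 0"
    then have "AE z in lborel. ?g z = 0"
      using integral_nonneg_eq_0_iff_AE[OF integral_exp_norm_finite] by auto
    then have "AE z in (lborel :: (complex ^ 'n) measure). False" by simp
    then have "(UNIV :: (complex ^ 'n) set) \<in> null_sets lborel"
      by (subst AE_iff_null_sets) auto
    then show False by (simp add: null_sets_def)
  qed
  moreover have "0 \<le> ?I" by simp
  ultimately have I: "0 < ?I" by linarith
  have nn: "(\<integral>\<^sup>+ z. ennreal (?g z) \<partial>lborel) = ennreal ?I"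
    by (intro nn_integral_eq_integral integral_exp_norm_finite) auto
  have "(1::ennreal) / ennreal ?I = ennreal (1 / ?I)"
    using I divide_ennreal[of 1 ?I] by simp
  then have dV: "(dV :: (complex ^ 'n) measure) = density lborel (\<lambda>_. ennreal (1 / ?I))"
    unfolding dV_def nn by (intro measure_eqI) (auto simp: emeasure_density_const)
  show ?thesis
  proof (rule that[OF _ dV])
    show "0 < 1 / ?I" using I by simp
    show "(\<integral>z. ?g z \<partial>dV) = 1"
      unfolding dV using I by (subst integral_density) auto
  qed
qed

section \<open>Homogeneous expansions of entire functions\<close>

lemma norm_vec_smult: "norm (c *s (z :: complex ^ 'n)) = cmod c * norm z"
  by (simp add: norm_vec_def norm_mult L2_set_right_distrib)

lemma of_real_vec_smult: "complex_of_real t *s (z :: complex ^ 'n) = t *\<^sub>R z"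
  by (simp add: vec_eq_iff) (simp add: scaleR_conv_of_real)

lemma linear_vec_smult: "linear (\<lambda>z :: complex ^ 'n. c *s z)"
  by (rule linearI) (simp_all add: vec_eq_iff algebra_simps)

lemma bounded_linear_smult_left: "bounded_linear (\<lambda>c. c *s (z :: complex ^ 'n))"
proof -
  have "linear (\<lambda>c. c *s z)"
    by (rule linearI) (simp_all add: vec_eq_iff algebra_simps)
  then show ?thesis by (simp add: linear_conv_bounded_linear)
qed

lemma herm_smult_left: "herm (c *s z) w = c * herm z w"
  by (simp add: herm_def sum_distrib_left mult.assoc)

lemma cnj_herm: "cnj (herm z w) = herm w z"
  by (simp add: herm_def mult.commute)

lemma norm_herm_le: "cmod (herm z w) \<le> norm z * norm w"
proof -
  have "cmod (herm z w) \<le> (\<Sum>j\<in>UNIV. \<bar>cmod (z $ j)\<bar> * \<bar>cmod (w $ j)\<bar>)"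
    unfolding herm_def by (rule sum_norm_le) (simp add: norm_mult)
  also have "\<dots> \<le> norm z * norm w"
    unfolding norm_vec_def by (rule L2_set_mult_ineq)
  finally show ?thesis .
qed

lemma entire_fun_const: "entire_fun (\<lambda>_. c)"
  unfolding entire_fun_def by (auto intro!: exI[of _ "\<lambda>_. 0"])

lemma entire_fun_coord: "entire_fun (\<lambda>z. z $ j)"
  unfolding entire_fun_def by (auto intro!: exI[of _ "\<lambda>z. z $ j"] bounded_linear_imp_has_derivative bounded_linear_vec_nth)

lemma entire_fun_add:
  assumes "entire_fun f" "entire_fun g"
  shows "entire_fun (\<lambda>z. f z + g z)"
  unfolding entire_fun_def
proof
  fix z
  obtain D E where "(f has_derivative D) (at z)" "\<And>c v. D (c *s v) = c * D v"
    "(g has_derivative E) (at z)" "\<And>c v. E (c *s v) = c * E v"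
    using assms unfolding entire_fun_def by metis
  then show "\<exists>D. ((\<lambda>z. f z + g z) has_derivative D) (at z) \<and> (\<forall>c v. D (c *s v) = c * D v)"
    by (intro exI[of _ "\<lambda>v. D v + E v"]) (auto intro!: has_derivative_add simp: algebra_simps)
qed

lemma entire_fun_mult:
  assumes "entire_fun f" "entire_fun g"
  shows "entire_fun (\<lambda>z. f z * g z)"
  unfolding entire_fun_def
proof
  fix z
  obtain D E where "(f has_derivative D) (at z)" "\<And>c v. D (c *s v) = c * D v"
    "(g has_derivative E) (at z)" "\<And>c v. E (c *s v) = c * E v"
    using assms unfolding entire_fun_def by metis
  then show "\<exists>D. ((\<lambda>z. f z * g z) has_derivative D) (at z) \<and> (\<forall>c v. D (c *s v) = c * D v)"
    using has_derivative_mult[of f D z UNIV g E]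
    by (intro exI[of _ "\<lambda>v. f z * E v + D v * g z"]) (auto simp: algebra_simps)
qed

lemma entire_fun_sum:
  "(\<And>i. i \<in> I \<Longrightarrow> entire_fun (f i)) \<Longrightarrow> entire_fun (\<lambda>z. \<Sum>i\<in>I. f i z)"
  by (induction I rule: infinite_finite_induct) (auto intro: entire_fun_const entire_fun_add)

lemma entire_fun_prod:
  "(\<And>i. i \<in> I \<Longrightarrow> entire_fun (f i)) \<Longrightarrow> entire_fun (\<lambda>z. \<Prod>i\<in>I. f i z)"
  by (induction I rule: infinite_finite_induct) (auto intro: entire_fun_const entire_fun_mult)

lemma entire_fun_power: "entire_fun f \<Longrightarrow> entire_fun (\<lambda>z. f z ^ k)"
  by (induction k) (auto intro: entire_fun_const entire_fun_mult)

lemma entire_fun_compose: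
  assumes "entire_fun f" "g holomorphic_on UNIV"
  shows "entire_fun (\<lambda>z. g (f z))"
  unfolding entire_fun_def
proof
  fix z
  obtain D where D: "(f has_derivative D) (at z)" "\<And>c v. D (c *s v) = c * D v"
    using assms unfolding entire_fun_def by metis
  have "(g has_field_derivative deriv g (f z)) (at (f z))"
    using assms(2) holomorphic_derivI by blast
  then have "((\<lambda>z. g (f z)) has_derivative (\<lambda>v. deriv g (f z) * D v)) (at z)"
    using has_derivative_compose[OF D(1), of g] by (simp add: has_field_derivative_def)
  with D show "\<exists>D. ((\<lambda>z. g (f z)) has_derivative D) (at z) \<and> (\<forall>c v. D (c *s v) = c * D v)"
    by (intro exI[of _ "\<lambda>v. deriv g (f z) * D v"]) (auto simp: algebra_simps)
qed

lemma entire_fun_shift: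
  assumes "entire_fun f"
  shows "entire_fun (\<lambda>z. f (z + w))"
  unfolding entire_fun_def
proof
  fix z
  obtain D where D: "(f has_derivative D) (at (z + w))" "\<And>c v. D (c *s v) = c * D v"
    using assms unfolding entire_fun_def by metis
  have "((\<lambda>z. z + w) has_derivative (\<lambda>v. v)) (at z)"
    by (auto intro!: derivative_eq_intros)
  from has_derivative_compose[OF this D(1)] D(2)
  show "\<exists>D. ((\<lambda>z. f (z + w)) has_derivative D) (at z) \<and> (\<forall>c v. D (c *s v) = c * D v)"
    by blast
qed

lemma entire_fun_herm: "entire_fun (\<lambda>z. herm z w)"
  unfolding herm_def by (intro entire_fun_sum entire_fun_mult entire_fun_coord entire_fun_const)

lemma entire_fun_continuous: "entire_fun f \<Longrightarrow> continuous_on UNIV f"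
  unfolding entire_fun_def
  by (meson continuous_at_imp_continuous_on has_derivative_continuous)

lemma entire_fun_slice:
  assumes "entire_fun f"
  shows "(\<lambda>\<zeta>. f (a + \<zeta> *s b)) holomorphic_on UNIV"
proof (rule holomorphic_onI, rule field_differentiable_at_within)
  fix \<zeta>
  obtain D where D: "(f has_derivative D) (at (a + \<zeta> *s b))" "\<And>c v. D (c *s v) = c * D v"
    using assms unfolding entire_fun_def by metis
  have "((\<lambda>\<zeta>. a + \<zeta> *s b) has_derivative (\<lambda>c. c *s b)) (at \<zeta>)"
    using has_derivative_add[OF has_derivative_const bounded_linear_imp_has_derivative[OF bounded_linear_smult_left]]
    by simp
  from has_derivative_compose[OF this D(1)] D(2)
  have "((\<lambda>\<zeta>. f (a + \<zeta> *s b)) has_derivative (\<lambda>c. D b * c)) (at \<zeta>)"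
    by (simp add: mult.commute)
  then show "(\<lambda>\<zeta>. f (a + \<zeta> *s b)) field_differentiable at \<zeta>"
    unfolding field_differentiable_def has_field_derivative_def by blast
qed

section \<open>Components as Taylor coefficients along complex lines\<close>

lemma powser_coeffs_unique:
  fixes a b :: "nat \<Rightarrow> complex"
  assumes "\<And>t. (\<lambda>k. a k * t ^ k) sums g t" "\<And>t. (\<lambda>k. b k * t ^ k) sums g t"
  shows "a k = b k"
proof (rule ccontr)
  assume "a k \<noteq> b k"
  have s: "(\<lambda>k. (a k - b k) * t ^ k) sums 0" for t
    using sums_diff[OF assms(1)[of t] assms(2)[of t]] by (simp add: algebra_simps)
  show False
  proof (cases "k = 0")
    case True
    have "a 0 - b 0 = 0"
      using s[of 0] powser_sums_zero[of "\<lambda>k. a k - b k"] sums_unique2 by blast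
    then show ?thesis using \<open>a k \<noteq> b k\<close> True by simp
  next
    case False
    \<comment> \<open>Isolation of zeros is applied to the series whose sum is constantly 0: a
      nonzero coefficient would make that sum nonzero on a punctured disc.\<close>
    obtain s where "0 < s" "\<And>z. z \<in> cball (0::complex) s - {0} \<Longrightarrow> (0::complex) \<noteq> 0"
      by (rule powser_0_nonzero[of 1 0 "\<lambda>k. a k - b k" "\<lambda>_. 0" k])
         (use s False \<open>a k \<noteq> b k\<close> in auto)
    from this(2)[of "of_real s"] this(1) show ?thesis by simp
  qed
qed

text \<open>The Taylor coefficient of f restricted to the complex line through z. Sums and bounds
  thus reduce to Cauchy theory in one variable; dependence on z as a polynomial has to be shown
  separately.\<close>

definition taylor_comp :: "(complex ^ 'n \<Rightarrow> complex) \<Rightarrow> nat \<Rightarrow> complex ^ 'n \<Rightarrow> complex" where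
  "taylor_comp f k z = (deriv ^^ k) (\<lambda>t. f (t *s z)) 0 / fact k"

lemma taylor_comp_sums:
  assumes "entire_fun f"
  shows "(\<lambda>k. taylor_comp f k z * t ^ k) sums f (t *s z)"
proof -
  have "(\<lambda>t. f (0 + t *s z)) holomorphic_on UNIV"
    by (rule entire_fun_slice[OF assms])
  then have "(\<lambda>t. f (t *s z)) holomorphic_on ball 0 (norm t + 1)"
    using holomorphic_on_subset by auto
  from holomorphic_power_series[OF this, of t] show ?thesis
    by (simp add: taylor_comp_def)
qed

lemma taylor_comp_bound:
  assumes "entire_fun f" "0 < r" "\<And>u. norm u \<le> r * norm z \<Longrightarrow> cmod (f u) \<le> B"
  shows "cmod (taylor_comp f k z) \<le> B / r ^ k"
proof -
  have hol: "(\<lambda>t. f (0 + t *s z)) holomorphic_on UNIV"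
    by (rule entire_fun_slice[OF assms(1)])
  have "cmod ((deriv ^^ k) (\<lambda>t. f (0 + t *s z)) 0) \<le> fact k * B / r ^ k"
  proof (rule Cauchy_inequality)
    show "(\<lambda>t. f (0 + t *s z)) holomorphic_on ball 0 r"
      using hol holomorphic_on_subset by blast
    show "continuous_on (cball 0 r) (\<lambda>t. f (0 + t *s z))"
      using hol holomorphic_on_imp_continuous_on holomorphic_on_subset by blast
    show "cmod (f (0 + t *s z)) \<le> B" if "cmod (0 - t) = r" for t
      using that by (intro assms(3)) (simp add: norm_vec_smult)
  qed fact
  then show ?thesis
    by (simp add: taylor_comp_def norm_divide field_simps)
qed

text \<open>Both sides are coefficients of the same power series, that of
  \<open>f ((t * s) *s z)\<close> in t.\<close>

lemma taylor_comp_smult: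
  assumes "entire_fun f"
  shows "taylor_comp f k (s *s z) = s ^ k * taylor_comp f k z"
proof (rule powser_coeffs_unique)
  show "(\<lambda>k. taylor_comp f k (s *s z) * t ^ k) sums f ((t * s) *s z)" for t
    using taylor_comp_sums[OF assms, of "s *s z" t] by simp
  show "(\<lambda>k. s ^ k * taylor_comp f k z * t ^ k) sums f ((t * s) *s z)" for t
    using taylor_comp_sums[OF assms, of z "t * s"] by (simp add: power_mult_distrib mult_ac)
qed

lemma entire_fun_bounded_on_ball:
  assumes "entire_fun f"
  obtains M where "0 < M" "\<And>z. norm z \<le> R \<Longrightarrow> cmod (f z) \<le> M"
proof -
  have "compact (f ` cball 0 R)"
    using entire_fun_continuous[OF assms]
    by (intro compact_continuous_image) (auto intro: continuous_on_subset)
  then obtain M where "0 < M" "\<And>y. y \<in> f ` cball 0 R \<Longrightarrow> norm y \<le> M"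
    using compact_imp_bounded bounded_pos by metis
  then show ?thesis using that by auto
qed

text \<open>Cauchy's estimate on a disc of radius 2, with f bounded on the ball of twice the radius.
  The geometric decay is the form of local uniform convergence used for all termwise
  integrations.\<close>

lemma taylor_comp_local_bound:
  assumes "entire_fun f"
  obtains M where "0 < M" "\<And>k z. norm z \<le> R \<Longrightarrow> cmod (taylor_comp f k z) \<le> M * (1/2) ^ k"
proof -
  obtain M where M: "0 < M" "\<And>z. norm z \<le> 2 * R \<Longrightarrow> cmod (f z) \<le> M"
    using entire_fun_bounded_on_ball[OF assms] by blast
  have "cmod (taylor_comp f k z) \<le> M * (1/2) ^ k" if "norm z \<le> R" for k z
    using taylor_comp_bound[OF assms, of 2 z M k] M that by (simp add: power_one_over field_simps)
  with M(1) show ?thesis by (rule that)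
qed

text \<open>
  As \<open>s \<rightarrow> 0\<close>, the component \<open>f\<^sub>k(z)\<close> is the locally uniform limit of
  \<open>(f(s z) - \<Sum>l<k. s\<^sup>l f\<^sub>l(z)) / s\<^sup>k\<close>.
\<close>

lemma taylor_comp_holomorphic:
  assumes f: "entire_fun f"
  shows "(\<lambda>\<zeta>. taylor_comp f k (a + \<zeta> *s b)) holomorphic_on UNIV"
proof (induction k rule: less_induct)
  case (less k)
  \<comment> \<open>The shift by 2 keeps the modulus at most 1/2 even for N = 0, so the geometric
    series bounding the error converges.\<close>
  define s where "s N = complex_of_real (1 / (real N + 2))" for N :: nat
  define g where "g N \<zeta> = (f (s N *s (a + \<zeta> *s b)) - (\<Sum>l<k. taylor_comp f l (a + \<zeta> *s b) * s N ^ l)) / s N ^ k"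
    for N \<zeta>
  have ns: "cmod (s N) = 1 / (real N + 2)" for N
    unfolding s_def norm_of_real by (rule abs_of_pos) simp
  have s0: "s N \<noteq> 0" for N
    using ns[of N] by auto
  show ?case
  proof (rule holomorphic_uniform_sequence[of UNIV g])
    show "g N holomorphic_on UNIV" for N
    proof -
      have "(\<lambda>\<zeta>. f (s N *s a + \<zeta> *s (s N *s b))) holomorphic_on UNIV"
        by (rule entire_fun_slice[OF f])
      moreover have "s N *s a + \<zeta> *s (s N *s b) = s N *s (a + \<zeta> *s b)" for \<zeta>
        by (simp add: vec_eq_iff algebra_simps)
      ultimately have "(\<lambda>\<zeta>. f (s N *s (a + \<zeta> *s b))) holomorphic_on UNIV" by (simp only:)
      then show ?thesis
        unfolding g_def using s0 less by (intro holomorphic_intros) auto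
    qed
    fix x :: complex
    define R where "R = norm a + (norm x + 1) * norm b"
    obtain M where M: "0 < M" "\<And>z. norm z \<le> R \<Longrightarrow> cmod (f z) \<le> M"
      using entire_fun_bounded_on_ball[OF f] by blast
    have err: "dist (g N \<zeta>) (taylor_comp f k (a + \<zeta> *s b)) \<le> 2 * M / (real N + 2)"
      if "\<zeta> \<in> cball x 1" for N \<zeta>
    proof -
      define z where "z = a + \<zeta> *s b"
      have "cmod \<zeta> \<le> norm x + 1"
        using that by (metis add.commute dist_commute dist_norm mem_cball norm_triangle_sub order_trans add_left_mono)
      then have "norm z \<le> R"
        unfolding z_def R_def
        by (intro order_trans[OF norm_triangle_ineq] add_left_mono) (simp add: norm_vec_smult mult_right_mono)
      then have c: "cmod (taylor_comp f l z) \<le> M" for l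
        using taylor_comp_bound[OF f, of 1 z M l] M by auto
      let ?q = "1 / (real N + 2)"
      have "(\<lambda>l. taylor_comp f (l + k) z * s N ^ (l + k)) sums (f (s N *s z) - (\<Sum>l<k. taylor_comp f l z * s N ^ l))"
        using taylor_comp_sums[OF f, of z "s N"]
          sums_iff_shift[of "\<lambda>l. taylor_comp f l z * s N ^ l" k "f (s N *s z) - (\<Sum>l<k. taylor_comp f l z * s N ^ l)"]
        by simp
      from sums_divide[OF this, of "s N ^ k"]
      have "(\<lambda>l. taylor_comp f (l + k) z * s N ^ l) sums g N \<zeta>"
        using s0 by (simp add: g_def z_def power_add)
      \<comment> \<open>The term of index 0 is the limit itself; every remaining term carries a
        factor \<open>s N\<close>.\<close>
      then have "(\<lambda>l. taylor_comp f (Suc l + k) z * s N ^ Suc l) sums (g N \<zeta> - taylor_comp f k z)"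
        using sums_Suc_iff[of "\<lambda>l. taylor_comp f (l + k) z * s N ^ l"] by simp
      moreover have "(\<lambda>l. M * ?q * ?q ^ l) sums (M * ?q * (1 / (1 - ?q)))"
        by (intro sums_mult geometric_sums) simp
      ultimately have "cmod (g N \<zeta> - taylor_comp f k z) \<le> M * ?q * (1 / (1 - ?q))"
      proof (rule norm_sums_le)
        fix l
        have "cmod (taylor_comp f (Suc l + k) z) * ?q ^ Suc l \<le> M * ?q ^ Suc l"
          using c by (intro mult_right_mono) auto
        then show "cmod (taylor_comp f (Suc l + k) z * s N ^ Suc l) \<le> M * ?q * ?q ^ l"
          by (simp add: norm_mult norm_power ns mult_ac)
      qed
      also have "1 - ?q = (real N + 1) / (real N + 2)"
        by (simp add: field_simps)
      also have "M * ?q * (1 / ((real N + 1) / (real N + 2))) = M / (real N + 1)"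
        by (simp add: add_pos_nonneg)
      also have "\<dots> \<le> 2 * M / (real N + 2)"
        using M by (simp add: field_simps)
      finally show ?thesis by (simp add: dist_norm z_def)
    qed
    have "(\<lambda>N. 2 * M / (real N + 2)) \<longlonglongrightarrow> 0"
      by real_asymp
    then have "uniform_limit (cball x 1) g (\<lambda>\<zeta>. taylor_comp f k (a + \<zeta> *s b)) sequentially"
      unfolding uniform_limit_iff
    proof (intro allI impI)
      fix e :: real assume "0 < e"
      with \<open>(\<lambda>N. 2 * M / (real N + 2)) \<longlonglongrightarrow> 0\<close>
      have "\<forall>\<^sub>F N in sequentially. 2 * M / (real N + 2) < e" by (rule order_tendstoD)
      then show "\<forall>\<^sub>F N in sequentially. \<forall>\<zeta>\<in>cball x 1. dist (g N \<zeta>) (taylor_comp f k (a + \<zeta> *s b)) < e"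
        by eventually_elim (blast intro: le_less_trans[OF err])
    qed
    then show "\<exists>d>0. cball x d \<subseteq> UNIV \<and> uniform_limit (cball x d) g (\<lambda>\<zeta>. taylor_comp f k (a + \<zeta> *s b)) sequentially"
      by (intro exI[of _ 1]) auto
  qed simp
qed

section \<open>Polynomiality of the components\<close>

definition monomial_fun :: "('n::finite \<Rightarrow> nat) \<Rightarrow> complex ^ 'n \<Rightarrow> complex" where
  "monomial_fun m z = (\<Prod>j\<in>UNIV. (z $ j) ^ m j)"

text \<open>Lists of terms may repeat an exponent, so addition is concatenation and multiplication
  by a coordinate is a map. Like terms are collected only once, in
  \<open>polynomial_fun_homogeneous\<close>.\<close>

definition polynomial_fun :: "(complex ^ 'n \<Rightarrow> complex) \<Rightarrow> bool" where
  "polynomial_fun f \<longleftrightarrow> (\<exists>xs. \<forall>z. f z = (\<Sum>(c, m)\<leftarrow>xs. c * monomial_fun m z))"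

lemma polynomial_fun_const: "polynomial_fun (\<lambda>_. c)"
  unfolding polynomial_fun_def by (rule exI[of _ "[(c, \<lambda>_. 0)]"]) (simp add: monomial_fun_def)

lemma polynomial_fun_add:
  assumes "polynomial_fun f" "polynomial_fun g"
  shows "polynomial_fun (\<lambda>z. f z + g z)"
proof -
  obtain xs ys where "\<forall>z. f z = (\<Sum>(c, m)\<leftarrow>xs. c * monomial_fun m z)"
    "\<forall>z. g z = (\<Sum>(c, m)\<leftarrow>ys. c * monomial_fun m z)"
    using assms unfolding polynomial_fun_def by blast
  then show ?thesis
    unfolding polynomial_fun_def by (intro exI[of _ "xs @ ys"]) simp
qed

lemma polynomial_fun_coord_mult:
  fixes f :: "complex ^ 'n \<Rightarrow> complex"
  assumes "polynomial_fun f"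
  shows "polynomial_fun (\<lambda>z. z $ j * f z)"
proof -
  obtain xs where xs: "\<forall>z. f z = (\<Sum>(c, m)\<leftarrow>xs. c * monomial_fun m z)"
    using assms unfolding polynomial_fun_def by blast
  have mono: "monomial_fun (m(j := Suc (m j))) z = z $ j * monomial_fun m z" for m and z :: "complex ^ 'n"
  proof -
    have "monomial_fun (m(j := Suc (m j))) z
        = (z $ j) ^ Suc (m j) * (\<Prod>i\<in>UNIV - {j}. (z $ i) ^ m i)"
      unfolding monomial_fun_def by (subst prod.remove[of _ j]) auto
    also have "\<dots> = z $ j * monomial_fun m z"
      unfolding monomial_fun_def by (subst prod.remove[of UNIV j]) auto
    finally show ?thesis .
  qed
  have eq: "z $ j * (\<Sum>(c, m)\<leftarrow>xs. c * monomial_fun m z)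
      = (\<Sum>(c, m)\<leftarrow>map (\<lambda>(c, m). (c, m(j := Suc (m j)))) xs. c * monomial_fun m z)" for z :: "complex ^ 'n"
  proof (induction xs)
    case (Cons x xs)
    obtain c m where "x = (c, m)" by force
    then have "z $ j * (\<Sum>(c, m)\<leftarrow>x # xs. c * monomial_fun m z)
        = c * (z $ j * monomial_fun m z) + z $ j * (\<Sum>(c, m)\<leftarrow>xs. c * monomial_fun m z)"
      by (simp add: distrib_left)
    with \<open>x = (c, m)\<close> show ?case
      unfolding Cons.IH mono[symmetric] by (simp del: fun_upd_apply)
  qed simp
  show ?thesis
    unfolding polynomial_fun_def
    by (intro exI[of _ "map (\<lambda>(c, m). (c, m(j := Suc (m j)))) xs"] allI) (simp only: xs eq)
qed

lemma polynomial_fun_cmult: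
  assumes "polynomial_fun f"
  shows "polynomial_fun (\<lambda>z. a * f z)"
proof -
  obtain xs where xs: "\<forall>z. f z = (\<Sum>(c, m)\<leftarrow>xs. c * monomial_fun m z)"
    using assms unfolding polynomial_fun_def by blast
  have eq: "a * (\<Sum>(c, m)\<leftarrow>xs. c * monomial_fun m z)
      = (\<Sum>(c, m)\<leftarrow>map (\<lambda>(c, m). (a * c, m)) xs. c * monomial_fun m z)" for z
    by (induction xs) (auto simp: algebra_simps)
  show ?thesis
    unfolding polynomial_fun_def
    by (intro exI[of _ "map (\<lambda>(c, m). (a * c, m)) xs"] allI) (simp only: xs eq)
qed

lemma polynomial_fun_poly_mult:
  assumes "polynomial_fun f"
  shows "polynomial_fun (\<lambda>z. poly q (z $ j) * f z)"
proof (induction q)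
  case 0
  then show ?case using polynomial_fun_const[of 0] by simp
next
  case (pCons a q)
  have "polynomial_fun (\<lambda>z. a * f z + z $ j * (poly q (z $ j) * f z))"
    by (intro polynomial_fun_add polynomial_fun_cmult polynomial_fun_coord_mult assms pCons.IH)
  then show ?case by (simp add: algebra_simps)
qed

lemma polynomial_fun_sum:
  "(\<And>i. i \<in> I \<Longrightarrow> polynomial_fun (f i)) \<Longrightarrow> polynomial_fun (\<lambda>z. \<Sum>i\<in>I. f i z)"
  by (induction I rule: infinite_finite_induct) (auto intro: polynomial_fun_const polynomial_fun_add)

text \<open>The basis polynomials depend on k alone. They can therefore be fixed before the
  polynomial to be interpolated, whose coefficients will depend on the other variables.\<close>

lemma lagrange_interpolation:
  obtains L :: "nat \<Rightarrow> complex poly" where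
    "\<And>q t. degree q \<le> k \<Longrightarrow> poly q t = (\<Sum>i\<le>k. poly (L i) t * poly q (of_nat i))"
proof
  define L :: "nat \<Rightarrow> complex poly" where
    "L i = (\<Prod>j\<in>{..k} - {i}. smult (1 / (of_nat i - of_nat j)) [:- of_nat j, 1:])" for i
  have deg: "degree (L i) \<le> k" if "i \<le> k" for i
  proof -
    have "degree (L i) \<le> sum (degree \<circ> (\<lambda>j. smult (1 / (of_nat i - of_nat j)) [:- of_nat j, 1 :: complex:])) ({..k} - {i})"
      unfolding L_def by (rule degree_prod_sum_le) simp
    also have "\<dots> \<le> (\<Sum>j\<in>{..k} - {i}. 1)"
      by (rule sum_mono) (simp add: degree_pCons_eq_if)
    also have "\<dots> = k" using that by simp
    finally show ?thesis .
  qed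
  have L: "poly (L i) (of_nat l) = (if i = l then 1 else 0)" if "i \<le> k" "l \<le> k" for i l
    using that by (auto simp: L_def poly_prod simp flip: diff_divide_distrib intro!: prod.neutral)
  fix q :: "complex poly" and t assume q: "degree q \<le> k"
  define p where "p = (\<Sum>i\<le>k. smult (poly q (of_nat i)) (L i))"
  have "p = q"
  proof (rule poly_eqI_degree[of "of_nat ` {..k}"])
    have card: "card (of_nat ` {..k} :: complex set) = Suc k"
      by (subst card_image) (auto simp: inj_on_def)
    show "degree p < card (of_nat ` {..k} :: complex set)"
      unfolding card p_def less_Suc_eq_le
      by (rule degree_sum_le) (use deg in \<open>auto intro: order_trans[OF degree_smult_le]\<close>)
    show "degree q < card (of_nat ` {..k} :: complex set)"
      using q card by simp
    fix x :: complex assume "x \<in> of_nat ` {..k}"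
    then obtain l where "l \<le> k" "x = of_nat l" by auto
    then have "poly p x = (\<Sum>i\<le>k. if i = l then poly q x else 0)"
      unfolding p_def poly_sum by (intro sum.cong) (auto simp: L)
    with \<open>l \<le> k\<close> show "poly p x = poly q x" by simp
  qed
  have "poly q t = poly p t" by (simp add: \<open>p = q\<close>)
  then show "poly q t = (\<Sum>i\<le>k. poly (L i) t * poly q (of_nat i))"
    by (simp add: p_def poly_sum mult.commute)
qed

definition coord_upd :: "complex ^ 'n \<Rightarrow> 'n \<Rightarrow> complex \<Rightarrow> complex ^ 'n" where
  "coord_upd z j t = (\<chi> i. if i = j then t else z $ i)"

lemma norm_coord_upd_le: "norm (coord_upd z j t) \<le> norm z + cmod t"
proof -
  have "coord_upd z j t = coord_upd z j 0 + axis j t"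
    by (simp add: coord_upd_def axis_def vec_eq_iff)
  moreover have "norm (coord_upd z j 0) \<le> norm z"
    by (rule norm_le_componentwise_cart) (simp add: coord_upd_def)
  moreover have "norm (axis j t) = cmod t"
    by (simp add: norm_vec_def L2_set_def axis_def if_distrib[of norm] if_distrib[of "\<lambda>x. x\<^sup>2"] cong: if_cong)
  ultimately show ?thesis
    using norm_triangle_ineq[of "coord_upd z j 0" "axis j t"] by simp
qed

text \<open>
  In each variable the function is a polynomial of degree at most \<open>k\<close> by Liouville, hence determined
  through Lagrange interpolation by its values at \<open>0, \<dots>, k\<close>; substituting these values eliminates
  the variable.
\<close>

lemma polynomial_fun_Liouville:
  fixes P :: "complex ^ 'n \<Rightarrow> complex"
  assumes hol: "\<And>a b. (\<lambda>\<zeta>. P (a + \<zeta> *s b)) holomorphic_on UNIV"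
    and growth: "\<And>z. cmod (P z) \<le> M * (1 + norm z) ^ k"
    and dep: "\<And>z z'. (\<And>j. j \<in> T \<Longrightarrow> z $ j = z' $ j) \<Longrightarrow> P z = P z'"
  shows "polynomial_fun P"
proof -
  have "finite T" by simp
  then show ?thesis using assms
  proof (induction T arbitrary: P M rule: finite_induct)
    case empty
    have "P z = P 0" for z by (rule empty.prems(3)) simp
    then have "P = (\<lambda>_. P 0)" by blast
    then show ?case using polynomial_fun_const by metis
  next
    case (insert j T)
    obtain L :: "nat \<Rightarrow> complex poly" where
      L: "\<And>q t. degree q \<le> k \<Longrightarrow> poly q t = (\<Sum>i\<le>k. poly (L i) t * poly q (of_nat i))"
      using lagrange_interpolation[of k] by blast
    have M: "0 \<le> M" using order_trans[OF norm_ge_zero insert.prems(2)[of 0]] by simp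
    have interp: "P z = (\<Sum>i\<le>k. poly (L i) (z $ j) * P (coord_upd z j (of_nat i)))" for z
    proof -
      define u where "u t = P (coord_upd z j t)" for t
      have "coord_upd z j t = coord_upd z j 0 + t *s axis j 1" for t
        by (simp add: coord_upd_def axis_def vec_eq_iff)
      then have "u = (\<lambda>t. P (coord_upd z j 0 + t *s axis j 1))"
        unfolding u_def by (intro ext arg_cong[where f=P])
      then have hol_u: "u holomorphic_on UNIV"
        using insert.prems(1)[of "coord_upd z j 0" "axis j 1"] by (simp only:)
      \<comment> \<open>For such t the quantity 1 + |z| + |t| is at most 2|t|, whence the factor
        \<open>2 ^ k\<close>.\<close>
      have grow_u: "cmod (u t) \<le> M * 2 ^ k * cmod t ^ k" if "1 + norm z \<le> cmod t" for t
      proof -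
        have "cmod (u t) \<le> M * (1 + norm (coord_upd z j t)) ^ k"
          unfolding u_def by (rule insert.prems(2))
        also have "\<dots> \<le> M * (2 * cmod t) ^ k"
          using M that norm_coord_upd_le[of z j t] by (intro mult_left_mono power_mono) auto
        finally show ?thesis by (simp add: power_mult_distrib mult_ac)
      qed
      define q where "q = (\<Sum>i\<le>k. monom ((deriv ^^ i) u 0 / fact i) i)"
      have "degree q \<le> k"
        unfolding q_def by (rule degree_sum_le) (auto intro: order_trans[OF degree_monom_le])
      moreover have "u t = poly q t" for t
        using Liouville_polynomial[OF hol_u grow_u, where \<xi>=t] by (simp add: q_def poly_sum poly_monom)
      ultimately have "u (z $ j) = (\<Sum>i\<le>k. poly (L i) (z $ j) * u (of_nat i))"
        using L[of q "z $ j"] by simp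
      moreover have "coord_upd z j (z $ j) = z"
        by (simp add: coord_upd_def vec_eq_iff)
      ultimately show ?thesis by (simp add: u_def)
    qed
    have "polynomial_fun (\<lambda>z. P (coord_upd z j (of_nat i)))" if "i \<le> k" for i
    proof (rule insert.IH)
      show "(\<lambda>\<zeta>. P (coord_upd (a + \<zeta> *s b) j (of_nat i))) holomorphic_on UNIV" for a b
      proof -
        have "coord_upd (a + \<zeta> *s b) j (of_nat i) = coord_upd a j (of_nat i) + \<zeta> *s coord_upd b j 0" for \<zeta>
          by (simp add: coord_upd_def vec_eq_iff)
        then show ?thesis using insert.prems(1) by simp
      qed
      \<comment> \<open>A node has modulus at most k, so freezing the coordinate costs only the
        constant \<open>(1 + real k) ^ k\<close>. The growth exponent stays k, as the induction,
        which varies \<open>P\<close> and \<open>M\<close> only, demands.\<close>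
      show "cmod (P (coord_upd z j (of_nat i))) \<le> M * (1 + real k) ^ k * (1 + norm z) ^ k" for z
      proof -
        have "1 + norm (coord_upd z j (of_nat i)) \<le> 1 + norm z + real k"
          using norm_coord_upd_le[of z j "of_nat i"] that by simp
        also have "\<dots> \<le> (1 + real k) * (1 + norm z)"
          by (simp add: algebra_simps)
        finally have "M * (1 + norm (coord_upd z j (of_nat i))) ^ k \<le> M * ((1 + real k) * (1 + norm z)) ^ k"
          using M by (intro mult_left_mono power_mono) auto
        then show ?thesis
          using insert.prems(2)[of "coord_upd z j (of_nat i)"] by (simp add: power_mult_distrib mult_ac)
      qed
      show "P (coord_upd z j (of_nat i)) = P (coord_upd z' j (of_nat i))"
        if "\<And>l. l \<in> T \<Longrightarrow> z $ l = z' $ l" for z z'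
        using that by (intro insert.prems(3)) (auto simp: coord_upd_def)
    qed
    then have "polynomial_fun (\<lambda>z. \<Sum>i\<le>k. poly (L i) (z $ j) * P (coord_upd z j (of_nat i)))"
      by (intro polynomial_fun_sum polynomial_fun_poly_mult) auto
    then show ?case by (simp add: interp[symmetric])
  qed
qed

lemma finite_multiindices: "finite {m :: 'n::finite \<Rightarrow> nat. (\<Sum>j\<in>UNIV. m j) = k}"
proof (rule finite_subset)
  show "{m :: 'n \<Rightarrow> nat. (\<Sum>j\<in>UNIV. m j) = k} \<subseteq> (UNIV :: 'n set) \<rightarrow>\<^sub>E {..k}"
    by (auto simp: PiE_def extensional_def intro: member_le_sum)
qed (simp add: finite_PiE)

lemma monomial_fun_smult: "monomial_fun m (t *s z) = t ^ (\<Sum>j\<in>UNIV. m j) * monomial_fun m z"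
  by (simp add: monomial_fun_def power_mult_distrib prod.distrib power_sum)

text \<open>For fixed z, \<open>P (t *s z)\<close> is a polynomial in t that equals
  \<open>t ^ k * P z\<close>. Comparing the coefficients of t^k discards every monomial of total
  degree other than k; \<open>group\<close> then collects like terms into one coefficient per
  exponent.\<close>

lemma polynomial_fun_homogeneous:
  fixes P :: "complex ^ 'n \<Rightarrow> complex"
  assumes "polynomial_fun P" and hom: "\<And>t z. P (t *s z) = t ^ k * P z"
  shows "homogeneous_poly k P"
proof -
  obtain xs where xs: "\<And>z. P z = (\<Sum>(c, m)\<leftarrow>xs. c * monomial_fun m z)"
    using assms(1) unfolding polynomial_fun_def by blast
  define A where "A = {m :: 'n \<Rightarrow> nat. (\<Sum>j\<in>UNIV. m j) = k}"
  have fin: "finite A" unfolding A_def by (rule finite_multiindices)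
  have P: "P z = (\<Sum>(c, m)\<leftarrow>xs. if m \<in> A then c * monomial_fun m z else 0)" for z
  proof -
    define p where "p = (\<Sum>(c, m)\<leftarrow>xs. monom (c * monomial_fun m z) (\<Sum>j\<in>UNIV. m j))"
    have "poly p t = (\<Sum>(c, m)\<leftarrow>xs. c * monomial_fun m (t *s z))" for t
      unfolding p_def by (induction xs) (auto simp: poly_monom monomial_fun_smult mult_ac)
    then have "poly p t = poly (monom (P z) k) t" for t
      by (simp add: xs[symmetric] hom poly_monom mult.commute)
    then have "p = monom (P z) k"
      by (metis poly_eq_poly_eq_iff ext)
    then have "P z = coeff p k" by simp
    also have "\<dots> = (\<Sum>(c, m)\<leftarrow>xs. if m \<in> A then c * monomial_fun m z else 0)"
      unfolding p_def by (induction xs) (auto simp: A_def)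
    finally show ?thesis .
  qed
  have group: "(\<Sum>(c, m)\<leftarrow>ys. if m \<in> A then c * g m else 0)
      = (\<Sum>m\<in>A. (\<Sum>(c, m')\<leftarrow>ys. if m' = m then c else 0) * g m)" for ys and g :: "_ \<Rightarrow> complex"
  proof (induction ys)
    case (Cons y ys)
    obtain c m0 where y: "y = (c, m0)" by force
    have "(\<Sum>m\<in>A. (\<Sum>(c, m')\<leftarrow>y # ys. if m' = m then c else 0) * g m)
        = (\<Sum>m\<in>A. (if m0 = m then c * g m else 0) + (\<Sum>(c, m')\<leftarrow>ys. if m' = m then c else 0) * g m)"
      by (intro sum.cong) (auto simp: y algebra_simps)
    also have "\<dots> = (if m0 \<in> A then c * g m0 else 0) + (\<Sum>(c, m)\<leftarrow>ys. if m \<in> A then c * g m else 0)"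
      using fin by (simp add: sum.distrib Cons.IH)
    finally show ?case by (simp add: y)
  qed simp
  show ?thesis
    unfolding homogeneous_poly_def
    by (intro exI[of _ "\<lambda>m. \<Sum>(c, m')\<leftarrow>xs. if m' = m then c else 0"])
       (simp add: P group A_def[symmetric] flip: monomial_fun_def)
qed

text \<open>Homogeneity upgrades a bound on the unit ball to growth of order k everywhere, so the
  Liouville argument applies, and homogeneity again selects the degree.\<close>

lemma homogeneous_polyI:
  fixes P :: "complex ^ 'n \<Rightarrow> complex"
  assumes "\<And>a b. (\<lambda>\<zeta>. P (a + \<zeta> *s b)) holomorphic_on UNIV"
    and "\<And>t z. P (t *s z) = t ^ k * P z"
    and growth: "\<And>z. norm z \<le> 1 \<Longrightarrow> cmod (P z) \<le> M"
  shows "homogeneous_poly k P"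
proof (rule polynomial_fun_homogeneous)
  have "cmod (P z) \<le> M * (1 + norm z) ^ k" for z
  proof -
    \<comment> \<open>Rescaling by 1 + |z| instead of |z| moves z into the unit ball without
      excluding the origin.\<close>
    let ?r = "1 + norm z"
    have r: "0 < ?r" by (simp add: add_pos_nonneg)
    have "z = complex_of_real ?r *s (complex_of_real (1 / ?r) *s z)"
      using r
      by (simp add: of_real_vec_smult del: of_real_divide of_real_add)
    then have "P z = complex_of_real ?r ^ k * P (complex_of_real (1 / ?r) *s z)"
      using assms(2) by metis
    then have "cmod (P z) = ?r ^ k * cmod (P (complex_of_real (1 / ?r) *s z))"
      using r by (simp add: norm_mult norm_power del: of_real_divide of_real_add)
    moreover have "norm (complex_of_real (1 / ?r) *s z) \<le> 1"
      using r by (simp add: of_real_vec_smult divide_le_eq del: of_real_divide of_real_add)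
    ultimately show ?thesis
      using r mult_left_mono[OF growth, of "complex_of_real (1 / ?r) *s z" "?r ^ k"] by (simp add: mult.commute)
  qed
  then show "polynomial_fun P"
    using assms(1)
  proof (intro polynomial_fun_Liouville[of P M k UNIV])
    show "P z = P z'" if "\<And>j. j \<in> UNIV \<Longrightarrow> z $ j = z' $ j" for z z' :: "complex ^ 'n"
      using that by (metis UNIV_I vec_eq_iff)
  qed auto
qed (rule assms(2))

lemma homogeneous_poly_taylor_comp:
  assumes "entire_fun f"
  shows "homogeneous_poly k (taylor_comp f k)"
proof -
  obtain M where "\<And>k z. norm z \<le> 1 \<Longrightarrow> cmod (taylor_comp f k z) \<le> M * (1/2) ^ k"
    using taylor_comp_local_bound[OF assms] by blast
  then show ?thesis
    by (intro homogeneous_polyI[of "taylor_comp f k" k "M * (1/2) ^ k"] taylor_comp_holomorphic taylor_comp_smult assms)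
qed

section \<open>Uniqueness of homogeneous expansions\<close>

lemma homogeneous_poly_smult: "homogeneous_poly k p \<Longrightarrow> p (t *s z) = t ^ k * p z"
  unfolding homogeneous_poly_def
  by (auto simp: sum_distrib_left power_mult_distrib prod.distrib power_sum[symmetric] mult_ac intro!: sum.cong)

lemma entire_fun_homogeneous_poly:
  assumes "homogeneous_poly k p"
  shows "entire_fun p"
proof -
  obtain c where "\<And>z. p z = (\<Sum>m | (\<Sum>j\<in>UNIV. m j) = k. c m * (\<Prod>j\<in>UNIV. (z $ j) ^ m j))"
    using assms unfolding homogeneous_poly_def by blast
  then have "p = (\<lambda>z. \<Sum>m | (\<Sum>j\<in>UNIV. m j) = k. c m * (\<Prod>j\<in>UNIV. (z $ j) ^ m j))"
    by blast
  then show ?thesis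
    by (auto intro!: entire_fun_sum entire_fun_mult entire_fun_prod entire_fun_power entire_fun_const entire_fun_coord)
qed

lemma homogeneous_expansion_unique:
  assumes "homogeneous_expansion f p" "homogeneous_expansion f q"
  shows "p = q"
proof (intro ext)
  fix k z
  have *: "(\<lambda>k. r k z * t ^ k) sums f (t *s z)" if "homogeneous_expansion f r" for r t
  proof -
    have hom: "homogeneous_poly k (r k)" for k
      using that unfolding homogeneous_expansion_def by auto
    have "(\<lambda>k. r k (t *s z)) sums f (t *s z)"
      using that unfolding homogeneous_expansion_def by auto
    moreover have "r k (t *s z) = r k z * t ^ k" for k
      using homogeneous_poly_smult[OF hom, of k t z] by simp
    ultimately show ?thesis by (simp only:)
  qed
  show "p k z = q k z"
    by (rule powser_coeffs_unique[OF *[OF assms(1)] *[OF assms(2)]])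
qed

lemma hcomp_eqI: "homogeneous_expansion f p \<Longrightarrow> hcomp f = p"
  unfolding hcomp_def using homogeneous_expansion_unique by blast

lemma hcomp_entire:
  assumes "entire_fun f"
  shows "hcomp f = taylor_comp f"
proof (rule hcomp_eqI)
  show "homogeneous_expansion f (taylor_comp f)"
    unfolding homogeneous_expansion_def
    using homogeneous_poly_taylor_comp[OF assms] taylor_comp_sums[OF assms, of _ 1] by simp
qed

text \<open>Holomorphy on lines, scaling and a bound on the unit ball replace a multinomial
  expansion.\<close>

lemma homogeneous_poly_herm_power: "homogeneous_poly k (\<lambda>z. c * herm z w ^ k)"
proof (rule homogeneous_polyI)
  show "(\<lambda>\<zeta>. c * herm (a + \<zeta> *s b) w ^ k) holomorphic_on UNIV" for a b
    by (intro entire_fun_slice entire_fun_mult entire_fun_power entire_fun_const entire_fun_herm)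
  show "c * herm (t *s z) w ^ k = t ^ k * (c * herm z w ^ k)" for t z
    by (simp add: herm_smult_left power_mult_distrib)
  show "cmod (c * herm z w ^ k) \<le> cmod c * norm w ^ k" if "norm z \<le> 1" for z
  proof -
    have "norm z * norm w \<le> norm w"
      using that mult_right_mono[of "norm z" 1 "norm w"] by simp
    then have "cmod (herm z w) ^ k \<le> norm w ^ k"
      using norm_herm_le[of z w] by (intro power_mono) auto
    then show ?thesis by (simp add: norm_mult norm_power mult_left_mono)
  qed
qed

section \<open>Termwise integration\<close>

lemma sets_dV [measurable_cong, simp]: "sets dV = sets borel"
  by (simp add: dV_def)

lemma borel_measurable_cnj [measurable]:
  assumes "f \<in> borel_measurable M"
  shows "(\<lambda>x. cnj (f x)) \<in> borel_measurable M"
proof (rule measurable_compose[OF assms])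
  show "cnj \<in> borel_measurable borel"
    by (intro borel_measurable_continuous_onI continuous_intros)
qed

lemma integral_dV_distr:
  fixes f :: "complex ^ 'n \<Rightarrow> complex" and T :: "complex ^ 'n \<Rightarrow> complex ^ 'n"
  assumes [measurable]: "f \<in> borel_measurable borel" "T \<in> borel_measurable borel"
    and T: "distr lborel borel T = (lborel :: (complex ^ 'n) measure)"
  shows "(\<integral>z. f (T z) \<partial>dV) = (\<integral>z. f z \<partial>dV)"
proof -
  obtain c where c: "0 < c" "(dV :: (complex ^ 'n) measure) = density lborel (\<lambda>_. ennreal c)"
    by (rule dV_eq_density)
  have "(\<integral>z. c *\<^sub>R f z \<partial>lborel) = (\<integral>z. c *\<^sub>R f z \<partial>distr lborel borel T)"
    by (simp add: T)
  also have "\<dots> = (\<integral>z. c *\<^sub>R f (T z) \<partial>lborel)"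
    by (rule integral_distr) auto
  finally show ?thesis
    using c(1) by (simp add: c(2) integral_density)
qed

lemma integral_dV_rotate:
  fixes f :: "complex ^ 'n \<Rightarrow> complex"
  assumes "f \<in> borel_measurable borel" "cmod u = 1"
  shows "(\<integral>z. f (u *s z) \<partial>dV) = (\<integral>z. f z \<partial>dV)"
proof (rule integral_dV_distr)
  have "continuous_on UNIV (\<lambda>z :: complex ^ 'n. u *s z)"
    using linear_vec_smult linear_continuous_on linear_conv_bounded_linear by blast
  then show "(\<lambda>z :: complex ^ 'n. u *s z) \<in> borel_measurable borel"
    by (rule borel_measurable_continuous_onI)
  show "distr lborel borel (\<lambda>z :: complex ^ 'n. u *s z) = lborel"
    using assms by (intro lborel_distr_isometry linear_vec_smult) (simp add: norm_vec_smult)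
qed (rule assms)

lemma integral_dV_shift:
  fixes f :: "complex ^ 'n \<Rightarrow> complex"
  assumes "f \<in> borel_measurable borel"
  shows "(\<integral>z. f (z + w) \<partial>dV) = (\<integral>z. f z \<partial>dV)"
proof (rule integral_dV_distr)
  have "(+) w = (\<lambda>z. z + w)" by (auto simp: add.commute)
  then show "distr lborel borel (\<lambda>z. z + w) = lborel"
    using lborel_distr_plus[of w] by simp
qed (use assms in auto)

section \<open>Moments in the squared norm\<close>

abbreviation moment :: "real \<Rightarrow> (real \<Rightarrow> real) \<Rightarrow> real" where
  "moment b \<phi> \<equiv> (\<integral>t. t powr (b - 1) * indicator {0<..} t * \<phi> t \<partial>lborel)"

abbreviation has_moment :: "real \<Rightarrow> (real \<Rightarrow> real) \<Rightarrow> bool" where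
  "has_moment b \<phi> \<equiv> integrable lborel (\<lambda>t. t powr (b - 1) * indicator {0<..} t * \<phi> t)"

lemma has_bochner_integral_dV:
  obtains c where "0 < c" "\<And>f :: complex ^ 'n \<Rightarrow> 'b::{banach, second_countable_topology}. \<And>x. has_bochner_integral lborel f x \<Longrightarrow>
    has_bochner_integral dV f (c *\<^sub>R x)"
proof -
  obtain c where c: "0 < c" "(dV :: (complex ^ 'n) measure) = density lborel (\<lambda>_. ennreal c)"
    by (rule dV_eq_density)
  have "has_bochner_integral dV f (c *\<^sub>R x)" if "has_bochner_integral lborel f x"
    for f :: "complex ^ 'n \<Rightarrow> 'b" and x
  proof -
    from that have [measurable]: "f \<in> borel_measurable borel"
      by (auto dest: borel_measurable_has_bochner_integral)
    show ?thesis
      using that c(1) unfolding has_bochner_integral_iff c(2)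
      by (simp add: integrable_density integral_density)
  qed
  with c(1) show ?thesis by (rule that)
qed

text \<open>Real dimension 2n and degree 2k give the exponent n + k after halving. With b = n + k,
  the moment of \<open>exp (- t)\<close> is the value of Gamma at b, the numerator in the kernel
  coefficients.\<close>

lemma has_integral_dV_radial:
  fixes H :: "complex ^ 'n \<Rightarrow> complex"
  assumes "continuous_on UNIV H"
    and "\<And>t x. 0 < t \<Longrightarrow> H (t *\<^sub>R x) = of_real (t ^ (2 * k)) * H x"
  shows "\<exists>D. \<forall>\<phi>. \<phi> \<in> borel_measurable borel \<longrightarrow> (\<forall>t. 0 \<le> \<phi> t) \<longrightarrow>
    has_moment (real CARD('n) + real k) \<phi> \<longrightarrow>
    has_bochner_integral dV (\<lambda>x. H x * of_real (\<phi> ((norm x)\<^sup>2)))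
      (D * of_real (moment (real CARD('n) + real k) \<phi>))"
proof -
  have dim: "(real DIM(complex ^ 'n) + real (2 * k)) / 2 = real CARD('n) + real k"
    by simp
  obtain c where c: "\<And>f :: complex ^ 'n \<Rightarrow> complex. \<And>x. has_bochner_integral lborel f x \<Longrightarrow>
    has_bochner_integral dV f (c *\<^sub>R x)"
    using has_bochner_integral_dV by metis
  obtain D where D: "\<forall>\<phi>. \<phi> \<in> borel_measurable borel \<longrightarrow> (\<forall>t. 0 \<le> \<phi> t) \<longrightarrow>
    has_moment (real CARD('n) + real k) \<phi> \<longrightarrow>
    has_bochner_integral lborel (\<lambda>x. H x * of_real (\<phi> ((norm x)\<^sup>2)))
      (D * of_real (moment (real CARD('n) + real k) \<phi>))"
    using has_integral_radial[OF assms] unfolding dim by blast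
  show ?thesis
  proof (intro exI[of _ "of_real c * D"] allI impI)
    fix \<phi> :: "real \<Rightarrow> real"
    assume "\<phi> \<in> borel_measurable borel" "\<forall>t. 0 \<le> \<phi> t" "has_moment (real CARD('n) + real k) \<phi>"
    with D have "has_bochner_integral lborel (\<lambda>x. H x * of_real (\<phi> ((norm x)\<^sup>2)))
      (D * of_real (moment (real CARD('n) + real k) \<phi>))" by blast
    from c[OF this] show "has_bochner_integral dV (\<lambda>x. H x * of_real (\<phi> ((norm x)\<^sup>2)))
      (of_real c * D * of_real (moment (real CARD('n) + real k) \<phi>))"
      by (simp add: scaleR_conv_of_real mult.assoc)
  qed
qed

lemma integrable_dV_radial:
  assumes "\<phi> \<in> borel_measurable borel" "\<And>t. 0 \<le> \<phi> t" "has_moment (real CARD('n)) \<phi>"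
  shows "integrable dV (\<lambda>x :: complex ^ 'n. \<phi> ((norm x)\<^sup>2))"
proof -
  obtain D where "\<forall>\<phi>. \<phi> \<in> borel_measurable borel \<longrightarrow> (\<forall>t. 0 \<le> \<phi> t) \<longrightarrow>
    has_moment (real CARD('n)) \<phi> \<longrightarrow>
    has_bochner_integral dV (\<lambda>x :: complex ^ 'n. 1 * complex_of_real (\<phi> ((norm x)\<^sup>2)))
      (D * of_real (moment (real CARD('n)) \<phi>))"
    using has_integral_dV_radial[of "\<lambda>_ :: complex ^ 'n. 1" 0] by auto
  with assms have "integrable dV (\<lambda>x :: complex ^ 'n. complex_of_real (\<phi> ((norm x)\<^sup>2)))"
    by (auto simp: has_bochner_integral_iff)
  then show ?thesis
    using integrable_Re by fastforce
qed

lemma has_moment_exp: "0 < b \<Longrightarrow> has_moment b (\<lambda>t. exp (- t))"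
  using integral_powr_exp by (auto simp: has_bochner_integral_iff)

lemma moment_exp: "0 < b \<Longrightarrow> moment b (\<lambda>t. exp (- t)) = Gamma b"
  using integral_powr_exp by (auto simp: has_bochner_integral_iff)

lemma has_moment_exp_half:
  assumes "0 < b"
  shows "has_moment b (\<lambda>t. exp (- t / 2))"
proof -
  have "integrable lborel (\<lambda>t. (0 + 1/2 * t) powr (b - 1) * indicator {0<..} (0 + 1/2 * t) * exp (- (0 + 1/2 * t)))"
    using has_moment_exp[OF assms] by (rule lborel_integrable_real_affine) simp
  then have "integrable lborel (\<lambda>t. 2 powr (b - 1) * ((1/2 * t) powr (b - 1) * indicator {0<..} (1/2 * t) * exp (- (1/2 * t))))"
    by simp
  moreover have "2 powr (b - 1) * ((1/2 * t) powr (b - 1) * indicator {0<..} (1/2 * t) * exp (- (1/2 * t)))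
      = t powr (b - 1) * indicator {0<..} t * exp (- t / 2)" for t :: real
    by (cases "0 < t") (auto simp: powr_mult[symmetric] indicator_def powr_divide)
  ultimately show ?thesis by (simp only:)
qed

text \<open>Completing the square sacrifices half of the Gaussian to absorb the exponential; the
  remaining half has finite moments.\<close>

lemma integrable_dV_exp_norm:
  "integrable dV (\<lambda>z :: complex ^ 'n. exp (c * norm z - (norm z)\<^sup>2))"
proof (rule Bochner_Integration.integrable_bound)
  show "integrable dV (\<lambda>z :: complex ^ 'n. exp (c\<^sup>2 / 2) * exp (- (norm z)\<^sup>2 / 2))"
    using integrable_dV_radial[OF _ _ has_moment_exp_half, where 'n='n] by simp
  have "c * norm z - (norm z)\<^sup>2 \<le> c\<^sup>2 / 2 + - (norm z)\<^sup>2 / 2" for z :: "complex ^ 'n"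
    using zero_le_power2[of "c - norm z"] by (simp add: power2_eq_square algebra_simps)
  then show "AE z :: complex ^ 'n in dV. norm (exp (c * norm z - (norm z)\<^sup>2)) \<le> norm (exp (c\<^sup>2 / 2) * exp (- (norm z)\<^sup>2 / 2))"
    by (simp flip: exp_add)
qed simp

lemma integrable_dV_of_growth:
  fixes g :: "complex ^ 'n \<Rightarrow> 'b::{banach, second_countable_topology}"
  assumes "g \<in> borel_measurable borel" "\<And>z. norm (g z) \<le> C * exp (c * norm z - (norm z)\<^sup>2)"
  shows "integrable dV g"
proof (rule Bochner_Integration.integrable_bound)
  show "integrable dV (\<lambda>z :: complex ^ 'n. C * exp (c * norm z - (norm z)\<^sup>2))"
    by (intro integrable_mult_right integrable_dV_exp_norm)
  show "AE z in dV. norm (g z) \<le> norm (C * exp (c * norm z - (norm z)\<^sup>2))"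
    using assms(2) order_trans[OF _ abs_ge_self] by auto
qed (use assms in auto)

section \<open>Orthogonality of degrees and locally uniform expansions\<close>

lemma AE_dV_nonzero: "AE z in dV. z \<noteq> (0 :: complex ^ 'n)"
proof -
  obtain c where "(dV :: (complex ^ 'n) measure) = density lborel (\<lambda>_. ennreal c)"
    by (rule dV_eq_density)
  then show ?thesis
    by (subst \<open>dV = _\<close>, subst AE_density) (auto intro!: AE_I[of _ _ "{0}"])
qed

lemma integral_dV_orthogonal:
  fixes f g :: "complex ^ 'n \<Rightarrow> complex"
  assumes [measurable]: "f \<in> borel_measurable borel" "g \<in> borel_measurable borel" "\<phi> \<in> borel_measurable borel"
    and f: "\<And>u z. f (u *s z) = u ^ k * f z" and g: "\<And>u z. g (u *s z) = u ^ l * g z"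
    and "k \<noteq> l"
  shows "(\<integral>z. f z * cnj (g z) * of_real (\<phi> ((norm z)\<^sup>2)) \<partial>dV) = 0"
proof -
  \<comment> \<open>The angle is chosen so that (k - l)\<theta> = \<open>pi\<close>. One rotation
    then changes the sign of the integrand, which replaces averaging over the circle.\<close>
  define \<theta> where "\<theta> = pi / (real k - real l)"
  define u where "u = cis \<theta>"
  have "u ^ k * cnj (u ^ l) = cis (real k * \<theta> - real l * \<theta>)"
    by (simp add: u_def Complex.DeMoivre cis_mult cis_cnj)
  also have "real k * \<theta> - real l * \<theta> = (real k - real l) * \<theta>"
    by (rule left_diff_distrib[symmetric])
  also have "\<dots> = pi"
    using \<open>k \<noteq> l\<close> by (simp add: \<theta>_def)
  finally have u: "u ^ k * cnj (u ^ l) = -1" by simp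
  let ?h = "\<lambda>z. f z * cnj (g z) * of_real (\<phi> ((norm z)\<^sup>2))"
  have "(\<integral>z. ?h z \<partial>dV) = (\<integral>z. ?h (u *s z) \<partial>dV)"
    by (rule integral_dV_rotate[symmetric]) (auto simp: u_def)
  also have "?h (u *s z) = - ?h z" for z
  proof -
    have "?h (u *s z) = (u ^ k * cnj (u ^ l)) * ?h z"
      by (simp add: f g norm_vec_smult u_def)
    then show ?thesis unfolding u by simp
  qed
  then have "(\<integral>z. ?h (u *s z) \<partial>dV) = - (\<integral>z. ?h z \<partial>dV)" by simp
  finally show ?thesis by simp
qed

text \<open>Termwise integration consumes the geometric bound on each ball. As it concerns the
  components, it passes at once to truncated series, hence to \<open>low_part\<close> and
  \<open>high_part\<close>.\<close>

definition normal_expansion ::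
    "(complex ^ 'n \<Rightarrow> complex) \<Rightarrow> (nat \<Rightarrow> complex ^ 'n \<Rightarrow> complex) \<Rightarrow> bool" where
  "normal_expansion f p \<longleftrightarrow> homogeneous_expansion f p \<and>
     (\<forall>R. \<exists>M>0. \<forall>k z. norm z \<le> R \<longrightarrow> cmod (p k z) \<le> M * (1/2) ^ k)"

lemma normal_expansion_homogeneous: "normal_expansion f p \<Longrightarrow> homogeneous_poly k (p k)"
  by (simp add: normal_expansion_def homogeneous_expansion_def)

lemma normal_expansion_sums: "normal_expansion f p \<Longrightarrow> (\<lambda>k. p k z) sums f z"
  by (simp add: normal_expansion_def homogeneous_expansion_def)

lemma normal_expansion_hcomp: "normal_expansion f p \<Longrightarrow> hcomp f = p"
  unfolding normal_expansion_def by (blast intro: hcomp_eqI)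

lemma normal_expansion_bound:
  assumes "normal_expansion f p"
  obtains M where "0 < M" "\<And>k z. norm z \<le> R \<Longrightarrow> cmod (p k z) \<le> M * (1/2) ^ k"
    "\<And>z. norm z \<le> R \<Longrightarrow> cmod (f z) \<le> 2 * M"
proof -
  obtain M where M: "0 < M" "\<And>k z. norm z \<le> R \<Longrightarrow> cmod (p k z) \<le> M * (1/2) ^ k"
    using assms unfolding normal_expansion_def by blast
  have "cmod (f z) \<le> 2 * M" if "norm z \<le> R" for z
  proof (rule norm_sums_le)
    show "(\<lambda>k. p k z) sums f z" using assms by (rule normal_expansion_sums)
    show "(\<lambda>k. M * (1/2) ^ k) sums (2 * M)"
      using sums_mult[OF geometric_sums[of "1/2 :: real"], of M] by (simp add: mult.commute)
  qed (use M that in auto)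
  with M show ?thesis by (rule that)
qed

lemma borel_measurable_homogeneous_poly: "homogeneous_poly k p \<Longrightarrow> p \<in> borel_measurable borel"
  by (intro borel_measurable_continuous_onI entire_fun_continuous entire_fun_homogeneous_poly)

lemma borel_measurable_normal_expansion:
  assumes "normal_expansion f p"
  shows "f \<in> borel_measurable borel"
proof -
  have [measurable]: "p k \<in> borel_measurable borel" for k
    using normal_expansion_homogeneous[OF assms] by (rule borel_measurable_homogeneous_poly)
  have "f = (\<lambda>z. \<Sum>k. p k z)"
    using normal_expansion_sums[OF assms] by (auto simp: sums_iff)
  then show ?thesis by simp
qed

lemma normal_expansion_entire:
  assumes "entire_fun f"
  shows "normal_expansion f (hcomp f)"
  unfolding normal_expansion_def hcomp_entire[OF assms] homogeneous_expansion_def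
  using homogeneous_poly_taylor_comp[OF assms] taylor_comp_sums[OF assms, of _ 1]
  by (auto intro: taylor_comp_local_bound[OF assms])

lemma homogeneous_poly_0: "homogeneous_poly k (\<lambda>_. 0)"
  unfolding homogeneous_poly_def by (rule exI[of _ "\<lambda>_. 0"]) simp

lemma normal_expansion_restrict:
  assumes "normal_expansion f p"
  shows "normal_expansion (\<lambda>z. \<Sum>k. if k \<in> A then p k z else 0) (\<lambda>k z. if k \<in> A then p k z else 0)"
  unfolding normal_expansion_def homogeneous_expansion_def
proof (intro conjI allI)
  show "homogeneous_poly k (\<lambda>z. if k \<in> A then p k z else 0)" for k
    using normal_expansion_homogeneous[OF assms] homogeneous_poly_0 by (cases "k \<in> A") auto
  show "(\<lambda>k. if k \<in> A then p k z else 0) sums (\<Sum>k. if k \<in> A then p k z else 0)" for z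
  proof -
    obtain M where "\<And>k z'. norm z' \<le> norm z \<Longrightarrow> cmod (p k z') \<le> M * (1/2) ^ k" "0 < M"
      using normal_expansion_bound[OF assms] by metis
    then have le: "cmod (if k \<in> A then p k z else 0) \<le> M * (1/2) ^ k" for k
      by (cases "k \<in> A") (simp_all only: if_True if_False, auto)
    have "summable (\<lambda>k. if k \<in> A then p k z else 0)"
    proof (rule summable_comparison_test'[of _ 0, OF _ le])
      show "summable (\<lambda>k. M * (1/2) ^ k)" by (intro summable_mult summable_geometric) simp
    qed
    then show ?thesis by (rule summable_sums)
  qed
  show "\<exists>M>0. \<forall>k z. norm z \<le> R \<longrightarrow> cmod (if k \<in> A then p k z else 0) \<le> M * (1/2) ^ k" for R
  proof -
    obtain M where "\<And>k z. norm z \<le> R \<Longrightarrow> cmod (p k z) \<le> M * (1/2) ^ k" "0 < M"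
      using normal_expansion_bound[OF assms] by metis
    then show ?thesis by (intro exI[of _ M]) auto
  qed
qed

text \<open>A geometric series times the integrable \<open>W\<close> dominates absolutely. The bound
  is asked only where \<open>W\<close> is nonzero, so a weight supported in a ball turns local
  estimates into global ones.\<close>

lemma sums_integral_weighted:
  fixes u :: "nat \<Rightarrow> 'a \<Rightarrow> complex" and W :: "'a \<Rightarrow> real"
  assumes [measurable]: "\<And>k. u k \<in> borel_measurable M"
    and W: "integrable M W" "\<And>z. 0 \<le> W z"
    and bound: "\<And>k z. W z \<noteq> 0 \<Longrightarrow> cmod (u k z) \<le> B * (1/2) ^ k"
    and sums: "\<And>z. (\<lambda>k. u k z) sums U z"
  shows "(\<lambda>k. \<integral>z. u k z * of_real (W z) \<partial>M) sums (\<integral>z. U z * of_real (W z) \<partial>M)"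
proof -
  have [measurable]: "W \<in> borel_measurable M" using W(1) by simp
  have le: "cmod (u k z * of_real (W z)) \<le> B * (1/2) ^ k * W z" for k z
    using bound[of z k] W(2)[of z] by (cases "W z = 0") (auto simp: norm_mult mult_right_mono)
  have int: "integrable M (\<lambda>z. u k z * of_real (W z))" for k
  proof (rule Bochner_Integration.integrable_bound)
    show "integrable M (\<lambda>z. B * (1/2) ^ k * W z)" using W(1) by simp
    show "AE z in M. cmod (u k z * of_real (W z)) \<le> norm (B * (1/2) ^ k * W z)"
      using le order_trans[OF le abs_ge_self] by auto
  qed simp
  have smb: "summable (\<lambda>k. B * (1/2) ^ k * c)" for c :: real
    by (intro summable_mult summable_mult2 summable_geometric) simp
  have "(\<lambda>k. \<integral>z. u k z * of_real (W z) \<partial>M) sums (\<integral>z. (\<Sum>k. u k z * of_real (W z)) \<partial>M)"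
  proof (rule sums_integral[OF int])
    show "AE z in M. summable (\<lambda>k. cmod (u k z * of_real (W z)))"
      by (intro AE_I2 summable_comparison_test'[OF smb, of 0]) (use le in auto)
    have "norm (\<integral>z. cmod (u k z * of_real (W z)) \<partial>M) \<le> B * (1/2) ^ k * (\<integral>z. W z \<partial>M)" for k
    proof -
      have "(\<integral>z. cmod (u k z * of_real (W z)) \<partial>M) \<le> (\<integral>z. B * (1/2) ^ k * W z \<partial>M)"
        using int W le by (intro integral_mono) auto
      then show ?thesis by simp
    qed
    then show "summable (\<lambda>k. \<integral>z. cmod (u k z * of_real (W z)) \<partial>M)"
      by (intro summable_comparison_test'[OF smb, of 0]) auto
  qed
  moreover have "(\<Sum>k. u k z * of_real (W z)) = U z * of_real (W z)" for z
    using sums_mult2[OF sums] by (simp add: sums_iff)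
  ultimately show ?thesis by simp
qed

text \<open>\<open>F\<close> is expanded with \<open>G\<close> kept whole; then \<open>G\<close> is
  expanded against one component of \<open>F\<close> at a time, and orthogonality leaves the
  diagonal. Double series are thereby avoided, and the support of \<open>\<phi>\<close> confines all
  estimates to one ball.\<close>

lemma pairing_sums:
  fixes F G :: "complex ^ 'n \<Rightarrow> complex"
  assumes F: "normal_expansion F p" and G: "normal_expansion G q"
    and [measurable]: "\<phi> \<in> borel_measurable borel" and pos: "\<And>t. 0 \<le> \<phi> t"
    and mom: "has_moment (real CARD('n)) \<phi>"
    and supp: "\<And>t. R\<^sup>2 < t \<Longrightarrow> \<phi> t = 0" and R: "0 \<le> R"
  shows "(\<lambda>k. \<integral>z. p k z * cnj (q k z) * of_real (\<phi> ((norm z)\<^sup>2)) \<partial>dV)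
    sums (\<integral>z. F z * cnj (G z) * of_real (\<phi> ((norm z)\<^sup>2)) \<partial>dV)"
proof -
  let ?W = "\<lambda>z :: complex ^ 'n. \<phi> ((norm z)\<^sup>2)"
  have W: "integrable dV ?W" using pos mom by (intro integrable_dV_radial) auto
  have R: "norm z \<le> R" if "?W z \<noteq> 0" for z
    using supp[of "(norm z)\<^sup>2"] that R power2_le_imp_le[of "norm z" R] by fastforce
  have [measurable]: "p k \<in> borel_measurable borel" "q k \<in> borel_measurable borel" for k
    using F G by (auto intro: borel_measurable_homogeneous_poly normal_expansion_homogeneous)
  have [measurable]: "F \<in> borel_measurable borel" "G \<in> borel_measurable borel"
    using F G by (auto intro: borel_measurable_normal_expansion)
  obtain M where M: "0 < M" "\<And>k z. norm z \<le> R \<Longrightarrow> cmod (p k z) \<le> M * (1/2) ^ k"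
    using normal_expansion_bound[OF F] by metis
  obtain N where N: "0 < N" "\<And>k z. norm z \<le> R \<Longrightarrow> cmod (q k z) \<le> N * (1/2) ^ k"
      "\<And>z. norm z \<le> R \<Longrightarrow> cmod (G z) \<le> 2 * N"
    using normal_expansion_bound[OF G] by metis
  have "(\<lambda>k. \<integral>z. p k z * cnj (G z) * of_real (?W z) \<partial>dV) sums (\<integral>z. F z * cnj (G z) * of_real (?W z) \<partial>dV)"
  proof (rule sums_integral_weighted[OF _ W, where B="M * (2 * N)"])
    show "(\<lambda>z. p k z * cnj (G z)) \<in> borel_measurable dV" for k by measurable
    show "cmod (p k z * cnj (G z)) \<le> M * (2 * N) * (1/2) ^ k" if "?W z \<noteq> 0" for k z
      using mult_mono[OF M(2)[OF R[OF that], of k] N(3)[OF R[OF that]]] M by (simp add: norm_mult mult_ac)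
    show "(\<lambda>k. p k z * cnj (G z)) sums (F z * cnj (G z))" for z
      by (intro sums_mult2 normal_expansion_sums[OF F])
  qed (use pos in auto)
  moreover have "(\<integral>z. p k z * cnj (G z) * of_real (?W z) \<partial>dV) = (\<integral>z. p k z * cnj (q k z) * of_real (?W z) \<partial>dV)" for k
  proof -
    have "(\<lambda>l. \<integral>z. p k z * cnj (q l z) * of_real (?W z) \<partial>dV) sums (\<integral>z. p k z * cnj (G z) * of_real (?W z) \<partial>dV)"
    proof (rule sums_integral_weighted[OF _ W, where B="M * N"])
      show "(\<lambda>z. p k z * cnj (q l z)) \<in> borel_measurable dV" for l by measurable
      show "cmod (p k z * cnj (q l z)) \<le> M * N * (1/2) ^ l" if "?W z \<noteq> 0" for l z
      proof -
        have "M * (1/2) ^ k \<le> M"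
          using M(1) by (simp add: power_le_one mult_left_le)
        then have "cmod (p k z) \<le> M" using M(2)[OF R[OF that], of k] by linarith
        from mult_mono[OF this N(2)[OF R[OF that], of l]] M show ?thesis
          by (simp add: norm_mult mult_ac)
      qed
      show "(\<lambda>l. p k z * cnj (q l z)) sums (p k z * cnj (G z))" for z
        using normal_expansion_sums[OF G] by (intro sums_mult) (simp add: sums_cnj)
    qed (use pos in auto)
    moreover have "(\<integral>z. p k z * cnj (q l z) * of_real (?W z) \<partial>dV) = 0" if "l \<notin> {k}" for l
    proof (rule integral_dV_orthogonal)
      show "p k (u *s z) = u ^ k * p k z" for u z
        by (rule homogeneous_poly_smult[OF normal_expansion_homogeneous[OF F]])
      show "q l (u *s z) = u ^ l * q l z" for u z
        by (rule homogeneous_poly_smult[OF normal_expansion_homogeneous[OF G]])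
    qed (use that in auto)
    then have "(\<lambda>l. \<integral>z. p k z * cnj (q l z) * of_real (?W z) \<partial>dV) sums
        (\<Sum>l\<in>{k}. \<integral>z. p k z * cnj (q l z) * of_real (?W z) \<partial>dV)"
      by (intro sums_finite) auto
    ultimately show ?thesis
      by (auto dest: sums_unique2)
  qed
  ultimately show ?thesis by simp
qed

section \<open>Cutting off radial weights\<close>

text \<open>
  The cutoff at the origin is needed because for \<open>\<alpha> \<ge> 2n\<close> the weight is not integrable there.
\<close>

definition cutoff :: "nat \<Rightarrow> (real \<Rightarrow> real) \<Rightarrow> real \<Rightarrow> real" where
  "cutoff N \<phi> t = indicator {1 / (real N + 1)..real N + 1} t * \<phi> t"

lemma cutoff_measurable [measurable]: "\<phi> \<in> borel_measurable borel \<Longrightarrow> cutoff N \<phi> \<in> borel_measurable borel"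
  unfolding cutoff_def[abs_def] by measurable

lemma cutoff_nonneg: "(\<And>t. 0 \<le> \<phi> t) \<Longrightarrow> 0 \<le> cutoff N \<phi> t"
  by (simp add: cutoff_def)

lemma cutoff_le: "(\<And>t. 0 \<le> \<phi> t) \<Longrightarrow> cutoff N \<phi> t \<le> \<phi> t"
  by (simp add: cutoff_def indicator_def)

lemma cutoff_tendsto:
  assumes "0 < t"
  shows "(\<lambda>N. cutoff N \<phi> t) \<longlonglongrightarrow> \<phi> t"
proof (rule tendsto_eventually)
  have "(\<lambda>N. 1 / (real N + 1)) \<longlonglongrightarrow> 0" "filterlim (\<lambda>N. real N + 1) at_top sequentially"
    by real_asymp+
  then have "\<forall>\<^sub>F N in sequentially. 1 / (real N + 1) < t" "\<forall>\<^sub>F N in sequentially. t \<le> real N + 1"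
    using assms by (auto intro: order_tendstoD simp: filterlim_at_top)
  then show "\<forall>\<^sub>F N in sequentially. cutoff N \<phi> t = \<phi> t"
    by eventually_elim (simp add: cutoff_def)
qed

lemma has_moment_cutoff:
  assumes "continuous_on {0<..} \<phi>"
  shows "has_moment b (cutoff N \<phi>)"
proof -
  have pos: "0 < t" if "1 / (real N + 1) \<le> t" for t
    using that by (intro less_le_trans[of 0 "1 / (real N + 1)" t]) auto
  then have "continuous_on {1 / (real N + 1)..real N + 1} (\<lambda>t. t powr (b - 1) * \<phi> t)"
    using assms by (intro continuous_intros continuous_on_subset[OF assms]) auto
  from borel_integrable_atLeastAtMost'[OF this] show ?thesis
    unfolding set_integrable_def
  proof (rule Bochner_Integration.integrable_cong[THEN iffD1, OF refl, rotated])
    fix t :: real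
    show "indicator {1 / (real N + 1)..real N + 1} t *\<^sub>R (t powr (b - 1) * \<phi> t)
        = t powr (b - 1) * indicator {0<..} t * cutoff N \<phi> t"
      using pos[of t] by (auto simp: cutoff_def indicator_def)
  qed
qed

lemma integral_cutoff_tendsto:
  fixes F :: "complex ^ 'n \<Rightarrow> complex"
  assumes [measurable]: "F \<in> borel_measurable borel" "\<phi> \<in> borel_measurable borel"
    and pos: "\<And>t. 0 \<le> \<phi> t"
    and int: "integrable dV (\<lambda>z. F z * of_real (\<phi> ((norm z)\<^sup>2)))"
  shows "(\<lambda>N. \<integral>z. F z * of_real (cutoff N \<phi> ((norm z)\<^sup>2)) \<partial>dV)
    \<longlonglongrightarrow> (\<integral>z. F z * of_real (\<phi> ((norm z)\<^sup>2)) \<partial>dV)"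
proof (rule integral_dominated_convergence)
  show "integrable dV (\<lambda>z. norm (F z * of_real (\<phi> ((norm z)\<^sup>2))))"
    using int by (rule integrable_norm)
  show "AE z in dV. (\<lambda>N. F z * of_real (cutoff N \<phi> ((norm z)\<^sup>2))) \<longlonglongrightarrow> F z * of_real (\<phi> ((norm z)\<^sup>2))"
    using AE_dV_nonzero by eventually_elim (intro tendsto_intros cutoff_tendsto, simp)
  show "AE z in dV. norm (F z * of_real (cutoff N \<phi> ((norm z)\<^sup>2))) \<le> norm (F z * of_real (\<phi> ((norm z)\<^sup>2)))" for N
    using cutoff_le[of \<phi>, OF pos] cutoff_nonneg[of \<phi>, OF pos] pos
    by (intro AE_I2) (auto simp: norm_mult intro!: mult_left_mono)
qed measurable

lemma moment_cutoff_tendsto: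
  assumes [measurable]: "\<phi> \<in> borel_measurable borel" and pos: "\<And>t. 0 \<le> \<phi> t" and "has_moment b \<phi>"
  shows "(\<lambda>N. moment b (cutoff N \<phi>)) \<longlonglongrightarrow> moment b \<phi>"
proof (rule integral_dominated_convergence)
  show "integrable lborel (\<lambda>t. t powr (b - 1) * indicator {0<..} t * \<phi> t)" by fact
  show "AE t in lborel. (\<lambda>N. t powr (b - 1) * indicator {0<..} t * cutoff N \<phi> t)
      \<longlonglongrightarrow> t powr (b - 1) * indicator {0<..} t * \<phi> t"
  proof (rule AE_I2)
    fix t :: real
    show "(\<lambda>N. t powr (b - 1) * indicator {0<..} t * cutoff N \<phi> t)
      \<longlonglongrightarrow> t powr (b - 1) * indicator {0<..} t * \<phi> t"
      by (cases "0 < t") (auto intro!: tendsto_intros cutoff_tendsto)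
  qed
  show "AE t in lborel. norm (t powr (b - 1) * indicator {0<..} t * cutoff N \<phi> t)
      \<le> t powr (b - 1) * indicator {0<..} t * \<phi> t" for N
    using cutoff_le[of \<phi>, OF pos] cutoff_nonneg[of \<phi>, OF pos] pos
    by (intro AE_I2) (auto simp: abs_mult intro!: mult_left_mono)
qed measurable

lemma moment_cutoff_le:
  assumes "\<And>t. 0 \<le> \<phi> t" "has_moment b \<phi>" "continuous_on {0<..} \<phi>"
  shows "0 \<le> moment b (cutoff N \<phi>)" "moment b (cutoff N \<phi>) \<le> moment b \<phi>"
proof -
  show "0 \<le> moment b (cutoff N \<phi>)"
    using assms by (intro integral_nonneg_AE) (auto simp: cutoff_nonneg)
  show "moment b (cutoff N \<phi>) \<le> moment b \<phi>"
    using assms has_moment_cutoff cutoff_le by (intro integral_mono) (auto intro!: mult_left_mono)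
qed

lemma pairing_cutoff_sums:
  fixes F G :: "complex ^ 'n \<Rightarrow> complex"
  assumes "normal_expansion F p" "normal_expansion G q"
    and "\<phi> \<in> borel_measurable borel" "\<And>t. 0 \<le> \<phi> t" "continuous_on {0<..} \<phi>"
  shows "(\<lambda>k. \<integral>z. p k z * cnj (q k z) * of_real (cutoff N \<phi> ((norm z)\<^sup>2)) \<partial>dV)
    sums (\<integral>z. F z * cnj (G z) * of_real (cutoff N \<phi> ((norm z)\<^sup>2)) \<partial>dV)"
\<comment> \<open>The cutoff bounds the squared norm by N + 1, while \<open>R\<close> bounds the
  norm; as N + 1 is at most its square, the same number serves.\<close>
proof (rule pairing_sums[where R = "real N + 1"])
  fix t :: real assume "(real N + 1)\<^sup>2 < t"
  moreover have "real N + 1 \<le> (real N + 1)\<^sup>2"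
    by (simp add: power2_eq_square)
  ultimately show "cutoff N \<phi> t = 0" by (simp add: cutoff_def)
qed (use assms has_moment_cutoff in \<open>auto simp: cutoff_nonneg\<close>)

lemma continuous_on_exp_neg: "continuous_on S (\<lambda>t::real. exp (- t))"
  by (intro continuous_intros)

lemma normal_expansion_single:
  assumes "homogeneous_poly k p"
  shows "normal_expansion p (\<lambda>l z. if l = k then p z else 0)"
  unfolding normal_expansion_def homogeneous_expansion_def
proof (intro conjI allI)
  show "homogeneous_poly l (\<lambda>z. if l = k then p z else 0)" for l
    using assms homogeneous_poly_0 by (cases "l = k") auto
  show "(\<lambda>l. if l = k then p z else 0) sums p z" for z
    using sums_single[of k "\<lambda>_. p z"] by simp
  show "\<exists>M>0. \<forall>l z. norm z \<le> R \<longrightarrow> cmod (if l = k then p z else 0) \<le> M * (1/2) ^ l" for R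
  proof -
    obtain M where "0 < M" "\<And>z. norm z \<le> R \<Longrightarrow> cmod (p z) \<le> M"
      using entire_fun_bounded_on_ball[OF entire_fun_homogeneous_poly[OF assms]] by blast
    then show ?thesis
      \<comment> \<open>The factor \<open>2 ^ k\<close> compensates \<open>(1/2) ^ l\<close> at the
        only nonzero index l = k.\<close>
      by (intro exI[of _ "M * 2 ^ k"]) (auto simp: power_one_over)
  qed
qed

text \<open>Pairing \<open>g\<close> with the constant 1 on an annulus leaves only degree 0, so each
  cut integral is \<open>g 0\<close> times the cut mass; in the limit the mass is 1.\<close>

lemma integral_gaussian_mean_value:
  fixes g :: "complex ^ 'n \<Rightarrow> complex"
  assumes g: "entire_fun g" and int: "integrable dV (\<lambda>z. g z * of_real (exp (- (norm z)\<^sup>2)))"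
  shows "(\<integral>z. g z * of_real (exp (- (norm z)\<^sup>2)) \<partial>dV) = g 0"
proof -
  have [measurable]: "g \<in> borel_measurable borel"
    by (intro borel_measurable_continuous_onI entire_fun_continuous g)
  let ?\<phi> = "\<lambda>t::real. exp (- t)"
  have int1: "integrable dV (\<lambda>z :: complex ^ 'n. 1 * complex_of_real (exp (- (norm z)\<^sup>2)))"
    using integrable_dV_exp_norm[of 0, where 'n='n] by simp
  have one: "normal_expansion (\<lambda>z :: complex ^ 'n. 1) (\<lambda>l z. if l = 0 then 1 else 0)"
    by (rule normal_expansion_single) (use homogeneous_poly_herm_power[of 0 1 0] in simp)
  have "(\<integral>z. g z * of_real (cutoff N ?\<phi> ((norm z)\<^sup>2)) \<partial>dV)
      = g 0 * (\<integral>z. 1 * of_real (cutoff N ?\<phi> ((norm (z :: complex ^ 'n))\<^sup>2)) \<partial>dV)" for N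
  proof -
    have "(\<lambda>k. \<integral>z. hcomp g k z * cnj (if k = 0 then 1 else 0) * of_real (cutoff N ?\<phi> ((norm z)\<^sup>2)) \<partial>dV)
      sums (\<integral>z. g z * cnj 1 * of_real (cutoff N ?\<phi> ((norm z)\<^sup>2)) \<partial>dV)"
      by (rule pairing_cutoff_sums[OF normal_expansion_entire[OF g] one]) (auto intro: continuous_on_exp_neg)
    moreover have "(\<lambda>k. \<integral>z. hcomp g k z * cnj (if k = 0 then 1 else 0) * of_real (cutoff N ?\<phi> ((norm z)\<^sup>2)) \<partial>dV)
      sums (\<Sum>k\<in>{0}. \<integral>z. hcomp g k z * cnj (if k = 0 then 1 else 0) * of_real (cutoff N ?\<phi> ((norm z)\<^sup>2)) \<partial>dV)"
      by (rule sums_finite) auto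
    ultimately show ?thesis
      by (auto dest: sums_unique2 simp: hcomp_entire[OF g] taylor_comp_def)
  qed
  moreover have "(\<lambda>N. \<integral>z. g z * of_real (cutoff N ?\<phi> ((norm z)\<^sup>2)) \<partial>dV)
      \<longlonglongrightarrow> (\<integral>z. g z * of_real (exp (- (norm z)\<^sup>2)) \<partial>dV)"
    using int by (intro integral_cutoff_tendsto) auto
  moreover have "(\<lambda>N. g 0 * (\<integral>z. 1 * of_real (cutoff N ?\<phi> ((norm (z :: complex ^ 'n))\<^sup>2)) \<partial>dV))
      \<longlonglongrightarrow> g 0 * (\<integral>z. 1 * of_real (exp (- (norm (z :: complex ^ 'n))\<^sup>2)) \<partial>dV)"
    using int1 by (intro tendsto_mult_left integral_cutoff_tendsto) auto
  moreover have "(\<integral>z. 1 * complex_of_real (exp (- (norm (z :: complex ^ 'n))\<^sup>2)) \<partial>dV) = 1"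
    using dV_eq_density[where 'n='n] by (metis (no_types, lifting) Bochner_Integration.integral_cong integral_complex_of_real mult_1 of_real_1)
  ultimately show ?thesis
    by (metis (no_types, lifting) LIMSEQ_unique mult.right_neutral ext)
qed

section \<open>Power series of exponential type in the Hermitian product\<close>

lemma power_over_fact_le_exp: "0 \<le> (x::real) \<Longrightarrow> x ^ k / fact k \<le> exp x"
  using sum_le_suminf[OF summable_exp_generic[of x], of "{k}"]
  by (simp add: exp_def divide_inverse mult.commute)

text \<open>The growth \<open>C * 2 ^ k\<close> is a crude substitute for the polynomial growth of
  the Gamma quotients. It keeps the exponential series of 2|t| as a majorant, which yields both
  convergence and exponential type.\<close>

lemma exp_power_series_bound:
  fixes c :: "nat \<Rightarrow> complex"
  assumes "\<And>k. cmod (c k) \<le> C * 2 ^ k" "cmod t \<le> r"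
  shows "cmod (c k * t ^ k / fact k) \<le> C * ((2 * r) ^ k / fact k)"
proof -
  have C: "0 \<le> C" using order_trans[OF norm_ge_zero assms(1)[of 0]] by simp
  have "cmod (c k) * cmod t ^ k \<le> (C * 2 ^ k) * r ^ k"
    using assms C by (intro mult_mono power_mono) auto
  then show ?thesis
    by (simp add: norm_mult norm_divide norm_power power_mult_distrib divide_right_mono mult_ac)
qed

lemma exp_power_series_sums:
  fixes c :: "nat \<Rightarrow> complex"
  assumes "\<And>k. cmod (c k) \<le> C * 2 ^ k"
  shows "(\<lambda>k. c k * t ^ k / fact k) sums (\<Sum>k. c k * t ^ k / fact k)"
    and "cmod (\<Sum>k. c k * t ^ k / fact k) \<le> C * exp (2 * cmod t)"
proof -
  have ex: "(\<lambda>k. C * ((2 * cmod t) ^ k / fact k)) sums (C * exp (2 * cmod t))"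
    using sums_mult[OF exp_converges[of "2 * cmod t"], of C] by (simp add: divide_inverse mult_ac)
  have "summable (\<lambda>k. c k * t ^ k / fact k)"
    using exp_power_series_bound[OF assms order_refl]
    by (intro summable_comparison_test'[OF sums_summable[OF ex], of 0])
  then show 1: "(\<lambda>k. c k * t ^ k / fact k) sums (\<Sum>k. c k * t ^ k / fact k)"
    by (rule summable_sums)
  show "cmod (\<Sum>k. c k * t ^ k / fact k) \<le> C * exp (2 * cmod t)"
    by (rule norm_sums_le[OF 1 ex]) (rule exp_power_series_bound[OF assms order_refl])
qed

lemma exp_power_series_holomorphic:
  fixes c :: "nat \<Rightarrow> complex"
  assumes "\<And>k. cmod (c k) \<le> C * 2 ^ k"
  shows "(\<lambda>t. \<Sum>k. c k * t ^ k / fact k) holomorphic_on UNIV"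
proof -
  have "(\<lambda>t. \<Sum>k. c k * t ^ k / fact k) holomorphic_on ball 0 r" for r
  proof (rule power_series_holomorphic[where a="\<lambda>k. c k / fact k"])
    show "(\<lambda>k. c k / fact k * (w - 0) ^ k) sums (\<Sum>k. c k * w ^ k / fact k)" for w
      using exp_power_series_sums(1)[OF assms, of w] by simp
  qed
  then have "(\<lambda>t. \<Sum>k. c k * t ^ k / fact k) field_differentiable (at x)" for x
    using holomorphic_on_imp_differentiable_at[of _ "ball 0 (cmod x + 1)" x] by auto
  then show ?thesis
    by (simp add: holomorphic_on_def field_differentiable_at_within)
qed

lemma normal_expansion_kernel:
  fixes c :: "nat \<Rightarrow> complex" and w :: "complex ^ 'n"
  assumes c: "\<And>k. cmod (c k) \<le> C * 2 ^ k" and C: "0 < C"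
  shows "normal_expansion (\<lambda>z. \<Sum>k. c k * herm z w ^ k / fact k) (\<lambda>k z. c k * herm z w ^ k / fact k)"
  unfolding normal_expansion_def homogeneous_expansion_def
proof (intro conjI allI)
  show "homogeneous_poly k (\<lambda>z. c k * herm z w ^ k / fact k)" for k
    using homogeneous_poly_herm_power[of k "c k / fact k" w] by simp
  show "(\<lambda>k. c k * herm z w ^ k / fact k) sums (\<Sum>k. c k * herm z w ^ k / fact k)" for z
    by (rule exp_power_series_sums(1)[OF c])
  show "\<exists>M>0. \<forall>k z. norm z \<le> R \<longrightarrow> cmod (c k * herm z w ^ k / fact k) \<le> M * (1/2) ^ k" for R
  \<comment> \<open>In the exponent, one factor 2 stems from the growth of the coefficients, the
    other pays for extracting \<open>(1/2) ^ k\<close>. The absolute value covers negative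
    \<open>R\<close>.\<close>
  proof (intro exI[of _ "C * exp (4 * (\<bar>R\<bar> * norm w))"] conjI allI impI)
    fix k and z :: "complex ^ 'n" assume "norm z \<le> R"
    then have "norm z * norm w \<le> \<bar>R\<bar> * norm w" by (intro mult_right_mono) auto
    then have "cmod (herm z w) \<le> \<bar>R\<bar> * norm w" using norm_herm_le[of z w] by linarith
    from exp_power_series_bound[OF c this, of k]
    have "cmod (c k * herm z w ^ k / fact k) \<le> C * ((2 * (\<bar>R\<bar> * norm w)) ^ k / fact k)" .
    also have "\<dots> = C * ((4 * (\<bar>R\<bar> * norm w)) ^ k / fact k) * (1/2) ^ k"
    proof -
      have "(4 * (\<bar>R\<bar> * norm w)) ^ k * (1/2) ^ k = (2 * (\<bar>R\<bar> * norm w)) ^ k"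
        unfolding power_mult_distrib[symmetric] by simp
      then show ?thesis by (metis (no_types, lifting) mult.assoc times_divide_eq_left)
    qed
    also have "\<dots> \<le> C * exp (4 * (\<bar>R\<bar> * norm w)) * (1/2) ^ k"
      using C by (intro mult_right_mono mult_left_mono power_over_fact_le_exp) auto
    finally show "cmod (c k * herm z w ^ k / fact k) \<le> C * exp (4 * (\<bar>R\<bar> * norm w)) * (1/2) ^ k" .
  qed (use C in simp)
qed

lemma exp_kernel_eq: "exp_kernel w z = (\<Sum>k. 1 * herm z w ^ k / fact k)"
  unfolding exp_kernel_def exp_def
  by (intro suminf_cong) (simp add: scaleR_conv_of_real divide_inverse mult.commute)

lemma normal_expansion_exp_kernel:
  "normal_expansion (exp_kernel w) (\<lambda>k z. herm z w ^ k / fact k)"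
proof -
  have "exp_kernel w = (\<lambda>z. \<Sum>k. 1 * herm z w ^ k / fact k)"
    by (intro ext exp_kernel_eq)
  moreover have "normal_expansion (\<lambda>z. \<Sum>k. 1 * herm z w ^ k / fact k) (\<lambda>k z. 1 * herm z w ^ k / fact k)"
    by (rule normal_expansion_kernel[where C=1]) auto
  ultimately show ?thesis by (simp only: mult_1)
qed

section \<open>Growth of homogeneous polynomials and the Gaussian reproducing formula\<close>

lemma homogeneous_poly_bound:
  assumes "homogeneous_poly k p" "\<And>u. norm u \<le> 1 \<Longrightarrow> cmod (p u) \<le> M"
  shows "cmod (p z) \<le> M * norm z ^ k"
proof (cases "z = 0")
  case True
  have M: "0 \<le> M" using order_trans[OF norm_ge_zero assms(2)[of 0]] by simp
  show ?thesis
  proof (cases "k = 0")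
    case True
    then show ?thesis using assms(2)[of z] \<open>z = 0\<close> by simp
  next
    case False
    then have "p (0 *s z) = 0" using homogeneous_poly_smult[OF assms(1), of 0 z] by simp
    then show ?thesis using \<open>z = 0\<close> M by simp
  qed
next
  case False
  let ?u = "complex_of_real (1 / norm z) *s z"
  have "z = complex_of_real (norm z) *s ?u"
    using False by (simp add: of_real_vec_smult del: of_real_divide)
  then have "p z = complex_of_real (norm z) ^ k * p ?u"
    using homogeneous_poly_smult[OF assms(1)] by metis
  moreover have "cmod (p ?u) \<le> M"
    using False by (intro assms(2)) (simp add: of_real_vec_smult del: of_real_divide)
  ultimately show ?thesis
    using mult_left_mono[of "cmod (p ?u)" M "norm z ^ k"]
    by (simp add: norm_mult norm_power mult.commute del: of_real_divide)
qed

text \<open>The bound is put in exponential form so that products with exponential kernels meet the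
  criterion \<open>integrable_dV_of_growth\<close>.\<close>

lemma homogeneous_poly_growth:
  assumes "homogeneous_poly k p"
  obtains M where "0 < M" "\<And>z. cmod (p z) \<le> M * exp (real k * norm z)"
proof -
  obtain M where M: "0 < M" "\<And>z. norm z \<le> 1 \<Longrightarrow> cmod (p z) \<le> M"
    using entire_fun_bounded_on_ball[OF entire_fun_homogeneous_poly[OF assms]] by blast
  have "cmod (p z) \<le> M * exp (real k * norm z)" for z
  proof -
    have "cmod (p z) \<le> M * norm z ^ k"
      by (rule homogeneous_poly_bound[OF assms M(2)])
    also have "norm z \<le> exp (norm z)"
      using exp_ge_add_one_self[of "norm z"] by linarith
    then have "norm z ^ k \<le> exp (norm z) ^ k" by (intro power_mono) auto
    also have "\<dots> = exp (real k * norm z)" by (simp add: exp_of_nat_mult)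
    finally show ?thesis using M(1) by simp
  qed
  with M(1) show ?thesis by (rule that)
qed

lemma herm_self: "herm v v = of_real ((norm v)\<^sup>2)"
proof -
  have "(norm v)\<^sup>2 = (\<Sum>j\<in>UNIV. (cmod (v $ j))\<^sup>2)"
    by (simp add: norm_vec_def L2_set_def sum_nonneg)
  then show ?thesis
    by (simp add: herm_def complex_norm_square del: of_real_power)
qed

lemma norm_diff_squared: "complex_of_real ((norm (z - w))\<^sup>2)
    = of_real ((norm z)\<^sup>2) - herm z w - herm w z + of_real ((norm w)\<^sup>2)"
  unfolding herm_self[symmetric] by (simp add: herm_def algebra_simps sum.distrib sum_subtractf)

text \<open>
  Translating by \<open>w\<close> turns the integral into the Gaussian mean of the entire function
  \<open>z \<mapsto> p (z + w) exp (- (z, w))\<close>, whose value at the origin is \<open>p w\<close>.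
\<close>

lemma integral_gaussian_reproducing:
  fixes p :: "complex ^ 'n \<Rightarrow> complex"
  assumes p: "homogeneous_poly k p"
  shows "integrable dV (\<lambda>z. p z * cnj (exp_kernel w z) * of_real (exp (- (norm z)\<^sup>2)))"
    and "(\<integral>z. p z * cnj (exp_kernel w z) * of_real (exp (- (norm z)\<^sup>2)) \<partial>dV) = p w"
proof -
  have entp: "entire_fun p" using p by (rule entire_fun_homogeneous_poly)
  obtain M where M: "0 < M" "\<And>z. cmod (p z) \<le> M * exp (real k * norm z)"
    using homogeneous_poly_growth[OF p] by blast
  have [measurable]: "p \<in> borel_measurable borel" "(\<lambda>z. herm z w) \<in> borel_measurable borel"
    by (auto intro!: borel_measurable_continuous_onI entire_fun_continuous entp entire_fun_herm)
  have [measurable]: "exp_kernel w \<in> borel_measurable borel"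
    unfolding exp_kernel_def[abs_def] by measurable
  have kern: "cmod (exp (herm z w)) \<le> exp (norm w * norm z)" "cmod (exp (- herm z w)) \<le> exp (norm w * norm z)" for z
    using norm_herm_le[of z w] abs_Re_le_cmod[of "herm z w"] by (auto simp: mult.commute)
  show "integrable dV (\<lambda>z. p z * cnj (exp_kernel w z) * of_real (exp (- (norm z)\<^sup>2)))"
  proof (rule integrable_dV_of_growth)
    fix z
    have "cmod (p z) * cmod (exp (herm z w)) \<le> (M * exp (real k * norm z)) * exp (norm w * norm z)"
      using M kern by (intro mult_mono) auto
    then have "cmod (p z) * cmod (exp (herm z w)) * exp (- (norm z)\<^sup>2)
        \<le> (M * exp (real k * norm z)) * exp (norm w * norm z) * exp (- (norm z)\<^sup>2)"
      by (rule mult_right_mono) simp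
    also have "\<dots> = M * exp ((real k + norm w) * norm z - (norm z)\<^sup>2)"
      by (simp add: exp_add[symmetric] exp_diff exp_minus field_simps)
    finally show "cmod (p z * cnj (exp_kernel w z) * of_real (exp (- (norm z)\<^sup>2)))
        \<le> M * exp ((real k + norm w) * norm z - (norm z)\<^sup>2)"
      by (simp add: norm_mult exp_kernel_def)
  qed measurable
  define g where "g z = p (z + w) * exp (- herm z w)" for z
  have [measurable]: "g \<in> borel_measurable borel"
    unfolding g_def[abs_def] by measurable
  have "entire_fun g"
    unfolding g_def
    by (intro entire_fun_mult entire_fun_shift[OF entp] entire_fun_compose[OF entire_fun_herm, of "\<lambda>t. exp (- t)"] holomorphic_intros)
  moreover have "integrable dV (\<lambda>z. g z * of_real (exp (- (norm z)\<^sup>2)))"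
  proof (rule integrable_dV_of_growth)
    fix z
    have "cmod (p (z + w)) \<le> M * exp (real k * norm w) * exp (real k * norm z)"
    proof -
      have "cmod (p (z + w)) \<le> M * exp (real k * norm (z + w))" by (rule M(2))
      also have "\<dots> \<le> M * exp (real k * (norm z + norm w))"
        using M(1) norm_triangle_ineq[of z w] by (intro mult_left_mono) (auto intro: mult_left_mono)
      finally show ?thesis by (simp add: exp_add[symmetric] algebra_simps)
    qed
    then have "cmod (p (z + w)) * cmod (exp (- herm z w)) \<le> (M * exp (real k * norm w) * exp (real k * norm z)) * exp (norm w * norm z)"
      using M kern by (intro mult_mono) auto
    then have "cmod (p (z + w)) * cmod (exp (- herm z w)) * exp (- (norm z)\<^sup>2)
        \<le> (M * exp (real k * norm w) * exp (real k * norm z)) * exp (norm w * norm z) * exp (- (norm z)\<^sup>2)"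
      by (rule mult_right_mono) simp
    also have "\<dots> = M * exp (real k * norm w) * exp ((real k + norm w) * norm z - (norm z)\<^sup>2)"
      by (simp add: mult.assoc exp_add[symmetric]) (simp add: algebra_simps)
    finally show "cmod (g z * of_real (exp (- (norm z)\<^sup>2)))
        \<le> M * exp (real k * norm w) * exp ((real k + norm w) * norm z - (norm z)\<^sup>2)"
      by (simp add: norm_mult g_def)
  qed measurable
  ultimately have "(\<integral>z. g z * of_real (exp (- (norm z)\<^sup>2)) \<partial>dV) = g 0"
    by (rule integral_gaussian_mean_value)
  also have "g 0 = p w" by (simp add: g_def herm_def)
  finally have mv: "(\<integral>z. g z * of_real (exp (- (norm z)\<^sup>2)) \<partial>dV) = p w" .
  \<comment> \<open>Expanding |z - w|^2 cancels \<open>herm z w\<close> and |w|^2 against the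
    exponent of \<open>g\<close>. What remains is \<open>herm w z\<close>, the exponent of the
    conjugate kernel, and the Gaussian.\<close>
  have "g (z - w) * of_real (exp (- (norm (z - w))\<^sup>2))
      = p z * cnj (exp_kernel w z) * of_real (exp (- (norm z)\<^sup>2))" for z
  proof -
    have "herm (z - w) w = herm z w - of_real ((norm w)\<^sup>2)"
      unfolding herm_self[symmetric] by (simp add: herm_def algebra_simps sum_subtractf)
    then have "- herm (z - w) w + of_real (- (norm (z - w))\<^sup>2) = herm w z + of_real (- (norm z)\<^sup>2)"
      unfolding of_real_minus norm_diff_squared by simp
    then have "exp (- herm (z - w) w) * of_real (exp (- (norm (z - w))\<^sup>2)) = exp (herm w z) * of_real (exp (- (norm z)\<^sup>2))"
      unfolding exp_of_real[symmetric] exp_add[symmetric] by simp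
    moreover have "cnj (exp_kernel w z) = exp (herm w z)"
      by (simp add: exp_kernel_def exp_cnj cnj_herm)
    ultimately show ?thesis by (simp add: g_def mult.assoc)
  qed
  then have "(\<integral>z. p z * cnj (exp_kernel w z) * of_real (exp (- (norm z)\<^sup>2)) \<partial>dV)
      = (\<integral>z. g (z + (- w)) * of_real (exp (- (norm (z + (- w)))\<^sup>2)) \<partial>dV)"
    by simp
  also have "\<dots> = (\<integral>z. g z * of_real (exp (- (norm z)\<^sup>2)) \<partial>dV)"
    by (rule integral_dV_shift) measurable
  finally show "(\<integral>z. p z * cnj (exp_kernel w z) * of_real (exp (- (norm z)\<^sup>2)) \<partial>dV) = p w"
    using mv by simp
qed

section \<open>The pairing with the kernel\<close>

text \<open>The reproducing formula is available against the whole exponential kernel. On annuli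
  orthogonality reduces it to the term of degree k, and the limit identifies the radial constant
  \<open>D\<close>, which then serves every \<open>\<phi>\<close>.\<close>

lemma has_integral_homogeneous_kernel:
  fixes p :: "complex ^ 'n \<Rightarrow> complex"
  assumes p: "homogeneous_poly k p"
    and [measurable]: "\<phi> \<in> borel_measurable borel" and "\<And>t. 0 \<le> \<phi> t"
    and "has_moment (real CARD('n) + real k) \<phi>"
  shows "has_bochner_integral dV (\<lambda>z. p z * cnj (herm z w ^ k / fact k) * of_real (\<phi> ((norm z)\<^sup>2)))
    (p w * of_real (moment (real CARD('n) + real k) \<phi> / Gamma (real CARD('n) + real k)))"
proof -
  let ?b = "real CARD('n) + real k"
  have b: "0 < ?b" by (simp add: add_pos_nonneg)
  define H where "H z = p z * cnj (herm z w ^ k / fact k)" for z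
  have "continuous_on UNIV H"
    unfolding H_def
    by (intro continuous_intros entire_fun_continuous entire_fun_homogeneous_poly[OF p] entire_fun_herm) auto
  then have [measurable]: "H \<in> borel_measurable borel"
    by (rule borel_measurable_continuous_onI)
  have hom: "H (t *\<^sub>R z) = of_real (t ^ (2 * k)) * H z" for t z
    unfolding H_def of_real_vec_smult[symmetric] homogeneous_poly_smult[OF p]
    by (simp add: herm_smult_left power_mult_distrib mult_2 power_add)
  obtain D where D: "\<And>\<phi>. \<phi> \<in> borel_measurable borel \<Longrightarrow> (\<And>t. 0 \<le> \<phi> t) \<Longrightarrow> has_moment ?b \<phi> \<Longrightarrow>
    has_bochner_integral dV (\<lambda>z. H z * of_real (\<phi> ((norm z)\<^sup>2))) (D * of_real (moment ?b \<phi>))"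
    using has_integral_dV_radial[OF \<open>continuous_on UNIV H\<close> hom] by blast
  let ?\<phi> = "\<lambda>t::real. exp (- t)"
  have De: "has_bochner_integral dV (\<lambda>z. H z * of_real (exp (- (norm z)\<^sup>2))) (D * of_real (Gamma ?b))"
    using D[of ?\<phi>] has_moment_exp[OF b] moment_exp[OF b] by simp
  have [measurable]: "p \<in> borel_measurable borel"
    using p by (rule borel_measurable_homogeneous_poly)
  have [measurable]: "exp_kernel w \<in> borel_measurable borel"
    using normal_expansion_exp_kernel by (rule borel_measurable_normal_expansion)
  have "(\<integral>z. p z * cnj (exp_kernel w z) * of_real (cutoff N ?\<phi> ((norm z)\<^sup>2)) \<partial>dV)
      = (\<integral>z. H z * of_real (cutoff N ?\<phi> ((norm z)\<^sup>2)) \<partial>dV)" for N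
  proof -
    let ?t = "\<lambda>l. \<integral>z. (if l = k then p z else 0) * cnj (herm z w ^ l / fact l) * of_real (cutoff N ?\<phi> ((norm z)\<^sup>2)) \<partial>dV"
    have "?t sums (\<integral>z. p z * cnj (exp_kernel w z) * of_real (cutoff N ?\<phi> ((norm z)\<^sup>2)) \<partial>dV)"
      by (rule pairing_cutoff_sums[OF normal_expansion_single[OF p] normal_expansion_exp_kernel])
         (auto intro: continuous_on_exp_neg)
    moreover have "?t sums (\<Sum>l\<in>{k}. ?t l)"
      by (rule sums_finite) auto
    ultimately show ?thesis
      unfolding H_def by (auto dest: sums_unique2)
  qed
  moreover have "(\<lambda>N. \<integral>z. p z * cnj (exp_kernel w z) * of_real (cutoff N ?\<phi> ((norm z)\<^sup>2)) \<partial>dV) \<longlonglongrightarrow> p w"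
    using integral_cutoff_tendsto[of "\<lambda>z. p z * cnj (exp_kernel w z)" ?\<phi>] integral_gaussian_reproducing[OF p, of w]
    by simp
  moreover have "(\<lambda>N. \<integral>z. H z * of_real (cutoff N ?\<phi> ((norm z)\<^sup>2)) \<partial>dV) \<longlonglongrightarrow> D * of_real (Gamma ?b)"
    using integral_cutoff_tendsto[of H ?\<phi>] De by (auto simp: has_bochner_integral_iff)
  ultimately have "p w = D * of_real (Gamma ?b)"
    by (metis (no_types, lifting) LIMSEQ_unique ext)
  moreover have "Gamma ?b \<noteq> 0" using Gamma_real_pos[OF b] by simp
  ultimately have "D = p w / of_real (Gamma ?b)" by simp
  with D[of \<phi>] assms show ?thesis by (simp add: H_def)
qed

text \<open>The weight of \<open>pairing\<close> in the variable t = |z|^2, which halves the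
  exponent. Both forms vanish at the origin because \<open>0 powr a = 0\<close>, so they agree there
  too.\<close>

definition fock_weight :: "real \<Rightarrow> real \<Rightarrow> real" where
  "fock_weight \<alpha> t = exp (- t) * t powr (- (\<alpha> / 2))"

lemma fock_weight_measurable [measurable]: "fock_weight \<alpha> \<in> borel_measurable borel"
  unfolding fock_weight_def[abs_def] by measurable

lemma fock_weight_nonneg: "0 \<le> fock_weight \<alpha> t"
  by (simp add: fock_weight_def)

lemma continuous_on_fock_weight: "continuous_on {0<..} (fock_weight \<alpha>)"
  unfolding fock_weight_def[abs_def] by (intro continuous_intros) auto

lemma fock_weight_norm: "fock_weight \<alpha> ((norm z)\<^sup>2) = exp (- (norm z)\<^sup>2) * norm z powr (- \<alpha>)"
proof -
  have "(norm z)\<^sup>2 powr (- (\<alpha> / 2)) = norm z powr (- \<alpha>)"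
    using powr_powr[of "norm z" 2 "- (\<alpha> / 2)"] by (cases "z = 0") (auto simp: powr_numeral)
  then show ?thesis by (simp add: fock_weight_def)
qed

text \<open>The power in the weight merely shifts the index of the moment by \<alpha>/2. This is the
  origin of the denominators in the kernel coefficients.\<close>

lemma moment_fock_weight_integrand:
  "t powr (b - 1) * indicator {0<..} t * fock_weight \<alpha> t
    = t powr (b - \<alpha> / 2 - 1) * indicator {0<..} t * exp (- t)"
  by (cases "0 < t") (auto simp: fock_weight_def powr_add[symmetric] algebra_simps)

lemma has_moment_fock_weight: "0 < b - \<alpha> / 2 \<Longrightarrow> has_moment b (fock_weight \<alpha>)"
  using has_moment_exp[of "b - \<alpha> / 2"] by (simp add: moment_fock_weight_integrand)

lemma moment_fock_weight: "0 < b - \<alpha> / 2 \<Longrightarrow> moment b (fock_weight \<alpha>) = Gamma (b - \<alpha> / 2)"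
  using moment_exp[of "b - \<alpha> / 2"] by (simp add: moment_fock_weight_integrand)

lemma pairing_fock_weight:
  "pairing \<alpha> F G = (\<integral>z. F z * cnj (G z) * of_real (fock_weight \<alpha> ((norm z)\<^sup>2)) \<partial>dV)"
  by (simp add: pairing_def fock_weight_norm)

text \<open>The alternative in \<open>coeff\<close> lets one statement serve whole functions, low
  parts and high parts: degrees removed from \<open>F\<close> contribute zero, and in the others the
  Gamma quotient in \<open>q\<close> is exactly what turns the term into \<open>p k w\<close> in the
  limit.\<close>

lemma pairing_kernel:
  fixes F G :: "complex ^ 'n \<Rightarrow> complex"
  assumes F: "normal_expansion F p" and G: "normal_expansion G q"
    and coeff: "\<And>k. p k = (\<lambda>_. 0) \<or> 0 < real CARD('n) + real k - \<alpha> / 2 \<and>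
      q k = (\<lambda>z. of_real (Gamma (real CARD('n) + real k) / Gamma (real CARD('n) + real k - \<alpha> / 2)) * (herm z w ^ k / fact k))"
    and int: "integrable dV (\<lambda>z. F z * cnj (G z) * of_real (fock_weight \<alpha> ((norm z)\<^sup>2)))"
  shows "pairing \<alpha> F G = F w"
proof -
  \<comment> \<open>The fraction of the full moment retained by the cutoff.\<close>
  define \<theta> where "\<theta> k N = moment (real CARD('n) + real k) (cutoff N (fock_weight \<alpha>)) / Gamma (real CARD('n) + real k - \<alpha> / 2)"
    for k N
  have [measurable]: "F \<in> borel_measurable borel" "G \<in> borel_measurable borel"
    using F G by (auto intro: borel_measurable_normal_expansion)
  have \<theta>: "\<theta> k N \<in> {0..1}" "(\<lambda>N. \<theta> k N) \<longlonglongrightarrow> 1" if k: "0 < real CARD('n) + real k - \<alpha> / 2" for k N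
  proof -
    have G: "0 < Gamma (real CARD('n) + real k - \<alpha> / 2)" using k by (rule Gamma_real_pos)
    show "\<theta> k N \<in> {0..1}"
      using moment_cutoff_le[OF fock_weight_nonneg has_moment_fock_weight[OF k] continuous_on_fock_weight, of N] G
      by (simp add: \<theta>_def moment_fock_weight[OF k])
    have "(\<lambda>N. \<theta> k N) \<longlonglongrightarrow> moment (real CARD('n) + real k) (fock_weight \<alpha>) / Gamma (real CARD('n) + real k - \<alpha> / 2)"
      unfolding \<theta>_def using G
      by (intro tendsto_divide tendsto_const moment_cutoff_tendsto fock_weight_nonneg has_moment_fock_weight k) auto
    then show "(\<lambda>N. \<theta> k N) \<longlonglongrightarrow> 1"
      using G by (simp add: moment_fock_weight[OF k])
  qed
  have term_eq: "(\<integral>z. p k z * cnj (q k z) * of_real (cutoff N (fock_weight \<alpha>) ((norm z)\<^sup>2)) \<partial>dV) = p k w * of_real (\<theta> k N)" for k N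
  proof (cases "p k = (\<lambda>_. 0)")
    case False
    with coeff[of k] have k: "0 < real CARD('n) + real k - \<alpha> / 2" and
      q: "q k = (\<lambda>z. of_real (Gamma (real CARD('n) + real k) / Gamma (real CARD('n) + real k - \<alpha> / 2)) * (herm z w ^ k / fact k))"
      by auto
    let ?g = "complex_of_real (Gamma (real CARD('n) + real k) / Gamma (real CARD('n) + real k - \<alpha> / 2))"
    let ?h = "\<lambda>z. p k z * cnj (herm z w ^ k / fact k) * of_real (cutoff N (fock_weight \<alpha>) ((norm z)\<^sup>2))"
    have "has_bochner_integral dV ?h
      (p k w * of_real (moment (real CARD('n) + real k) (cutoff N (fock_weight \<alpha>)) / Gamma (real CARD('n) + real k)))"
      by (intro has_integral_homogeneous_kernel normal_expansion_homogeneous[OF F] cutoff_nonneg fock_weight_nonneg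
          has_moment_cutoff continuous_on_fock_weight) measurable
    then have "(\<integral>z. ?g * ?h z \<partial>dV)
      = ?g * (p k w * of_real (moment (real CARD('n) + real k) (cutoff N (fock_weight \<alpha>)) / Gamma (real CARD('n) + real k)))"
      by (intro has_bochner_integral_integral_eq has_bochner_integral_mult_right)
    also have "\<dots> = p k w * of_real (\<theta> k N)"
    proof -
      have "Gamma (real CARD('n) + real k) \<noteq> 0"
        by (rule less_imp_neq[OF Gamma_real_pos, symmetric]) (simp add: add_pos_nonneg)
      then show ?thesis by (simp add: \<theta>_def)
    qed
    also have "(\<lambda>z. ?g * ?h z) = (\<lambda>z. p k z * cnj (q k z) * of_real (cutoff N (fock_weight \<alpha>) ((norm z)\<^sup>2)))"
      by (simp add: q mult_ac)
    finally show ?thesis .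
  qed simp
  have sums: "(\<lambda>k. p k w * of_real (\<theta> k N)) sums
      (\<integral>z. F z * cnj (G z) * of_real (cutoff N (fock_weight \<alpha>) ((norm z)\<^sup>2)) \<partial>dV)" for N
    using pairing_cutoff_sums[OF F G, of "fock_weight \<alpha>" N]
    by (simp add: term_eq fock_weight_nonneg continuous_on_fock_weight)
  have le: "cmod (p k w * of_real (\<theta> k N)) \<le> cmod (p k w)" for k N
  proof (cases "p k = (\<lambda>_. 0)")
    case False
    then have "\<theta> k N \<in> {0..1}" using coeff[of k] by (intro \<theta>(1)) auto
    then show ?thesis by (simp add: norm_mult mult_left_le)
  qed simp
  have "summable (\<lambda>k. cmod (p k w))"
  proof -
    obtain M where M: "0 < M" "\<And>k z. norm z \<le> norm w \<Longrightarrow> cmod (p k z) \<le> M * (1/2) ^ k"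
      using normal_expansion_bound[OF F] by metis
    show ?thesis
    proof (rule summable_comparison_test'[of _ 0])
      show "summable (\<lambda>k. M * (1/2) ^ k)" by (intro summable_mult summable_geometric) simp
      show "norm (cmod (p k w)) \<le> M * (1/2) ^ k" for k
        unfolding real_norm_def abs_norm_cancel by (rule M(2)) simp
    qed
  qed
  then have "(\<lambda>N. \<Sum>k. p k w * of_real (\<theta> k N)) \<longlonglongrightarrow> (\<Sum>k. p k w)"
  proof (intro tannerys_theorem[THEN conjunct2, THEN conjunct2])
    show "(\<lambda>N. p k w * of_real (\<theta> k N)) \<longlonglongrightarrow> p k w" for k
    proof (cases "p k = (\<lambda>_. 0)")
      case False
      then have "(\<lambda>N. \<theta> k N) \<longlonglongrightarrow> 1" using coeff[of k] by (intro \<theta>(2)) auto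
      then have "(\<lambda>N. p k w * of_real (\<theta> k N)) \<longlonglongrightarrow> p k w * of_real 1"
        by (intro tendsto_intros)
      then show ?thesis by simp
    qed simp
    show "\<forall>\<^sub>F (k, N) in sequentially \<times>\<^sub>F sequentially. cmod (p k w * of_real (\<theta> k N)) \<le> cmod (p k w)"
      using le by (intro always_eventually) auto
  qed auto
  then have "(\<lambda>N. \<integral>z. F z * cnj (G z) * of_real (cutoff N (fock_weight \<alpha>) ((norm z)\<^sup>2)) \<partial>dV) \<longlonglongrightarrow> F w"
    using sums normal_expansion_sums[OF F, of w] by (simp add: sums_iff)
  moreover have "(\<lambda>N. \<integral>z. F z * cnj (G z) * of_real (cutoff N (fock_weight \<alpha>) ((norm z)\<^sup>2)) \<partial>dV) \<longlonglongrightarrow> pairing \<alpha> F G"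
    unfolding pairing_fock_weight by (intro integral_cutoff_tendsto int fock_weight_nonneg) measurable
  ultimately show ?thesis by (rule LIMSEQ_unique[rotated])
qed

section \<open>Square integrability and convergence of the pairings\<close>

definition fock_density :: "real \<Rightarrow> complex ^ 'n \<Rightarrow> real" where
  "fock_density \<alpha> z = exp (- (norm z)\<^sup>2) * (1 + norm z) powr (- \<alpha>)"

lemma fock_density_measurable [measurable]: "fock_density \<alpha> \<in> borel_measurable borel"
  unfolding fock_density_def[abs_def] by measurable

text \<open>The integrability half of membership in the Fock space, with measurability in place of
  holomorphy, so that it applies directly to low and high parts.\<close>

definition square_integrable :: "real \<Rightarrow> (complex ^ 'n \<Rightarrow> complex) \<Rightarrow> bool" where
  "square_integrable \<alpha> f \<longleftrightarrow> f \<in> borel_measurable borel \<and>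
     integrable dV (\<lambda>z. (cmod (f z))\<^sup>2 * fock_density \<alpha> z)"

lemma fock_space_iff: "f \<in> fock_space \<alpha> \<longleftrightarrow> entire_fun f \<and> square_integrable \<alpha> f"
  unfolding fock_space_def square_integrable_def fock_density_def
  by (auto simp: mult.assoc intro: borel_measurable_continuous_onI entire_fun_continuous)

lemma square_integrable_diff:
  assumes "square_integrable \<alpha> f" "square_integrable \<alpha> g"
  shows "square_integrable \<alpha> (\<lambda>z. f z - g z)"
proof -
  have [measurable]: "f \<in> borel_measurable borel" "g \<in> borel_measurable borel"
    using assms by (auto simp: square_integrable_def)
  have "integrable dV (\<lambda>z. (cmod (f z - g z))\<^sup>2 * fock_density \<alpha> z)"
  proof (rule Bochner_Integration.integrable_bound)
    show "integrable dV (\<lambda>z. 2 * ((cmod (f z))\<^sup>2 * fock_density \<alpha> z) + 2 * ((cmod (g z))\<^sup>2 * fock_density \<alpha> z))"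
      using assms by (auto simp: square_integrable_def)
    have "(cmod (f z - g z))\<^sup>2 \<le> 2 * (cmod (f z))\<^sup>2 + 2 * (cmod (g z))\<^sup>2" for z
    proof -
      have "(cmod (f z - g z))\<^sup>2 \<le> (cmod (f z) + cmod (g z))\<^sup>2"
        by (intro power_mono norm_triangle_ineq4) simp
      also have "\<dots> \<le> 2 * (cmod (f z))\<^sup>2 + 2 * (cmod (g z))\<^sup>2"
        using zero_le_power2[of "cmod (f z) - cmod (g z)"] by (simp add: power2_eq_square algebra_simps)
      finally show ?thesis .
    qed
    then have "(cmod (f z - g z))\<^sup>2 * fock_density \<alpha> z
        \<le> 2 * ((cmod (f z))\<^sup>2 * fock_density \<alpha> z) + 2 * ((cmod (g z))\<^sup>2 * fock_density \<alpha> z)" for z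
      using mult_right_mono[of "(cmod (f z - g z))\<^sup>2" _ "fock_density \<alpha> z"]
      by (fastforce simp: fock_density_def algebra_simps)
    then show "AE z in dV. norm ((cmod (f z - g z))\<^sup>2 * fock_density \<alpha> z)
        \<le> norm (2 * ((cmod (f z))\<^sup>2 * fock_density \<alpha> z) + 2 * ((cmod (g z))\<^sup>2 * fock_density \<alpha> z))"
      by (intro AE_I2) (simp add: fock_density_def)
  qed measurable
  then show ?thesis by (simp add: square_integrable_def)
qed

lemma square_integrable_of_growth:
  fixes f :: "complex ^ 'n \<Rightarrow> complex"
  assumes [measurable]: "f \<in> borel_measurable borel" and growth: "\<And>z. cmod (f z) \<le> C * exp (c * norm z)"
  shows "square_integrable \<alpha> f"
proof -
  have "integrable dV (\<lambda>z. (cmod (f z))\<^sup>2 * fock_density \<alpha> z)"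
  proof (rule integrable_dV_of_growth)
    fix z :: "complex ^ 'n"
    have "(cmod (f z))\<^sup>2 \<le> (C * exp (c * norm z))\<^sup>2"
      using growth by (intro power_mono) auto
    also have "\<dots> = C\<^sup>2 * exp (2 * c * norm z)"
      by (simp add: power_mult_distrib exp_double[symmetric] mult.assoc)
    finally have 1: "(cmod (f z))\<^sup>2 \<le> C\<^sup>2 * exp (2 * c * norm z)" .
    have "(1 + norm z) powr (- \<alpha>) \<le> (1 + norm z) powr \<bar>\<alpha>\<bar>"
      by (intro powr_mono) auto
    also have "\<dots> \<le> exp (norm z) powr \<bar>\<alpha>\<bar>"
      by (intro powr_mono2 exp_ge_add_one_self) auto
    also have "\<dots> = exp (\<bar>\<alpha>\<bar> * norm z)" by (simp add: powr_def)
    finally have "(cmod (f z))\<^sup>2 * (exp (- (norm z)\<^sup>2) * (1 + norm z) powr (- \<alpha>))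
        \<le> (C\<^sup>2 * exp (2 * c * norm z)) * (exp (- (norm z)\<^sup>2) * exp (\<bar>\<alpha>\<bar> * norm z))"
      using 1 by (intro mult_mono) auto
    also have "\<dots> = C\<^sup>2 * exp ((2 * c + \<bar>\<alpha>\<bar>) * norm z - (norm z)\<^sup>2)"
      by (simp add: mult.assoc exp_add[symmetric] algebra_simps)
    finally show "norm ((cmod (f z))\<^sup>2 * fock_density \<alpha> z) \<le> C\<^sup>2 * exp ((2 * c + \<bar>\<alpha>\<bar>) * norm z - (norm z)\<^sup>2)"
      by (simp add: fock_density_def)
  qed measurable
  then show ?thesis by (simp add: square_integrable_def)
qed

lemma square_integrable_homogeneous_sum:
  assumes "\<And>k. homogeneous_poly k (p k)" "finite A"
  shows "square_integrable \<alpha> (\<lambda>z. \<Sum>k\<in>A. p k z)"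
proof -
  have "\<exists>M. \<forall>z. cmod (p k z) \<le> M * exp (real k * norm z)" for k
    using homogeneous_poly_growth[OF assms(1)] by metis
  then obtain M where M: "\<And>k z. cmod (p k z) \<le> M k * exp (real k * norm z)" by metis
  show ?thesis
  proof (rule square_integrable_of_growth)
    show "(\<lambda>z. \<Sum>k\<in>A. p k z) \<in> borel_measurable borel"
      using assms(1) borel_measurable_homogeneous_poly by (intro borel_measurable_sum) blast
    \<comment> \<open>The sum of all degrees in \<open>A\<close> is a common exponent dominating
      each single degree.\<close>
    show "cmod (\<Sum>k\<in>A. p k z) \<le> (\<Sum>k\<in>A. \<bar>M k\<bar>) * exp (real (\<Sum>A) * norm z)" for z
      unfolding sum_distrib_right
    proof (rule sum_norm_le)
      fix k assume "k \<in> A"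
      have "cmod (p k z) \<le> \<bar>M k\<bar> * exp (real k * norm z)"
        using M[of k z] by (rule order_trans) (intro mult_right_mono, auto)
      also have "\<dots> \<le> \<bar>M k\<bar> * exp (real (\<Sum>A) * norm z)"
        using member_le_sum[OF \<open>k \<in> A\<close>, of "\<lambda>k. k"] \<open>finite A\<close>
        by (intro mult_left_mono) (auto intro!: mult_right_mono simp del: of_nat_sum)
      finally show "cmod (p k z) \<le> \<bar>M k\<bar> * exp (real (\<Sum>A) * norm z)" .
    qed
  qed
qed

text \<open>In the unit ball each surviving component gains the factor |z|^m, because its degree is
  at least m, while the geometric bound at radius 1 sums the constants.\<close>

lemma normal_expansion_vanishing_order:
  assumes F: "normal_expansion F p" and van: "\<And>k. k < m \<Longrightarrow> p k = (\<lambda>_. 0)"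
  obtains C where "0 \<le> C" "\<And>z. norm z \<le> 1 \<Longrightarrow> cmod (F z) \<le> C * norm z ^ m"
proof -
  obtain M where M: "0 < M" "\<And>k z. norm z \<le> 1 \<Longrightarrow> cmod (p k z) \<le> M * (1/2) ^ k"
    using normal_expansion_bound[OF F] by metis
  have "cmod (F z) \<le> M * norm z ^ m * 2" if z: "norm z \<le> 1" for z
  proof (rule norm_sums_le)
    show "(\<lambda>k. p k z) sums F z" using F by (rule normal_expansion_sums)
    show "(\<lambda>k. M * norm z ^ m * (1/2) ^ k) sums (M * norm z ^ m * 2)"
      using sums_mult[OF geometric_sums[of "1/2 :: real"], of "M * norm z ^ m"] by simp
    fix k
    show "cmod (p k z) \<le> M * norm z ^ m * (1/2) ^ k"
    proof (cases "k < m")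
      case True
      then show ?thesis using van M(1) by simp
    next
      case False
      have "cmod (p k z) \<le> M * (1/2) ^ k * norm z ^ k"
        by (rule homogeneous_poly_bound[OF normal_expansion_homogeneous[OF F] M(2)])
      also have "\<dots> \<le> M * (1/2) ^ k * norm z ^ m"
        using False z M(1) by (intro mult_left_mono power_decreasing) auto
      finally show ?thesis by (simp only: mult_ac)
    qed
  qed
  then show ?thesis using M(1) by (intro that[of "M * 2"]) (auto simp: mult_ac)
qed

text \<open>In the unit ball the two vanishing orders change the parameter of the weight from
  \<alpha> to \<alpha> - 2m, whose moment of index n is finite by \<open>m\<close>. Outside, |z| and
  1 + |z| are comparable, and the product of moduli is at most the sum of their squares.\<close>

lemma integrable_pairing:
  fixes F G :: "complex ^ 'n \<Rightarrow> complex"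
  assumes F: "square_integrable \<alpha> F" and G: "square_integrable \<alpha> G"
    and C: "0 \<le> C" "\<And>z. norm z \<le> 1 \<Longrightarrow> cmod (F z) \<le> C * norm z ^ m"
    and C': "0 \<le> C'" "\<And>z. norm z \<le> 1 \<Longrightarrow> cmod (G z) \<le> C' * norm z ^ m"
    and m: "0 < real CARD('n) + real m - \<alpha> / 2"
  shows "integrable dV (\<lambda>z. F z * cnj (G z) * of_real (fock_weight \<alpha> ((norm z)\<^sup>2)))"
proof (rule Bochner_Integration.integrable_bound)
  have [measurable]: "F \<in> borel_measurable borel" "G \<in> borel_measurable borel"
    using F G by (auto simp: square_integrable_def)
  show "(\<lambda>z. F z * cnj (G z) * of_real (fock_weight \<alpha> ((norm z)\<^sup>2))) \<in> borel_measurable dV"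
    by measurable
  let ?\<beta> = "\<alpha> - 2 * real m"
  let ?B = "\<lambda>z. C * C' * fock_weight ?\<beta> ((norm z)\<^sup>2)
      + 2 powr \<bar>\<alpha>\<bar> * ((cmod (F z))\<^sup>2 * fock_density \<alpha> z + (cmod (G z))\<^sup>2 * fock_density \<alpha> z)"
  have "has_moment (real CARD('n)) (fock_weight ?\<beta>)"
    using m by (intro has_moment_fock_weight) (simp add: field_simps)
  then have "integrable dV (\<lambda>z :: complex ^ 'n. fock_weight ?\<beta> ((norm z)\<^sup>2))"
    by (intro integrable_dV_radial fock_weight_nonneg) measurable
  then show "integrable dV ?B"
    using F G by (auto simp: square_integrable_def)
  have dens: "0 \<le> fock_density \<alpha> z" for z :: "complex ^ 'n" by (simp add: fock_density_def)
  show "AE z in dV. norm (F z * cnj (G z) * of_real (fock_weight \<alpha> ((norm z)\<^sup>2))) \<le> norm (?B z)"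
  proof (rule AE_I2)
    fix z :: "complex ^ 'n"
    let ?S = "(cmod (F z))\<^sup>2 * fock_density \<alpha> z + (cmod (G z))\<^sup>2 * fock_density \<alpha> z"
    have S: "0 \<le> ?S" using dens by simp
    have P: "0 \<le> C * C' * fock_weight ?\<beta> ((norm z)\<^sup>2)"
      using C C' fock_weight_nonneg by simp
    have "cmod (F z) * cmod (G z) * fock_weight \<alpha> ((norm z)\<^sup>2) \<le> ?B z"
    proof (cases "norm z \<le> 1")
      case True
      have "cmod (F z) * cmod (G z) * fock_weight \<alpha> ((norm z)\<^sup>2)
          \<le> (C * norm z ^ m) * (C' * norm z ^ m) * fock_weight \<alpha> ((norm z)\<^sup>2)"
        using C C' True fock_weight_nonneg by (intro mult_right_mono mult_mono) auto
      also have "\<dots> = C * C' * fock_weight ?\<beta> ((norm z)\<^sup>2)"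
      proof (cases "z = 0")
        case False
        have "norm z ^ m * norm z ^ m * norm z powr (- \<alpha>) = norm z powr (- ?\<beta>)"
          using False by (simp add: powr_realpow[symmetric] powr_add[symmetric])
        then show ?thesis by (simp add: fock_weight_norm)
      qed (simp add: fock_weight_def)
      finally show ?thesis
        using mult_nonneg_nonneg[OF powr_ge_zero S, of 2 "\<bar>\<alpha>\<bar>"] by linarith
    next
      case False
      then have r: "1 < norm z" by simp
      \<comment> \<open>For |z| > 1 one has 1 + |z| \<le> 2|z|, which gives the constant when
        \<alpha> \<ge> 0. For negative \<alpha> the inequality holds by monotonicity, with room to
        spare.\<close>
      have "norm z powr (- \<alpha>) \<le> 2 powr \<bar>\<alpha>\<bar> * (1 + norm z) powr (- \<alpha>)"
      proof (cases "0 \<le> \<alpha>")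
        case True
        have "(1 + norm z) powr \<alpha> \<le> (2 * norm z) powr \<alpha>"
          using r True by (intro powr_mono2) auto
        then have "(1 + norm z) powr \<alpha> \<le> 2 powr \<alpha> * norm z powr \<alpha>"
          using r by (simp add: powr_mult)
        moreover have "0 < norm z powr \<alpha>" "z \<noteq> 0" using r by auto
        ultimately show ?thesis
          using True r by (simp add: powr_minus field_simps)
      next
        case False
        have "norm z powr (- \<alpha>) \<le> (1 + norm z) powr (- \<alpha>)"
          using r False by (intro powr_mono2) auto
        also have "\<dots> \<le> 2 powr \<bar>\<alpha>\<bar> * (1 + norm z) powr (- \<alpha>)"
          using ge_one_powr_ge_zero[of 2 "\<bar>\<alpha>\<bar>"] by (simp add: mult_le_cancel_right1)
        finally show ?thesis .
      qed
      then have "fock_weight \<alpha> ((norm z)\<^sup>2) \<le> 2 powr \<bar>\<alpha>\<bar> * fock_density \<alpha> z"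
        unfolding fock_weight_norm fock_density_def
        by (metis (no_types, lifting) exp_ge_zero mult.left_commute mult_left_mono)
      moreover have "cmod (F z) * cmod (G z) \<le> (cmod (F z))\<^sup>2 + (cmod (G z))\<^sup>2"
        using sum_squares_bound[of "cmod (F z)" "cmod (G z)"] mult_nonneg_nonneg[OF norm_ge_zero norm_ge_zero, of "F z" "G z"]
        by linarith
      ultimately have "cmod (F z) * cmod (G z) * fock_weight \<alpha> ((norm z)\<^sup>2)
          \<le> ((cmod (F z))\<^sup>2 + (cmod (G z))\<^sup>2) * (2 powr \<bar>\<alpha>\<bar> * fock_density \<alpha> z)"
        using fock_weight_nonneg by (intro mult_mono) auto
      also have "\<dots> = 2 powr \<bar>\<alpha>\<bar> * ?S" by (simp add: algebra_simps)
      finally show ?thesis using P by simp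
    qed
    then show "norm (F z * cnj (G z) * of_real (fock_weight \<alpha> ((norm z)\<^sup>2))) \<le> norm (?B z)"
      using fock_weight_nonneg[of \<alpha>] by (simp add: norm_mult)
  qed
qed

section \<open>The reproducing kernel\<close>

text \<open>One sequence merges the fractional operator with the error term. The value 1 reflects
  the unweighted pairing of low parts when \<alpha> \<ge> 2n. For \<alpha> < 2n all arguments n + k
  - \<alpha>/2 are positive, and the quotient is right in every degree.\<close>

definition kernel_coeff :: "nat \<Rightarrow> real \<Rightarrow> nat \<Rightarrow> real" where
  "kernel_coeff n \<alpha> k = (if 2 * real n \<le> \<alpha> \<and> real k \<le> \<alpha> / 2 then 1
     else Gamma (real n + real k) / Gamma (real n + real k - \<alpha> / 2))"

text \<open>By the functional equation of Gamma, consecutive coefficients have ratio (n + k)/(n + k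
  - \<alpha>/2), at most 2 for large k. Finitely many early coefficients go into
  \<open>C\<close>.\<close>

lemma kernel_coeff_growth:
  assumes "1 \<le> n"
  obtains C where "0 < C" "\<And>k. \<bar>kernel_coeff n \<alpha> k\<bar> \<le> C * 2 ^ k"
proof -
  \<comment> \<open>Beyond 2|\<alpha>| the Gamma arguments are positive, the ratio is at most 2 and
    the exceptional value 1 no longer occurs.\<close>
  define K where "K = nat \<lceil>2 * \<bar>\<alpha>\<bar>\<rceil> + 1"
  have K: "2 * \<bar>\<alpha>\<bar> < real K" unfolding K_def by linarith
  define C where "C = (\<Sum>k\<le>K. \<bar>kernel_coeff n \<alpha> k\<bar>) + 1"
  have small: "\<bar>kernel_coeff n \<alpha> k\<bar> \<le> C * 2 ^ k" if "k \<le> K" for k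
  proof -
    have "\<bar>kernel_coeff n \<alpha> k\<bar> \<le> (\<Sum>k\<le>K. \<bar>kernel_coeff n \<alpha> k\<bar>)"
      using that by (intro member_le_sum) auto
    also have "\<dots> \<le> C" by (simp add: C_def)
    also have "\<dots> \<le> C * 2 ^ k"
      using mult_left_mono[of 1 "2 ^ k" C] sum_nonneg[of "{..K}" "\<lambda>k. \<bar>kernel_coeff n \<alpha> k\<bar>"]
      by (simp add: C_def)
    finally show ?thesis .
  qed
  have step: "\<bar>kernel_coeff n \<alpha> (Suc k)\<bar> \<le> 2 * \<bar>kernel_coeff n \<alpha> k\<bar>" if "K \<le> k" for k
  proof -
    have k: "2 * \<bar>\<alpha>\<bar> < real k" using K that by linarith
    let ?x = "real n + real k" and ?y = "real n + real k - \<alpha> / 2"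
    have y: "0 < ?y" and x: "0 < ?x" and xy: "?x \<le> 2 * ?y" using k assms by (auto simp: abs_if split: if_splits)
    have ax: "kernel_coeff n \<alpha> k = Gamma ?x / Gamma ?y"
      using k by (auto simp: kernel_coeff_def)
    have "kernel_coeff n \<alpha> (Suc k) = Gamma (?x + 1) / Gamma (?y + 1)"
      using k by (auto simp: kernel_coeff_def algebra_simps)
    also have "\<dots> = (?x * Gamma ?x) / (?y * Gamma ?y)"
    proof -
      have "Gamma (u + 1) = u * Gamma u" if "0 < u" for u :: real
        using that nonpos_Ints_nonpos[of u] by (intro Gamma_plus1) auto
      then show ?thesis using x y by simp
    qed
    also have "\<dots> = (?x / ?y) * kernel_coeff n \<alpha> k" by (simp add: ax)
    finally have "\<bar>kernel_coeff n \<alpha> (Suc k)\<bar> = (?x / ?y) * \<bar>kernel_coeff n \<alpha> k\<bar>"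
      using x y by (simp add: abs_mult)
    also have "\<dots> \<le> 2 * \<bar>kernel_coeff n \<alpha> k\<bar>"
      using y xy by (intro mult_right_mono) (auto simp: pos_divide_le_eq)
    finally show ?thesis .
  qed
  have "\<bar>kernel_coeff n \<alpha> k\<bar> \<le> C * 2 ^ k" for k
  proof (induction k)
    case 0
    then show ?case by (rule small) simp
  next
    case (Suc k)
    then show ?case
      using step[of k] small[of "Suc k"] by (cases "K \<le> k") (auto simp: not_le Suc_le_eq)
  qed
  moreover have "0 < C" unfolding C_def by (intro add_nonneg_pos sum_nonneg) auto
  ultimately show ?thesis using that by blast
qed

definition explicit_kernel :: "real \<Rightarrow> complex ^ 'n \<Rightarrow> complex ^ 'n \<Rightarrow> complex" where
  "explicit_kernel \<alpha> w z = (\<Sum>k. of_real (kernel_coeff CARD('n) \<alpha> k) * herm z w ^ k / fact k)"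

lemma kernel_coeff_growth_complex:
  obtains C where "0 < C" "\<And>k. cmod (of_real (kernel_coeff CARD('n::finite) \<alpha> k)) \<le> C * 2 ^ k"
  using kernel_coeff_growth[of "CARD('n)" \<alpha>] by (auto simp: Suc_le_eq)

lemma explicit_kernel_sums:
  fixes w :: "complex ^ 'n"
  shows "(\<lambda>k. of_real (kernel_coeff CARD('n) \<alpha> k) * herm z w ^ k / fact k) sums explicit_kernel \<alpha> w z"
proof -
  obtain C where "\<And>k. cmod (of_real (kernel_coeff CARD('n) \<alpha> k)) \<le> C * 2 ^ k"
    using kernel_coeff_growth_complex[where 'n='n] by metis
  then show ?thesis unfolding explicit_kernel_def by (rule exp_power_series_sums(1))
qed

lemma normal_expansion_explicit_kernel:
  fixes w :: "complex ^ 'n"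
  shows "normal_expansion (explicit_kernel \<alpha> w) (\<lambda>k z. of_real (kernel_coeff CARD('n) \<alpha> k) * herm z w ^ k / fact k)"
proof -
  obtain C where "0 < C" "\<And>k. cmod (of_real (kernel_coeff CARD('n) \<alpha> k)) \<le> C * 2 ^ k"
    using kernel_coeff_growth_complex[where 'n='n] by metis
  then show ?thesis unfolding explicit_kernel_def[abs_def] by (intro normal_expansion_kernel)
qed

lemma explicit_kernel_in_fock_space:
  fixes w :: "complex ^ 'n"
  shows "explicit_kernel \<alpha> w \<in> fock_space \<alpha>"
  unfolding fock_space_iff
proof
  obtain C where C: "0 < C" "\<And>k. cmod (of_real (kernel_coeff CARD('n) \<alpha> k)) \<le> C * 2 ^ k"
    using kernel_coeff_growth_complex[where 'n='n] by metis
  show ent: "entire_fun (explicit_kernel \<alpha> w)"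
    unfolding explicit_kernel_def[abs_def]
    by (rule entire_fun_compose[OF entire_fun_herm exp_power_series_holomorphic[OF C(2)]])
  show "square_integrable \<alpha> (explicit_kernel \<alpha> w)"
  proof (rule square_integrable_of_growth)
    show "explicit_kernel \<alpha> w \<in> borel_measurable borel"
      by (intro borel_measurable_continuous_onI entire_fun_continuous ent)
    show "cmod (explicit_kernel \<alpha> w z) \<le> C * exp (2 * norm w * norm z)" for z
    proof -
      have "cmod (explicit_kernel \<alpha> w z) \<le> C * exp (2 * cmod (herm z w))"
        unfolding explicit_kernel_def by (rule exp_power_series_sums(2)[OF C(2)])
      also have "\<dots> \<le> C * exp (2 * norm w * norm z)"
        using C(1) norm_herm_le[of z w] by (simp add: mult.commute mult.assoc)
      finally show ?thesis .
    qed
  qed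
qed

section \<open>Low and high parts\<close>

lemma finite_low_degrees: "finite {k. real k \<le> s}"
  by (rule finite_subset[of _ "{..nat \<lfloor>s\<rfloor>}"]) (auto intro: le_nat_floor)

text \<open>As a series masked by a set of degrees, the low part falls under
  \<open>normal_expansion_restrict\<close> just like the high part.\<close>

lemma low_part_eq: "low_part s f z = (\<Sum>k. if k \<in> {k. real k \<le> \<bar>s\<bar>} then hcomp f k z else 0)"
  using sums_If_finite_set[OF finite_low_degrees[of "\<bar>s\<bar>"], where f="\<lambda>k. hcomp f k z"]
  by (simp add: low_part_def sums_iff)

lemma high_part_eq: "high_part s f z = (\<Sum>k. if k \<in> {k. \<bar>s\<bar> < real k} then hcomp f k z else 0)"
  by (simp add: high_part_def)

lemma low_plus_high_part:
  assumes "normal_expansion f p"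
  shows "low_part s f z + high_part s f z = f z"
proof -
  have "(\<lambda>k. (if k \<in> {k. real k \<le> \<bar>s\<bar>} then hcomp f k z else 0) + (if k \<in> {k. \<bar>s\<bar> < real k} then hcomp f k z else 0))
    sums (low_part s f z + high_part s f z)"
    unfolding low_part_eq high_part_eq normal_expansion_hcomp[OF assms]
    by (intro sums_add normal_expansion_sums[OF normal_expansion_restrict[OF assms]])
  moreover have "(if k \<in> {k. real k \<le> \<bar>s\<bar>} then hcomp f k z else 0) + (if k \<in> {k. \<bar>s\<bar> < real k} then hcomp f k z else 0)
      = p k z" for k
    by (auto simp: normal_expansion_hcomp[OF assms])
  ultimately show ?thesis
    using normal_expansion_sums[OF assms, of z] sums_unique2 by simp
qed

lemma square_integrable_low_part:
  assumes "normal_expansion f p"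
  shows "square_integrable \<beta> (low_part s f)"
  unfolding low_part_def[abs_def] normal_expansion_hcomp[OF assms]
  by (intro square_integrable_homogeneous_sum normal_expansion_homogeneous[OF assms] finite_low_degrees)

text \<open>The low part is a finite sum of homogeneous polynomials, hence square integrable for
  every parameter, and the high part is the difference.\<close>

lemma square_integrable_high_part:
  assumes "normal_expansion f p" "square_integrable \<beta> f"
  shows "square_integrable \<beta> (high_part s f)"
proof -
  have "high_part s f = (\<lambda>z. f z - low_part s f z)"
    using low_plus_high_part[OF assms(1), of s] by (auto simp: fun_eq_iff algebra_simps)
  then show ?thesis
    using square_integrable_diff[OF assms(2) square_integrable_low_part[OF assms(1)]] by simp
qed

text \<open>For \<alpha> < 2n vanishing order 0 already makes the pairing converge. Otherwise the
  two halves of the inner product reproduce the low and the high part of f separately, and these add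
  up to f.\<close>

lemma explicit_kernel_reproducing:
  fixes f :: "complex ^ 'n \<Rightarrow> complex"
  assumes "f \<in> fock_space \<alpha>"
  shows "fock_inner \<alpha> f (explicit_kernel \<alpha> w) = f w"
proof -
  let ?K = "explicit_kernel \<alpha> w"
  let ?n = "real CARD('n)"
  have n: "1 \<le> ?n" by (simp add: Suc_le_eq)
  define q where "q k z = of_real (kernel_coeff CARD('n) \<alpha> k) * herm z w ^ k / fact k" for k and z :: "complex ^ 'n"
  have f: "normal_expansion f (hcomp f)" "square_integrable \<alpha> f"
    using assms by (auto simp: fock_space_iff intro: normal_expansion_entire)
  have K: "normal_expansion ?K q" "square_integrable \<alpha> ?K"
    using normal_expansion_explicit_kernel explicit_kernel_in_fock_space
    by (auto simp: fock_space_iff q_def[abs_def])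
  have hK: "hcomp ?K = q" using K(1) by (rule normal_expansion_hcomp)
  show ?thesis
  proof (cases "\<alpha> < 2 * ?n")
    case True
    obtain C where C: "0 \<le> C" "\<And>z. norm z \<le> 1 \<Longrightarrow> cmod (f z) \<le> C * norm z ^ 0"
      using normal_expansion_vanishing_order[OF f(1), of 0] by auto
    obtain C' where C': "0 \<le> C'" "\<And>z. norm z \<le> 1 \<Longrightarrow> cmod (?K z) \<le> C' * norm z ^ 0"
      using normal_expansion_vanishing_order[OF K(1), of 0] by auto
    have "pairing \<alpha> f ?K = f w"
    proof (rule pairing_kernel[OF f(1) K(1)])
      show "hcomp f k = (\<lambda>_. 0) \<or> 0 < ?n + real k - \<alpha> / 2 \<and>
          q k = (\<lambda>z. of_real (Gamma (?n + real k) / Gamma (?n + real k - \<alpha> / 2)) * (herm z w ^ k / fact k))" for k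
        using True by (auto simp: q_def[abs_def] kernel_coeff_def)
      show "integrable dV (\<lambda>z. f z * cnj (?K z) * of_real (fock_weight \<alpha> ((norm z)\<^sup>2)))"
        by (rule integrable_pairing[OF f(2) K(2) C C']) (use True in auto)
    qed
    then show ?thesis using True by (simp add: fock_inner_def)
  next
    case False
    define s where "s = \<alpha> / 2"
    have s: "\<bar>s\<bar> = \<alpha> / 2" "\<alpha> / 2 = s" using False n by (auto simp: s_def)
    let ?L = "{k. real k \<le> \<bar>s\<bar>}" and ?H = "{k. \<bar>s\<bar> < real k}"
    have low: "normal_expansion (low_part s g) (\<lambda>k z. if k \<in> ?L then hcomp g k z else 0)"
      and high: "normal_expansion (high_part s g) (\<lambda>k z. if k \<in> ?H then hcomp g k z else 0)"
      if "normal_expansion g (hcomp g)" for g :: "complex ^ 'n \<Rightarrow> complex"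
      using normal_expansion_restrict[OF that, of ?L] normal_expansion_restrict[OF that, of ?H]
      by (simp_all only: low_part_eq[abs_def] high_part_eq[abs_def])
    have K': "normal_expansion ?K (hcomp ?K)" using K(1) hK by simp
    obtain C where C: "0 \<le> C" "\<And>z. norm z \<le> 1 \<Longrightarrow> cmod (low_part s f z) \<le> C * norm z ^ 0"
      using normal_expansion_vanishing_order[OF low[OF f(1)], of 0] by auto
    obtain C' where C': "0 \<le> C'" "\<And>z. norm z \<le> 1 \<Longrightarrow> cmod (low_part s ?K z) \<le> C' * norm z ^ 0"
      using normal_expansion_vanishing_order[OF low[OF K'], of 0] by auto
    \<comment> \<open>With parameter 0 the Gamma quotient equals 1, the value of
      \<open>kernel_coeff\<close> in these degrees.\<close>
    have 1: "pairing 0 (low_part s f) (low_part s ?K) = low_part s f w"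
    proof (rule pairing_kernel[OF low[OF f(1)] low[OF K']])
      fix k
      have pos: "0 < ?n + real k" using n by linarith
      then have "Gamma (?n + real k) \<noteq> 0" using less_imp_neq[OF Gamma_real_pos, symmetric] by blast
      then show "(\<lambda>z. if k \<in> ?L then hcomp f k z else 0) = (\<lambda>_. 0) \<or> 0 < ?n + real k - 0 / 2 \<and>
          (\<lambda>z. if k \<in> ?L then hcomp ?K k z else 0)
            = (\<lambda>z. of_real (Gamma (?n + real k) / Gamma (?n + real k - 0 / 2)) * (herm z w ^ k / fact k))"
        using pos False by (cases "k \<in> ?L") (simp_all add: hK q_def[abs_def] kernel_coeff_def s(1))
    next
      show "integrable dV (\<lambda>z. low_part s f z * cnj (low_part s ?K z) * of_real (fock_weight 0 ((norm z)\<^sup>2)))"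
        by (rule integrable_pairing[OF square_integrable_low_part[OF f(1)] square_integrable_low_part[OF K(1)] C C'])
           (use n in auto)
    qed
    \<comment> \<open>The smallest degree present in a high part; exceeding \<alpha>/2, it is a
      vanishing order sufficient for integrability.\<close>
    define m where "m = nat \<lfloor>s\<rfloor> + 1"
    have m: "s < real m" and below: "real k \<le> s" if "k < m" for k
      using s False n that unfolding m_def by linarith+
    have m: "s < real m" unfolding m_def by linarith
    have van: "(\<lambda>z. if k \<in> ?H then hcomp g k z else 0) = (\<lambda>_. 0)" if "k < m" for k and g :: "complex ^ 'n \<Rightarrow> complex"
      using below[OF that] s by auto
    obtain D where D: "0 \<le> D" "\<And>z. norm z \<le> 1 \<Longrightarrow> cmod (high_part s f z) \<le> D * norm z ^ m"
      using normal_expansion_vanishing_order[OF high[OF f(1)] van] by auto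
    obtain D' where D': "0 \<le> D'" "\<And>z. norm z \<le> 1 \<Longrightarrow> cmod (high_part s ?K z) \<le> D' * norm z ^ m"
      using normal_expansion_vanishing_order[OF high[OF K'] van] by auto
    have 2: "pairing \<alpha> (high_part s f) (high_part s ?K) = high_part s f w"
    proof (rule pairing_kernel[OF high[OF f(1)] high[OF K']])
      show "(\<lambda>z. if k \<in> ?H then hcomp f k z else 0) = (\<lambda>_. 0) \<or> 0 < ?n + real k - \<alpha> / 2 \<and>
          (\<lambda>z. if k \<in> ?H then hcomp ?K k z else 0)
            = (\<lambda>z. of_real (Gamma (?n + real k) / Gamma (?n + real k - \<alpha> / 2)) * (herm z w ^ k / fact k))" for k
        using False n by (cases "k \<in> ?H") (simp_all add: hK q_def[abs_def] kernel_coeff_def s(1))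
      show "integrable dV (\<lambda>z. high_part s f z * cnj (high_part s ?K z) * of_real (fock_weight \<alpha> ((norm z)\<^sup>2)))"
        by (rule integrable_pairing[OF square_integrable_high_part[OF f] square_integrable_high_part[OF K] D D'])
           (use n m s in auto)
    qed
    show ?thesis
      using False 1 2 low_plus_high_part[OF f(1), of s w] by (simp add: fock_inner_def s(2))
  qed
qed

section \<open>Hermitian symmetry and identification of the kernel\<close>

lemma fock_inner_hermitian:
  fixes f g :: "complex ^ 'n \<Rightarrow> complex"
  shows "fock_inner \<alpha> g f = cnj (fock_inner \<alpha> f g)"
proof -
  have pair: "pairing \<beta> \<psi> \<phi> = cnj (pairing \<beta> \<phi> \<psi>)" for \<beta> and \<phi> \<psi> :: "complex ^ 'n \<Rightarrow> complex"
  proof -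
    let ?W = "\<lambda>z :: complex ^ 'n. complex_of_real (exp (- (norm z)\<^sup>2) * norm z powr (- \<beta>))"
    have "(\<integral>z. \<psi> z * cnj (\<phi> z) * ?W z \<partial>dV) = (\<integral>z. cnj (\<phi> z * cnj (\<psi> z) * ?W z) \<partial>dV)"
      by (rule Bochner_Integration.integral_cong) auto
    also have "\<dots> = cnj (\<integral>z. \<phi> z * cnj (\<psi> z) * ?W z \<partial>dV)"
      by (rule Bochner_Integration.integral_cnj)
    finally show ?thesis unfolding pairing_def .
  qed
  show ?thesis
    unfolding fock_inner_def pair[of \<alpha> g f] pair[of 0 "low_part (\<alpha> / 2) g" "low_part (\<alpha> / 2) f"]
      pair[of \<alpha> "high_part (\<alpha> / 2) g" "high_part (\<alpha> / 2) f"]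
    by simp
qed

lemma explicit_kernel_hermitian:
  fixes w z :: "complex ^ 'n"
  shows "cnj (explicit_kernel \<alpha> z w) = explicit_kernel \<alpha> w z"
proof -
  have "(\<lambda>k. cnj (of_real (kernel_coeff CARD('n) \<alpha> k) * herm w z ^ k / fact k)) sums cnj (explicit_kernel \<alpha> z w)"
    using explicit_kernel_sums by (simp only: sums_cnj)
  then have "(\<lambda>k. of_real (kernel_coeff CARD('n) \<alpha> k) * herm z w ^ k / fact k) sums cnj (explicit_kernel \<alpha> z w)"
    by (simp add: cnj_herm)
  then show ?thesis using explicit_kernel_sums sums_unique2 by blast
qed

lemma fock_kernel_eq: "fock_kernel \<alpha> w = explicit_kernel \<alpha> w"
  unfolding fock_kernel_def
proof (rule the_equality)
  show "explicit_kernel \<alpha> w \<in> fock_space \<alpha> \<and> (\<forall>f\<in>fock_space \<alpha>. f w = fock_inner \<alpha> f (explicit_kernel \<alpha> w))"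
    using explicit_kernel_in_fock_space explicit_kernel_reproducing by metis
next
  fix K assume K: "K \<in> fock_space \<alpha> \<and> (\<forall>f\<in>fock_space \<alpha>. f w = fock_inner \<alpha> f K)"
  show "K = explicit_kernel \<alpha> w"
  proof
    fix z
    have "K z = fock_inner \<alpha> K (explicit_kernel \<alpha> z)"
      using K explicit_kernel_reproducing by metis
    also have "\<dots> = cnj (fock_inner \<alpha> (explicit_kernel \<alpha> z) K)"
      by (rule fock_inner_hermitian)
    also have "fock_inner \<alpha> (explicit_kernel \<alpha> z) K = explicit_kernel \<alpha> z w"
      using K explicit_kernel_in_fock_space by metis
    finally show "K z = explicit_kernel \<alpha> w z"
      by (simp add: explicit_kernel_hermitian)
  qed
qed

section \<open>Comparison with the fractional operator\<close>

lemma hcomp_exp_kernel: "hcomp (exp_kernel w) = (\<lambda>k z. herm z w ^ k / fact k)"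
  using normal_expansion_exp_kernel by (rule normal_expansion_hcomp)

lemma suminf_split_finite:
  fixes t :: "nat \<Rightarrow> 'a::real_normed_vector"
  assumes "t sums S" "finite A"
  shows "S = (\<Sum>k. if k \<in> A then 0 else t k) + sum t A"
proof -
  have "(\<lambda>k. t k - (if k \<in> A then t k else 0)) sums (S - sum t A)"
    using assms by (intro sums_diff sums_If_finite_set)
  then have "(\<lambda>k. if k \<in> A then 0 else t k) sums (S - sum t A)"
    by (rule sums_cong[THEN iffD1, rotated]) auto
  then show ?thesis by (simp add: sums_iff)
qed

theorem theorem4p5:
  fixes \<alpha> :: real and z w :: "complex ^ 'n"
  shows "fock_kernel \<alpha> w z = frac_op (- \<alpha> / 2) (exp_kernel w) z + error_term \<alpha> z w \<and>
         (\<alpha> \<ge> 2 * real CARD('n) \<longrightarrow>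
            low_part (\<alpha> / 2) (exp_kernel w) z = (\<Sum>k | real k \<le> \<alpha> / 2. herm z w ^ k / fact k))"
proof
  let ?n = "real CARD('n)"
  have n: "1 \<le> ?n" by (simp add: Suc_le_eq)
  have low: "low_part (\<alpha> / 2) (exp_kernel w) z = (\<Sum>k | real k \<le> \<alpha> / 2. herm z w ^ k / fact k)" if "0 \<le> \<alpha>"
    using that by (simp add: low_part_def hcomp_exp_kernel)
  then show "\<alpha> \<ge> 2 * ?n \<longrightarrow> low_part (\<alpha> / 2) (exp_kernel w) z = (\<Sum>k | real k \<le> \<alpha> / 2. herm z w ^ k / fact k)"
    using n by auto
  define t where "t k = of_real (kernel_coeff CARD('n) \<alpha> k) * herm z w ^ k / fact k" for k
  have t: "t sums explicit_kernel \<alpha> w z" unfolding t_def by (rule explicit_kernel_sums)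
  have "explicit_kernel \<alpha> w z = frac_op (- \<alpha> / 2) (exp_kernel w) z + error_term \<alpha> z w"
  proof (cases "\<alpha> \<le> 0")
    case True
    \<comment> \<open>Here every coefficient is the Gamma quotient, and the operator, of order
      -\<alpha>/2 \<ge> 0, runs over all degrees; nothing is left for the error term.\<close>
    have "\<not> 2 * ?n \<le> \<alpha>" using True n by linarith
    with True have "frac_op (- \<alpha> / 2) (exp_kernel w) z = (\<Sum>k. t k)"
      unfolding frac_op_def hcomp_exp_kernel t_def
      by (intro suminf_cong) (auto simp: kernel_coeff_def algebra_simps)
    with True t show ?thesis by (simp add: error_term_def sums_iff)
  next
    case False
    let ?L = "{k. real k \<le> \<alpha> / 2}"
    \<comment> \<open>The order is now negative, so the operator omits exactly the degrees k \<le>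
      \<alpha>/2, which the error term restores with the coefficient appropriate to the range of
      \<alpha>.\<close>
    have "frac_op (- \<alpha> / 2) (exp_kernel w) z = (\<Sum>k. if k \<in> ?L then 0 else t k)"
      using False unfolding frac_op_def hcomp_exp_kernel t_def
      by (intro suminf_cong) (auto simp: kernel_coeff_def algebra_simps)
    moreover have "error_term \<alpha> z w = sum t ?L"
      using False low unfolding error_term_def t_def
      by (auto intro!: sum.cong simp: kernel_coeff_def)
    ultimately show ?thesis
      using suminf_split_finite[OF t finite_low_degrees[of "\<alpha> / 2"]] by simp
  qed
  then show "fock_kernel \<alpha> w z = frac_op (- \<alpha> / 2) (exp_kernel w) z + error_term \<alpha> z w"
    by (simp add: fock_kernel_eq)
qed

end
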